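(* Let $n \ge 3$ and $L > 0$, let $M = [0,L] \times \mathbb{S}^{n-1}$, and let $g_1$ be a metric of revolution on $M$. Then there exists a metric of revolution $g_2$ on $M$ such that for every integer $k \ge 1$, $$\sigma_k(M,g_1) < \sigma_k(M,g_2).$$
   Context: Metric of revolution: for $L>0$ and $M=[0,L]\times\mathbb{S}^{n-1}$, a metric of revolution on $M$ is a Riemannian metric of the form $g(r,p) = dr^2 + h^2(r) g_0(p)$, $(r,p)\in[0,L]\times\mathbb{S}^{n-1}$, where $g_0$ is the canonical metric of the unit $(n-1)$-sphere and $h:[0,L]\to(0,\infty)$ is a smooth function satisfying (1) $|h'(r)|\le 1$ for all $r\in[0,L]$ and (2) $h(0)=h(L)=1$. One says $g$ is induced by $h$; $(M,g)$ is called a hypersurface of revolution (in Euclidean space, with two boundary components each isometric to $\mathbb{S}^{n-1}$), and $L$ is its meridian length. Steklov eigenvalues: for a smooth compact connected Riemannian manifold $(M,g)$ with smooth boundary $\Sigma$, these are the real numbers $\sigma$ for which there is a nonzero harmonic function $f:M\to\mathbb{R}$ with $\partial_\nu f = \sigma f$ on $\Sigma$ ($\nu$ the outward unit normal). They form a sequence $0=\sigma_0(M,g)<\sigma_1(M,g)\le\sigma_2(M,g)\le\dots\nearrow\infty$, repeated according to multiplicity. *)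

theory Defs
  imports "HOL-Analysis.Analysis" "HOL-Library.Function_Algebras"
begin

section \<open>Smooth functions\<close>

text \<open>
  \<open>Ck_on k f U\<close> says that \<open>f\<close> is of class C^k on the open set \<open>U\<close>. The domain is meant to be
  finite-dimensional, so that continuity of all directional derivatives is continuity of the
  derivative.
\<close>

primrec Ck_on :: "nat \<Rightarrow> ('a::real_normed_vector \<Rightarrow> 'b::real_normed_vector) \<Rightarrow> 'a set \<Rightarrow> bool" where
  "Ck_on 0 f U \<longleftrightarrow> continuous_on U f"
| "Ck_on (Suc k) f U \<longleftrightarrow>
     (\<forall>x\<in>U. f differentiable (at x)) \<and> (\<forall>v. Ck_on k (\<lambda>x. frechet_derivative f (at x) v) U)"

text \<open>
  On a set that is not open (a compact interval, a manifold with boundary), smooth means being the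
  restriction of a smooth function defined on an open neighbourhood in the ambient space.
\<close>

definition smooth_on :: "('a::real_normed_vector \<Rightarrow> 'b::real_normed_vector) \<Rightarrow> 'a set \<Rightarrow> bool" where
  "smooth_on f S \<longleftrightarrow>
     (\<exists>U F. open U \<and> S \<subseteq> U \<and> (\<forall>k. Ck_on k F U) \<and> (\<forall>x\<in>S. F x = f x))"


section \<open>The manifold and its metrics\<close>

text \<open>
  The unit sphere of \<open>real^'n\<close> is the (n-1)-sphere for \<open>n = CARD('n)\<close>, and the product manifold is
  a submanifold with boundary of \<open>real \<times> (real^'n)\<close>. A tangent vector at a point is an
  ambient vector \<open>(\<rho>, v)\<close>, where \<open>\<rho>\<close> is the component along the interval and \<open>v\<close> is tangent to
  the sphere.
\<close>

definition cyl :: "real \<Rightarrow> (real \<times> (real^'n::finite)) set" where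
  "cyl L = {0..L} \<times> sphere 0 1"

definition cyl_interior :: "real \<Rightarrow> (real \<times> (real^'n::finite)) set" where
  "cyl_interior L = {0<..<L} \<times> sphere 0 1"

definition cyl_boundary :: "real \<Rightarrow> (real \<times> (real^'n::finite)) set" where
  "cyl_boundary L = {0, L} \<times> sphere 0 1"

definition cyl_tangent :: "real \<times> (real^'n::finite) \<Rightarrow> (real \<times> (real^'n)) set" where
  "cyl_tangent q = {(\<rho>, v). v \<bullet> snd q = 0}"

definition boundary_tangent :: "real \<times> (real^'n::finite) \<Rightarrow> (real \<times> (real^'n)) set" where
  "boundary_tangent q = {(\<rho>, v). \<rho> = 0 \<and> v \<bullet> snd q = 0}"

text \<open>
  A metric tensor takes a point and two tangent vectors. Its values at points outside the manifold
  or on vectors that are not tangent are irrelevant.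
\<close>

type_synonym 'n metric_tensor =
  "real \<times> (real^'n) \<Rightarrow> real \<times> (real^'n) \<Rightarrow> real \<times> (real^'n) \<Rightarrow> real"

text \<open>
  The canonical metric of the unit sphere is the restriction of the inner product of \<open>real^'n\<close>.
\<close>

definition induced_by :: "real \<Rightarrow> (real \<Rightarrow> real) \<Rightarrow> 'n::finite metric_tensor \<Rightarrow> bool" where
  "induced_by L h g \<longleftrightarrow>
     (\<forall>(r, p)\<in>cyl L. \<forall>(\<rho>, v)\<in>cyl_tangent (r, p). \<forall>(\<rho>', v')\<in>cyl_tangent (r, p).
        g (r, p) (\<rho>, v) (\<rho>', v') = \<rho> * \<rho>' + (h r)\<^sup>2 * (v \<bullet> v'))"

definition metric_of_revolution :: "real \<Rightarrow> 'n::finite metric_tensor \<Rightarrow> bool" where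
  "metric_of_revolution L g \<longleftrightarrow>
     (\<exists>h. smooth_on h {0..L} \<and> (\<forall>r\<in>{0..L}. 0 < h r) \<and>
          (\<forall>r\<in>{0..L}. \<exists>d. (h has_real_derivative d) (at r within {0..L}) \<and> \<bar>d\<bar> \<le> 1) \<and>
          h 0 = 1 \<and> h L = 1 \<and> induced_by L h g)"


section \<open>The Laplace-Beltrami operator\<close>

text \<open>
  The cylinder is covered by a single chart: \<open>(r, p) \<mapsto> (1 + r) p\<close> is a diffeomorphism onto the
  closed annulus with radii \<open>1\<close> and \<open>1 + L\<close> in \<open>real^'n\<close>, with inverse \<open>cyl_param\<close>. The
  Laplace-Beltrami operator of any metric \<open>g\<close> is given by its usual expression in this chart, where
  \<open>G\<close> below is the Gram matrix of the coordinate vector fields: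
  (det G)^(-1/2) times the sum over i, j of d_i ((det G)^(1/2) G^(ij) d_j f).
\<close>

definition cyl_chart :: "real \<times> (real^'n::finite) \<Rightarrow> real^'n" where
  "cyl_chart q = (1 + fst q) *\<^sub>R snd q"

definition cyl_param :: "real^'n::finite \<Rightarrow> real \<times> (real^'n)" where
  "cyl_param x = (norm x - 1, x /\<^sub>R norm x)"

definition partial_deriv :: "'n::finite \<Rightarrow> (real^'n \<Rightarrow> real) \<Rightarrow> real^'n \<Rightarrow> real" where
  "partial_deriv i F x = frechet_derivative F (at x) (axis i 1)"

definition metric_matrix :: "'n::finite metric_tensor \<Rightarrow> real^'n \<Rightarrow> real^'n^'n" where
  "metric_matrix g x = (\<chi> i j. g (cyl_param x)
     (frechet_derivative cyl_param (at x) (axis i 1))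
     (frechet_derivative cyl_param (at x) (axis j 1)))"

definition laplace_beltrami ::
  "'n::finite metric_tensor \<Rightarrow> (real \<times> (real^'n) \<Rightarrow> real) \<Rightarrow> real \<times> (real^'n) \<Rightarrow> real" where
  "laplace_beltrami g f q =
     (let G = metric_matrix g; F = f \<circ> cyl_param; x = cyl_chart q
      in 1 / sqrt (det (G x)) *
         (\<Sum>i\<in>UNIV. partial_deriv i
            (\<lambda>y. \<Sum>j\<in>UNIV. sqrt (det (G y)) * matrix_inv (G y) $ i $ j * partial_deriv j F y) x))"

lemma cyl_chart_param:
  assumes "x \<noteq> 0"
  shows "cyl_chart (cyl_param x) = x"
  using assms by (simp add: cyl_chart_def cyl_param_def)

lemma cyl_param_chart:
  assumes "q \<in> cyl L"
  shows "cyl_param (cyl_chart q) = q"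
  using assms by (cases q) (auto simp: cyl_chart_def cyl_param_def cyl_def)

lemma bij_betw_cyl_chart:
  "bij_betw cyl_chart (cyl L) {x :: real^'n::finite. 1 \<le> norm x \<and> norm x \<le> 1 + L}"
proof (rule bij_betwI[where g = cyl_param])
  show "cyl_chart \<in> cyl L \<rightarrow> {x. 1 \<le> norm x \<and> norm x \<le> 1 + L}"
    by (auto simp: cyl_chart_def cyl_def)
  show "cyl_param \<in> {x :: real^'n. 1 \<le> norm x \<and> norm x \<le> 1 + L} \<rightarrow> cyl L"
  proof
    fix x :: "real^'n" assume "x \<in> {x. 1 \<le> norm x \<and> norm x \<le> 1 + L}"
    moreover from this have "norm x \<noteq> 0" by auto
    ultimately show "cyl_param x \<in> cyl L"
      by (auto simp: cyl_param_def cyl_def)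
  qed
  show "cyl_param (cyl_chart q) = q" if "q \<in> cyl L" for q :: "real \<times> (real^'n)"
    using that by (rule cyl_param_chart)
  show "cyl_chart (cyl_param x) = x" if "x \<in> {x. 1 \<le> norm x \<and> norm x \<le> 1 + L}" for x :: "real^'n"
    using that by (intro cyl_chart_param) auto
qed


section \<open>Steklov eigenvalues\<close>

definition outward_unit_normal ::
  "real \<Rightarrow> 'n::finite metric_tensor \<Rightarrow> real \<times> (real^'n) \<Rightarrow> real \<times> (real^'n) \<Rightarrow> bool" where
  "outward_unit_normal L g q \<nu> \<longleftrightarrow>
     \<nu> \<in> cyl_tangent q \<and> g q \<nu> \<nu> = 1 \<and> (\<forall>w\<in>boundary_tangent q. g q \<nu> w = 0) \<and>
     (fst q = 0 \<longrightarrow> fst \<nu> < 0) \<and> (fst q = L \<longrightarrow> 0 < fst \<nu>)"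

text \<open>
  A derivative within the cylinder at a point is determined only on tangent vectors, which is all
  that is used here.
\<close>

definition has_normal_derivative ::
  "real \<Rightarrow> 'n::finite metric_tensor \<Rightarrow> (real \<times> (real^'n) \<Rightarrow> real) \<Rightarrow> real \<Rightarrow> real \<times> (real^'n) \<Rightarrow> bool" where
  "has_normal_derivative L g f c q \<longleftrightarrow>
     (\<exists>\<nu> D. outward_unit_normal L g q \<nu> \<and> (f has_derivative D) (at q within cyl L) \<and> D \<nu> = c)"

text \<open>
  Functions on the cylinder are represented by functions on the ambient space that vanish outside
  the cylinder, so that linear independence and dimension are those of functions on the cylinder.
\<close>

definition steklov_eigenspace ::
  "real \<Rightarrow> 'n::finite metric_tensor \<Rightarrow> real \<Rightarrow> (real \<times> (real^'n) \<Rightarrow> real) set" where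
  "steklov_eigenspace L g \<sigma> =
     {f. (\<forall>q. q \<notin> cyl L \<longrightarrow> f q = 0) \<and> smooth_on f (cyl L) \<and>
         (\<forall>q\<in>cyl_interior L. laplace_beltrami g f q = 0) \<and>
         (\<forall>q\<in>cyl_boundary L. has_normal_derivative L g f (\<sigma> * f q) q)}"

interpretation fun_space: vector_space "\<lambda>c (f :: 'a \<Rightarrow> real) x. c * f x"
  by unfold_locales (auto simp: fun_eq_iff algebra_simps)

definition has_finite_dim :: "('a \<Rightarrow> real) set \<Rightarrow> nat \<Rightarrow> bool" where
  "has_finite_dim V d \<longleftrightarrow>
     (\<exists>B. finite B \<and> card B = d \<and> fun_space.independent B \<and> fun_space.span B = V)"

text \<open>
  The nondecreasing enumeration, starting at index 0, of all Steklov eigenvalues, in which each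
  real number occurs as often as the dimension of its eigenspace (zero times if it is not an
  eigenvalue). Such a sequence is unique if it exists.
\<close>

definition steklov_spectrum :: "real \<Rightarrow> 'n::finite metric_tensor \<Rightarrow> (nat \<Rightarrow> real) \<Rightarrow> bool" where
  "steklov_spectrum L g s \<longleftrightarrow>
     mono s \<and> filterlim s at_top sequentially \<and>
     (\<forall>\<tau>. has_finite_dim (steklov_eigenspace L g \<tau>) (card {k. s k = \<tau>}))"

definition steklov_eigenvalue :: "real \<Rightarrow> 'n::finite metric_tensor \<Rightarrow> nat \<Rightarrow> real" where
  "steklov_eigenvalue L g k = (THE s. steklov_spectrum L g s) k"

end

theory Submission
  imports Defs
begin

text \<open>
  Separate variables. Let \<open>Y\<^sub>k\<close> run through an orthogonal basis of spherical harmonics, with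
  eigenvalues \<open>\<lambda>\<^sub>k\<close>. Then \<open>u(r) Y\<^sub>k(p)\<close> is harmonic for \<open>dr\<^sup>2 + h\<^sup>2 g\<^sub>0\<close> iff
  \<open>(h\<^bsup>n-1\<^esup> u')' = \<lambda>\<^sub>k h\<^bsup>n-3\<^esup> u\<close>, so each \<open>k\<close> contributes the two eigenvalues of a symmetric
  \<open>2 \<times> 2\<close> Dirichlet-to-Neumann matrix, and every Steklov eigenvalue arises in this way. The
  quadratic form of that matrix is the minimum of \<open>\<integral> h\<^bsup>n-1\<^esup> u'\<^sup>2 + \<lambda>\<^sub>k h\<^bsup>n-3\<^esup> u\<^sup>2\<close> under the given
  boundary values. For \<open>n \<ge> 3\<close> it is monotone in \<open>h\<close>, and strictly so by unique continuation, except
  on the constant function. Finally \<open>|h'| \<le> 1\<close> and \<open>h 0 = h L = 1\<close> force \<open>h\<close> to stay below a tent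
  with a corner, which a smooth profile cannot fill; so there is a larger admissible profile.
\<close>

section \<open>Calculus of functions of class C^k\<close>

text \<open>Eigenvalues are defined through a nondecreasing sequence recording the exact dimension
  of every eigenspace, so a variational inequality on the cylinder would not be enough: each smooth
  Steklov eigenfunction has to be written as a finite combination of separated modes. Then, since
  one basis of harmonics serves both metrics, modes with the same index \<open>(k, e)\<close> are
  compared, and a counting argument carries the inequality over to the sorted sequences.

  Energies of radial solutions are boundary values \<open>v L * u L - v 0 * u 0\<close>, and
  inequalities between integrals become monotonicity of a function of r. The surface integral is
  replaced by a Lebesgue integral over a shell, and the spherical Laplacian by second derivatives
  along rotations, so that its symmetry follows from rotation invariance.

  For n = 3 the exponent n - 3 is zero, so strictness has to come from the weight
  \<open>h ^ (n - 1)\<close> alone; a single radius where the larger profile is strictly above is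
  enough. The modes are built on an interval longer than [0, L], since smoothness up to the boundary
  means extendability.\<close>

lemma Ck_on_cong:
  assumes "open U" "Ck_on k f U" "\<And>x. x \<in> U \<Longrightarrow> f x = g x"
  shows "Ck_on k g U"
  using assms(2,3)
proof (induction k arbitrary: f g)
  case 0
  then show ?case by (auto cong: continuous_on_cong)
next
  case (Suc k)
  have D: "(g has_derivative frechet_derivative f (at x)) (at x)" if "x \<in> U" for x
    using Suc.prems that \<open>open U\<close>
    by (auto intro: has_derivative_transform_within_open simp: frechet_derivative_works)
  then have "frechet_derivative f (at x) = frechet_derivative g (at x)" if "x \<in> U" for x
    using frechet_derivative_at that by metis
  then show ?case
    using D Suc.prems Suc.IH[of "\<lambda>x. frechet_derivative f (at x) v" "\<lambda>x. frechet_derivative g (at x) v" for v]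
    by (auto simp: differentiable_def)
qed

lemma Ck_onI:
  assumes "open U" "\<And>x. x \<in> U \<Longrightarrow> (f has_derivative D x) (at x)"
    and "\<And>v. Ck_on k (\<lambda>x. D x v) U"
  shows "Ck_on (Suc k) f U"
proof -
  have "D x = frechet_derivative f (at x)" if "x \<in> U" for x
    using assms(2)[OF that] frechet_derivative_at by metis
  then have "Ck_on k (\<lambda>x. frechet_derivative f (at x) v) U" for v
    by (intro Ck_on_cong[OF assms(1) assms(3)]) auto
  then show ?thesis
    using assms(2) by (auto simp: differentiable_def)
qed

lemma Ck_on_Suc_lower:
  assumes "Ck_on (Suc k) f U" shows "Ck_on k f U"
  using assms
proof (induction k arbitrary: f)
  case 0
  then show ?case
    by (simp add: continuous_at_imp_continuous_on differentiable_imp_continuous_within)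
qed auto

lemma Ck_on_subset:
  assumes "Ck_on k f U" "V \<subseteq> U" shows "Ck_on k f V"
  using assms(1) by (induction k arbitrary: f) (use assms(2) in \<open>auto intro: continuous_on_subset\<close>)

lemma Ck_on_const: "open U \<Longrightarrow> Ck_on k (\<lambda>x. c) U"
  by (induction k arbitrary: c) (auto simp: frechet_derivative_const)

lemma Ck_on_bounded_linear:
  assumes "open U" "bounded_linear f" shows "Ck_on k f U"
proof (cases k)
  case 0
  then show ?thesis using assms by (auto intro: linear_continuous_on)
next
  case (Suc m)
  show ?thesis unfolding Suc
    using assms by (intro Ck_onI[where D = "\<lambda>x. f"] Ck_on_const) (auto intro: bounded_linear_imp_has_derivative)
qed

lemma Ck_on_add:
  assumes "open U" "Ck_on k f U" "Ck_on k g U"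
  shows "Ck_on k (\<lambda>x. f x + g x) U"
  using assms(2,3)
proof (induction k arbitrary: f g)
  case 0
  then show ?case by (auto intro: continuous_intros)
next
  case (Suc k)
  then show ?case
    by (intro Ck_onI[OF \<open>open U\<close>, where D = "\<lambda>x v. frechet_derivative f (at x) v + frechet_derivative g (at x) v"])
      (auto intro!: has_derivative_add simp: frechet_derivative_works)
qed

lemma Ck_on_mult:
  fixes f g :: "'a::real_normed_vector \<Rightarrow> real"
  assumes "open U" "Ck_on k f U" "Ck_on k g U"
  shows "Ck_on k (\<lambda>x. f x * g x) U"
  using assms(2,3)
proof (induction k arbitrary: f g)
  case 0
  then show ?case by (auto intro: continuous_intros)
next
  case (Suc k)
  have "Ck_on k (\<lambda>x. f x * frechet_derivative g (at x) v + frechet_derivative f (at x) v * g x) U" for v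
    using Suc.prems Ck_on_Suc_lower[OF Suc.prems(1)] Ck_on_Suc_lower[OF Suc.prems(2)]
    by (intro Ck_on_add Suc.IH \<open>open U\<close>) auto
  with Suc.prems show ?case
    by (intro Ck_onI[OF \<open>open U\<close>, where D = "\<lambda>x v. f x * frechet_derivative g (at x) v + frechet_derivative f (at x) v * g x"])
      (auto intro!: has_derivative_mult simp: frechet_derivative_works)
qed

lemma Ck_on_power:
  fixes f :: "'a::real_normed_vector \<Rightarrow> real"
  assumes "open U" "Ck_on k f U"
  shows "Ck_on k (\<lambda>x. f x ^ m) U"
  by (induction m) (auto intro: Ck_on_const Ck_on_mult assms)

lemma Ck_on_inverse:
  fixes f :: "'a::real_normed_vector \<Rightarrow> real"
  assumes "open U" "Ck_on k f U" "\<And>x. x \<in> U \<Longrightarrow> f x \<noteq> 0"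
  shows "Ck_on k (\<lambda>x. inverse (f x)) U"
  using assms(2)
proof (induction k)
  case 0
  then show ?case using assms(3) by (auto intro: continuous_intros)
next
  case (Suc k)
  let ?D = "\<lambda>x v. (-1) * (inverse (f x) * frechet_derivative f (at x) v * inverse (f x))"
  have "Ck_on k (\<lambda>x. ?D x v) U" for v
    using Suc.prems Ck_on_Suc_lower[OF Suc.prems]
    by (intro Ck_on_mult Ck_on_const Suc.IH \<open>open U\<close>) auto
  moreover have "((\<lambda>x. inverse (f x)) has_derivative ?D x) (at x)" if "x \<in> U" for x
    using Suc.prems that assms(3)
    by (auto intro!: derivative_eq_intros simp: frechet_derivative_works)
  ultimately show ?case
    by (intro Ck_onI[OF \<open>open U\<close>]) auto
qed

lemma Ck_on_compose_linear:
  assumes "open U" "open V" "bounded_linear l" "l ` U \<subseteq> V" "Ck_on k f V"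
  shows "Ck_on k (\<lambda>x. f (l x)) U"
  using assms(5)
proof (induction k arbitrary: f)
  case 0
  then show ?case
    using continuous_on_compose2[OF _ linear_continuous_on[OF assms(3)] assms(4), of f] by simp
next
  case (Suc k)
  let ?D = "\<lambda>x v. frechet_derivative f (at (l x)) (l v)"
  have "Ck_on k (\<lambda>x. ?D x v) U" for v
    using Suc.prems Suc.IH[of "\<lambda>y. frechet_derivative f (at y) (l v)"] by simp
  moreover have "((\<lambda>x. f (l x)) has_derivative ?D x) (at x)" if "x \<in> U" for x
  proof -
    have "(f has_derivative frechet_derivative f (at (l x))) (at (l x))"
      using Suc.prems that assms(4) by (auto simp: frechet_derivative_works)
    from has_derivative_compose[OF bounded_linear_imp_has_derivative[OF assms(3)] this]
    show ?thesis .
  qed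
  ultimately show ?case
    by (intro Ck_onI[OF \<open>open U\<close>]) auto
qed

lemma Ck_on_SucI_real:
  fixes f :: "real \<Rightarrow> real"
  assumes "open U" "\<And>x. x \<in> U \<Longrightarrow> (f has_real_derivative f' x) (at x)" "Ck_on k f' U"
  shows "Ck_on (Suc k) f U"
  using assms
  by (intro Ck_onI[where D = "\<lambda>x v. f' x * v"] Ck_on_mult Ck_on_const)
    (auto simp: has_field_derivative_def)

lemma Ck_on_Suc_real:
  fixes f :: "real \<Rightarrow> real"
  assumes "open U" "Ck_on (Suc k) f U"
  shows "Ck_on k (deriv f) U" and "\<And>x. x \<in> U \<Longrightarrow> (f has_real_derivative deriv f x) (at x)"
proof -
  show D: "(f has_real_derivative deriv f x) (at x)" if "x \<in> U" for x
    using assms that by (auto intro!: DERIV_imp_deriv simp: real_differentiable_def[symmetric] DERIV_deriv_iff_real_differentiable)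
  have "frechet_derivative f (at x) 1 = deriv f x" if "x \<in> U" for x
    using D[OF that] by (metis frechet_derivative_at has_field_derivative_def mult.right_neutral)
  then show "Ck_on k (deriv f) U"
    using assms by (auto intro: Ck_on_cong)
qed

lemma Ck_on_real_polynomial_function:
  assumes "open U" "real_polynomial_function p"
  shows "Ck_on k p U"
  using assms(2)
  by (induction) (auto intro: Ck_on_const Ck_on_add Ck_on_mult Ck_on_bounded_linear assms(1))

section \<open>Linear systems on an interval\<close>

lemma constant_on_closed_intervalI:
  fixes f :: "real \<Rightarrow> real"
  assumes "a < b" "continuous_on {a..b} f" "\<And>t. \<lbrakk>a < t; t < b\<rbrakk> \<Longrightarrow> f t = c" "t \<in> {a..b}"
  shows "f t = c"
  using continuous_constant_on_closure[of "{a<..<b}" f c t] assms by auto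

lemma deriv_nonneg_imp_mono_closed:
  fixes f :: "real \<Rightarrow> real"
  assumes "continuous_on {a..b} f" "\<And>t. \<lbrakk>a < t; t < b\<rbrakk> \<Longrightarrow> (f has_real_derivative f' t) (at t)"
    and "\<And>t. \<lbrakk>a < t; t < b\<rbrakk> \<Longrightarrow> 0 \<le> f' t" and "s \<in> {a..b}" "t \<in> {a..b}" "s \<le> t"
  shows "f s \<le> f t"
proof (rule DERIV_nonneg_imp_increasing_open[OF \<open>s \<le> t\<close>])
  show "\<exists>y. (f has_real_derivative y) (at x) \<and> 0 \<le> y" if "s < x" "x < t" for x
    using assms that by (intro exI[of _ "f' x"]) auto
  show "continuous_on {s..t} f"
    using assms by (auto intro: continuous_on_subset)
qed

text \<open>Takes the place of the fact that a continuous nonnegative integrand with integral zero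
  vanishes: energies appear as differences of end values of a function whose derivative is the
  energy density.\<close>

lemma nondecreasing_ends_deriv_zero:
  fixes f :: "real \<Rightarrow> real"
  assumes "continuous_on {a..b} f" "\<And>t. \<lbrakk>a < t; t < b\<rbrakk> \<Longrightarrow> (f has_real_derivative f' t) (at t)"
    and "\<And>t. \<lbrakk>a < t; t < b\<rbrakk> \<Longrightarrow> 0 \<le> f' t" and "f b \<le> f a" "a < t" "t < b"
  shows "f' t = 0"
proof -
  have mono: "f r \<le> f s" if "r \<in> {a..b}" "s \<in> {a..b}" "r \<le> s" for r s
    by (rule deriv_nonneg_imp_mono_closed[OF assms(1-3)]) (use that in auto)
  have const: "f a = f s" if "s \<in> {a<..<b}" for s
    using mono[of a s] mono[of s b] that assms(4) by auto
  have "((\<lambda>_. f a) has_real_derivative f' t) (at t)"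
    using DERIV_cong_ev[of t t f "\<lambda>_. f a" "f' t" "f' t"] assms(2)[OF assms(5,6)] const assms(5,6)
    by (smt (verit, best) eventually_at_topological greaterThanLessThan_iff has_field_derivative_transform_within_open open_greaterThanLessThan)
  then show ?thesis
    using DERIV_const DERIV_unique by blast
qed

text \<open>Gronwall: the derivative of \<open>u\<^sup>2 + v\<^sup>2\<close> is at most
  \<open>M\<close> times the function in absolute value, so multiplied by exp (-M t) it does not
  increase to the right of \<open>t0\<close>, and multiplied by exp (M t) it does not decrease to
  the left. Both directions are needed, since Cauchy data will also be given at an interior
  point.\<close>

lemma linear_system_zero:
  fixes u v P Q :: "real \<Rightarrow> real"
  assumes cont: "continuous_on {a..b} u" "continuous_on {a..b} v"
    and u: "\<And>t. \<lbrakk>a < t; t < b\<rbrakk> \<Longrightarrow> (u has_real_derivative P t * v t) (at t)"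
    and v: "\<And>t. \<lbrakk>a < t; t < b\<rbrakk> \<Longrightarrow> (v has_real_derivative Q t * u t) (at t)"
    and M: "\<And>t. \<lbrakk>a < t; t < b\<rbrakk> \<Longrightarrow> \<bar>P t\<bar> + \<bar>Q t\<bar> \<le> M"
    and t0: "t0 \<in> {a..b}" "u t0 = 0" "v t0 = 0" and t: "t \<in> {a..b}"
  shows "u t = 0 \<and> v t = 0"
proof -
  define E where "E t = (u t)\<^sup>2 + (v t)\<^sup>2" for t
  define E' where "E' t = 2 * (P t + Q t) * (u t * v t)" for t
  have E: "(E has_real_derivative E' t) (at t)" if "a < t" "t < b" for t
    unfolding E_def E'_def
    by (auto intro!: derivative_eq_intros u v that simp: algebra_simps)
  have bound: "\<bar>E' t\<bar> \<le> M * E t" if "a < t" "t < b" for t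
  proof -
    have "2 * \<bar>u t * v t\<bar> \<le> E t"
      unfolding E_def using sum_squares_bound[of "\<bar>u t\<bar>" "\<bar>v t\<bar>"] by (simp add: abs_mult)
    moreover have "\<bar>P t + Q t\<bar> \<le> M" using M[OF that] by linarith
    moreover have "\<bar>E' t\<bar> = \<bar>P t + Q t\<bar> * (2 * \<bar>u t * v t\<bar>)"
      unfolding E'_def abs_mult by simp
    moreover have "0 \<le> M" using M[OF that] by linarith
    ultimately show ?thesis
      using mult_mono[of "\<bar>P t + Q t\<bar>" M "2 * \<bar>u t * v t\<bar>" "E t"] by simp
  qed
  have cE: "continuous_on {a..b} E"
    unfolding E_def by (intro continuous_intros cont)
  have "E t \<le> 0"
  proof (cases "t0 \<le> t")
    case True
    have "- (E t0 * exp (- M * t0)) \<le> - (E t * exp (- M * t))"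
    proof (rule deriv_nonneg_imp_mono_closed[where f' = "\<lambda>t. (M * E t - E' t) * exp (- M * t)" and f = "\<lambda>t. - (E t * exp (- M * t))"])
      show "continuous_on {a..b} (\<lambda>t. - (E t * exp (- M * t)))"
        by (intro continuous_intros cE)
      show "((\<lambda>t. - (E t * exp (- M * t))) has_real_derivative (M * E t - E' t) * exp (- M * t)) (at t)"
        if "a < t" "t < b" for t
        using E[OF that] by (auto intro!: derivative_eq_intros simp: algebra_simps)
      show "0 \<le> (M * E t - E' t) * exp (- M * t)" if "a < t" "t < b" for t
        using bound[OF that] by simp
    qed (use True t t0 in auto)
    then show ?thesis using t0 by (simp add: E_def zero_le_mult_iff mult_le_0_iff)
  next
    case False
    have "E t * exp (M * t) \<le> E t0 * exp (M * t0)"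
    proof (rule deriv_nonneg_imp_mono_closed[where f' = "\<lambda>t. (M * E t + E' t) * exp (M * t)" and f = "\<lambda>t. (E t * exp (M * t))"])
      show "continuous_on {a..b} (\<lambda>t. (E t * exp (M * t)))"
        by (intro continuous_intros cE)
      show "((\<lambda>t. (E t * exp (M * t))) has_real_derivative (M * E t + E' t) * exp (M * t)) (at t)"
        if "a < t" "t < b" for t
        using E[OF that] by (auto intro!: derivative_eq_intros simp: algebra_simps)
      show "0 \<le> (M * E t + E' t) * exp (M * t)" if "a < t" "t < b" for t
        using bound[OF that] by simp
    qed (use False t t0 in auto)
    then show ?thesis using t0 by (simp add: E_def mult_le_0_iff)
  qed
  then show ?thesis
    by (simp add: E_def sum_power2_le_zero_iff)
qed

text \<open>One Picard step: integrating \<open>M\<close> times the k-th term of the exponential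
  series gives the next term.\<close>

lemma iterated_integral_bound:
  fixes f :: "real \<Rightarrow> real"
  assumes "continuous_on {a..b} f" "\<And>s. s \<in> {a..b} \<Longrightarrow> \<bar>f s\<bar> \<le> M * (C * (M * (s - a)) ^ k / fact k)"
    and "t \<in> {a..b}"
  shows "\<bar>integral {a..t} f\<bar> \<le> C * (M * (t - a)) ^ Suc k / fact (Suc k)"
proof -
  let ?G = "\<lambda>s. C * (M * (s - a)) ^ Suc k / fact (Suc k)"
  let ?g = "\<lambda>s. M * (C * (M * (s - a)) ^ k / fact k)"
  have "(?G has_vector_derivative ?g s) (at s within {a..t})" for s
    unfolding has_real_derivative_iff_has_vector_derivative[symmetric]
    by (rule derivative_eq_intros refl | simp)+
  then have "(?g has_integral ?G t - ?G a) {a..t}"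
    using assms by (intro fundamental_theorem_of_calculus) auto
  then have *: "(?g has_integral ?G t) {a..t}" by simp
  have "norm (integral {a..t} f) \<le> integral {a..t} ?g"
  proof (rule integral_norm_bound_integral)
    show "f integrable_on {a..t}"
      using assms by (intro integrable_continuous_interval) (auto intro: continuous_on_subset)
    show "?g integrable_on {a..t}" using * by blast
  qed (use assms in auto)
  then show ?thesis
    using * integral_unique by (metis real_norm_def)
qed

lemma linear_system_exists:
  fixes P Q :: "real \<Rightarrow> real"
  assumes "a \<le> b" and P: "continuous_on {a..b} P" and Q: "continuous_on {a..b} Q"
  obtains u v where "u a = c" "v a = d"
    "\<And>t. t \<in> {a..b} \<Longrightarrow> (u has_real_derivative P t * v t) (at t within {a..b})"
    "\<And>t. t \<in> {a..b} \<Longrightarrow> (v has_real_derivative Q t * u t) (at t within {a..b})"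
proof -
  \<comment> \<open>The solution is the sum of the increments of the Picard iteration.\<close>
  define S where "S = {a..b}"
  define X where "X = rec_nat (\<lambda>t. c, \<lambda>t. d)
    (\<lambda>_ w. (\<lambda>t. integral {a..t} (\<lambda>s. P s * snd w s), \<lambda>t. integral {a..t} (\<lambda>s. Q s * fst w s)))"
  define U where "U k = fst (X k)" for k
  define V where "V k = snd (X k)" for k
  have U0: "U 0 = (\<lambda>t. c)" and V0: "V 0 = (\<lambda>t. d)"
    and US: "U (Suc k) = (\<lambda>t. integral {a..t} (\<lambda>s. P s * V k s))"
    and VS: "V (Suc k) = (\<lambda>t. integral {a..t} (\<lambda>s. Q s * U k s))" for k
    by (simp_all add: U_def V_def X_def)
  have "bounded (P ` S)" "bounded (Q ` S)"
    using P Q unfolding S_def by (auto intro: compact_imp_bounded compact_continuous_image)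
  then obtain M1 M2 where M1: "\<And>t. t \<in> S \<Longrightarrow> \<bar>P t\<bar> \<le> M1" and M2: "\<And>t. t \<in> S \<Longrightarrow> \<bar>Q t\<bar> \<le> M2"
    by (auto simp: bounded_iff)
  define M where "M = max 0 (max M1 M2)"
  define C where "C = max \<bar>c\<bar> \<bar>d\<bar>"
  have M: "\<bar>P t\<bar> \<le> M" "\<bar>Q t\<bar> \<le> M" if "t \<in> S" for t
    using M1[OF that] M2[OF that] by (auto simp: M_def)
  have M0: "0 \<le> M" by (simp add: M_def)
  have cont_integral: "continuous_on S (\<lambda>t. integral {a..t} f)" if "continuous_on S f" for f :: "real \<Rightarrow> real"
    using that unfolding S_def by (intro indefinite_integral_continuous_1 integrable_continuous_interval)
  have contU: "continuous_on S (U k)" and contV: "continuous_on S (V k)" for k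
    by (induction k) (use P Q in \<open>auto simp: U0 V0 US VS S_def[symmetric] intro!: cont_integral continuous_intros\<close>)
  define bd where "bd k t = C * (M * (t - a)) ^ k / fact k" for k t
  have bd: "\<bar>U k t\<bar> \<le> bd k t \<and> \<bar>V k t\<bar> \<le> bd k t" if "t \<in> S" for k t
    using that
  proof (induction k arbitrary: t)
    case 0
    then show ?case by (auto simp: U0 V0 bd_def C_def)
  next
    case (Suc k)
    have "\<bar>P s * V k s\<bar> \<le> M * (C * (M * (s - a)) ^ k / fact k)"
         "\<bar>Q s * U k s\<bar> \<le> M * (C * (M * (s - a)) ^ k / fact k)" if "s \<in> {a..b}" for s
      using that Suc.IH[of s] M[of s] M0 unfolding abs_mult bd_def S_def
      by (auto simp del: times_divide_eq_right intro!: mult_mono)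
    then show ?case
      using Suc.prems P Q contU contV unfolding bd_def US VS S_def
      by (intro conjI iterated_integral_bound) (auto intro!: continuous_intros)
  qed
  define B where "B k = C * (M * (b - a)) ^ k / fact k" for k
  have bdB: "bd k t \<le> B k" if "t \<in> S" for k t
    using that M0 unfolding bd_def B_def S_def
    by (auto intro!: divide_right_mono mult_left_mono power_mono mult_nonneg_nonneg simp: C_def)
  have sumB: "summable B"
    unfolding B_def using summable_exp_generic[of "M * (b - a)"]
    by (auto intro!: summable_mult simp: divide_inverse scaleR_conv_of_real mult.commute mult.left_commute)
  have dU: "(U (Suc k) has_real_derivative P t * V k t) (at t within S)"
   and dV: "(V (Suc k) has_real_derivative Q t * U k t) (at t within S)" if "t \<in> S" for k t
    using that P Q contU contV unfolding US VS S_def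
    by (auto intro!: integral_has_real_derivative continuous_intros)
  have MP: "norm (P t * V k t) \<le> M * B k" "norm (Q t * U k t) \<le> M * B k" if "t \<in> S" for k t
    using bd[OF that, of k] bdB[OF that, of k] M[OF that] M0
    by (auto simp: abs_mult intro!: mult_mono)
  have sumMB: "summable (\<lambda>k. M * B k)" using sumB by (rule summable_mult)
  \<comment> \<open>The increment of index \<open>Suc k\<close> has derivative \<open>R\<close>
    times the increment of index \<open>k\<close> of the other component, and the constant increment
    of index 0 contributes nothing. Hence the derivatives sum to \<open>R\<close> times the sum of
    the other component.\<close>
  have lim: "\<exists>g. \<forall>x\<in>S. (\<lambda>n. f n x) sums g x \<and> (g has_field_derivative R x * (\<Sum>k. w k x)) (at x within S)"
    if f0: "f 0 = (\<lambda>t. e)" and df: "\<And>k t. t \<in> S \<Longrightarrow> (f (Suc k) has_real_derivative R t * w k t) (at t within S)"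
      and w: "\<And>k t. t \<in> S \<Longrightarrow> norm (R t * w k t) \<le> M * B k"
      and w': "\<And>k t. t \<in> S \<Longrightarrow> norm (w k t) \<le> B k"
      and fa: "\<And>k. f (Suc k) a = 0"
    for f w :: "nat \<Rightarrow> real \<Rightarrow> real" and R :: "real \<Rightarrow> real" and e
  proof -
    define f' where "f' n = (case n of 0 \<Rightarrow> \<lambda>t. 0 | Suc k \<Rightarrow> (\<lambda>t. R t * w k t))" for n
    define B' where "B' n = (case n of 0 \<Rightarrow> 0 | Suc k \<Rightarrow> M * B k)" for n
    have sB': "summable B'"
      using sumMB by (subst summable_Suc_iff[symmetric]) (simp add: B'_def)
    have ul: "uniform_limit S (\<lambda>n x. \<Sum>i<n. f' i x) (\<lambda>x. \<Sum>i. f' i x) sequentially"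
      by (rule Weierstrass_m_test[OF _ sB']) (use w in \<open>auto simp: f'_def B'_def split: nat.splits\<close>)
    have "\<exists>g. \<forall>x\<in>S. (\<lambda>n. f n x) sums g x \<and> (g has_field_derivative (\<Sum>i. f' i x)) (at x within S)"
    proof (rule has_field_derivative_series[OF _ _ ul])
      show "convex S" by (simp add: S_def)
      show "(f n has_field_derivative f' n x) (at x within S)" if "x \<in> S" for n x
        using df[OF that] f0 by (cases n) (auto simp: f'_def)
      show "a \<in> S" using \<open>a \<le> b\<close> by (simp add: S_def)
      show "summable (\<lambda>n. f n a)"
        by (subst summable_Suc_iff[symmetric]) (simp add: fa)
    qed
    moreover have "(\<Sum>i. f' i x) = R x * (\<Sum>k. w k x)" if "x \<in> S" for x
    proof -
      have "summable (\<lambda>i. f' i x)"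
        by (rule summable_comparison_test'[OF sB', of 0]) (use w that in \<open>auto simp: f'_def B'_def split: nat.splits\<close>)
      from suminf_split_head[OF this] have "(\<Sum>i. f' i x) = (\<Sum>k. R x * w k x)"
        by (simp add: f'_def)
      moreover have "summable (\<lambda>k. w k x)"
        by (rule summable_comparison_test'[OF sumB, of 0]) (use w' that in auto)
      ultimately show ?thesis by (simp add: suminf_mult)
    qed
    ultimately show ?thesis by auto
  qed
  have UB: "norm (U k t) \<le> B k" and VB: "norm (V k t) \<le> B k" if "t \<in> S" for k t
    using bd[OF that, of k] bdB[OF that, of k] by auto
  obtain u where u: "\<And>x. x \<in> S \<Longrightarrow> (\<lambda>n. U n x) sums u x \<and> (u has_field_derivative P x * (\<Sum>k. V k x)) (at x within S)"
    using lim[of U c P V, OF U0 dU MP(1) VB] by (auto simp: US)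
  obtain v where v: "\<And>x. x \<in> S \<Longrightarrow> (\<lambda>n. V n x) sums v x \<and> (v has_field_derivative Q x * (\<Sum>k. U k x)) (at x within S)"
    using lim[of V d Q U, OF V0 dV MP(2) UB] by (auto simp: VS)
  have aS: "a \<in> S" using \<open>a \<le> b\<close> by (simp add: S_def)
  have "U n a = 0" "V n a = 0" if "n \<notin> {0}" for n
    using that by (cases n; simp add: US VS)+
  then have "(\<lambda>n. U n a) sums c" "(\<lambda>n. V n a) sums d"
    using sums_finite[of "{0}" "\<lambda>n. U n a"] sums_finite[of "{0}" "\<lambda>n. V n a"]
    by (auto simp: U0 V0)
  then have "u a = c" "v a = d"
    using u[OF aS] v[OF aS] sums_unique2 by blast+
  moreover have "(\<Sum>k. U k x) = u x" "(\<Sum>k. V k x) = v x" if "x \<in> S" for x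
    using u[OF that] v[OF that] by (auto simp: sums_iff)
  ultimately show ?thesis
    using u v that[of u v] by (auto simp: S_def)
qed

section \<open>Sturm--Liouville systems with a spectral parameter in the boundary conditions\<close>

text \<open>The equation \<open>(p u')' = lam q u\<close> as a first-order system for
  \<open>u\<close> and its flux \<open>v = p u'\<close>, which asks for no derivative of
  \<open>p\<close>. Derivatives are taken in the open interval; the ends enter through
  continuity.\<close>

definition sl_sol :: "real \<Rightarrow> (real \<Rightarrow> real) \<Rightarrow> (real \<Rightarrow> real) \<Rightarrow> real \<Rightarrow> (real \<Rightarrow> real) \<Rightarrow> (real \<Rightarrow> real) \<Rightarrow> bool" where
  "sl_sol L p q lam u v \<longleftrightarrow> continuous_on {0..L} u \<and> continuous_on {0..L} v \<and>
     (\<forall>r. 0 < r \<longrightarrow> r < L \<longrightarrow> (u has_real_derivative v r / p r) (at r) \<and>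
                          (v has_real_derivative lam * q r * u r) (at r))"

text \<open>By parts, this is the integral of \<open>p u'\<^sup>2 + lam q u\<^sup>2\<close> for a
  solution, hence the value of the Dirichlet-to-Neumann form at its boundary values.\<close>

definition sl_energy :: "real \<Rightarrow> (real \<Rightarrow> real) \<Rightarrow> (real \<Rightarrow> real) \<Rightarrow> real" where
  "sl_energy L u v = v L * u L - v 0 * u 0"

text \<open>
  \<open>U\<close> is an eigenfunction and \<open>V\<close> its flux \<open>p U'\<close>; the two eigenvalues \<open>\<mu> False \<le> \<mu> True\<close> are
  those of the Dirichlet-to-Neumann matrix of the interval, with eigenvectors \<open>(U 0, U L)\<close>.
\<close>

definition sl_eigen :: "real \<Rightarrow> (real \<Rightarrow> real) \<Rightarrow> (real \<Rightarrow> real) \<Rightarrow> real \<Rightarrow> (bool \<Rightarrow> real) \<Rightarrow>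
    (bool \<Rightarrow> real \<Rightarrow> real) \<Rightarrow> (bool \<Rightarrow> real \<Rightarrow> real) \<Rightarrow> bool" where
  "sl_eigen L p q lam \<mu> U V \<longleftrightarrow>
     (\<forall>e. sl_sol L p q lam (U e) (V e) \<and> - V e 0 = \<mu> e * U e 0 \<and> V e L = \<mu> e * U e L) \<and>
     (\<forall>e d. U e 0 * U d 0 + U e L * U d L = (if e = d then 1 else 0)) \<and> \<mu> False \<le> \<mu> True"

lemma sl_sol_lincomb:
  assumes "sl_sol L p q lam u v" "sl_sol L p q lam u' v'"
  shows "sl_sol L p q lam (\<lambda>r. a * u r + b * u' r) (\<lambda>r. a * v r + b * v' r)"
  using assms unfolding sl_sol_def
  by (auto intro!: continuous_intros derivative_eq_intros simp: algebra_simps add_divide_distrib)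

text \<open>The determinant of an orthonormal pair has square 1, so it may be cancelled from
  identities that hold up to this factor.\<close>

lemma orthonormal_pair_complete:
  fixes a b c d :: real
  assumes "a * a + b * b = 1" "c * c + d * d = 1" "a * c + b * d = 0"
  shows "x = (x * a + y * b) * a + (x * c + y * d) * c" "y = (x * a + y * b) * b + (x * c + y * d) * d"
proof -
  have "(a * d - b * c)\<^sup>2 = 1"
    using assms by algebra
  then have "a * d - b * c \<noteq> 0" by auto
  moreover have "(a * d - b * c) * (x - ((x * a + y * b) * a + (x * c + y * d) * c)) = 0"
    "(a * d - b * c) * (y - ((x * a + y * b) * b + (x * c + y * d) * d)) = 0"
    using assms by algebra+
  ultimately show "x = (x * a + y * b) * a + (x * c + y * d) * c" "y = (x * a + y * b) * b + (x * c + y * d) * d"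
    by auto
qed

text \<open>The spectral theorem in the plane, with the second eigenvector given as the quarter turn
  of the first.\<close>

lemma symmetric_matrix_2:
  fixes A B D :: real
  obtains a b \<mu> \<nu> where "a * a + b * b = 1" "A * a + B * b = \<mu> * a" "B * a + D * b = \<mu> * b"
    "A * (-b) + B * a = \<nu> * (-b)" "B * (-b) + D * a = \<nu> * a" "\<mu> \<le> \<nu>"
proof (cases "B = 0")
  case True
  show ?thesis
  proof (cases "A \<le> D")
    case True
    with \<open>B = 0\<close> show ?thesis by (intro that[of 1 0 A D]) auto
  next
    case False
    with \<open>B = 0\<close> show ?thesis by (intro that[of 0 1 D A]) auto
  qed
next
  case False
  \<comment> \<open>\<open>R\<close> is the square root of the discriminant of the characteristic
    polynomial. The vector \<open>(B, \<mu> - A)\<close> solves the first row for the smaller root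
    and is nonzero because \<open>B\<close> is; \<open>N\<close> is its length.\<close>
  define R where "R = sqrt ((A - D)\<^sup>2 + 4 * B\<^sup>2)"
  define \<mu> where "\<mu> = (A + D - R) / 2"
  define \<nu> where "\<nu> = (A + D + R) / 2"
  have R: "R * R = (A - D)\<^sup>2 + 4 * B\<^sup>2" "R \<ge> 0"
    by (auto simp: R_def)
  have ch: "(\<mu> - A) * (\<mu> - D) = B * B" "\<mu> + \<nu> = A + D"
    using R by (auto simp: \<mu>_def \<nu>_def field_simps power2_eq_square)
  define N where "N = sqrt (B * B + (\<mu> - A) * (\<mu> - A))"
  have N: "N * N = B * B + (\<mu> - A) * (\<mu> - A)"
    by (simp add: N_def)
  have "B * B > 0" using False by (auto simp: zero_less_mult_iff)
  then have "N > 0"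
    unfolding N_def by (simp add: add_pos_nonneg)
  show ?thesis
  proof (rule that[of "B / N" "(\<mu> - A) / N" \<mu> \<nu>])
    show "B / N * (B / N) + (\<mu> - A) / N * ((\<mu> - A) / N) = 1"
      using N \<open>N > 0\<close> False by (simp add: add_divide_distrib[symmetric])
    show "A * (B / N) + B * ((\<mu> - A) / N) = \<mu> * (B / N)"
      using \<open>N > 0\<close> by (simp add: field_simps)
    show "B * (B / N) + D * ((\<mu> - A) / N) = \<mu> * ((\<mu> - A) / N)"
      using \<open>N > 0\<close> ch(1) by (simp add: field_simps)
    have "A * - (\<mu> - A) + B * B = \<nu> * - (\<mu> - A)"
      using ch by algebra
    then show "A * - ((\<mu> - A) / N) + B * (B / N) = \<nu> * - ((\<mu> - A) / N)"
      by (metis add_divide_distrib divide_minus_left times_divide_eq_right)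
    have "B * - (\<mu> - A) + D * B = \<nu> * B"
      using ch by algebra
    then show "B * - ((\<mu> - A) / N) + D * (B / N) = \<nu> * (B / N)"
      by (metis add_divide_distrib divide_minus_left times_divide_eq_right)
    show "\<mu> \<le> \<nu>" using R by (simp add: \<mu>_def \<nu>_def)
  qed
qed

section \<open>The Dirichlet-to-Neumann form of a single system\<close>

lemma continuous_on_interval_bounded_above:
  fixes f :: "real \<Rightarrow> real"
  assumes "continuous_on {a..b} f"
  shows "\<exists>M. \<forall>t\<in>{a..b}. f t \<le> M"
proof -
  have "bounded (f ` {a..b})"
    by (intro compact_imp_bounded compact_continuous_image assms) auto
  then obtain M where "\<forall>t\<in>{a..b}. \<bar>f t\<bar> \<le> M" by (auto simp: bounded_iff)
  then show ?thesis by (auto intro!: exI[of _ M] dest!: bspec)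
qed

locale sl_coeffs =
  fixes L :: real and p q :: "real \<Rightarrow> real"
  assumes L: "0 < L" and cont_p: "continuous_on {0..L} p" and cont_q: "continuous_on {0..L} q"
    and p_pos: "\<And>r. r \<in> {0..L} \<Longrightarrow> 0 < p r" and q_pos: "\<And>r. r \<in> {0..L} \<Longrightarrow> 0 < q r"
begin

lemma coeff_bound: "\<exists>M. \<forall>t\<in>{0..L}. \<bar>1 / p t\<bar> + \<bar>lam * q t\<bar> \<le> M"
proof -
  have "continuous_on {0..L} (\<lambda>t. \<bar>1 / p t\<bar> + \<bar>lam * q t\<bar>)"
    using p_pos by (intro continuous_intros cont_p cont_q) force
  then show ?thesis by (rule continuous_on_interval_bounded_above)
qed

lemma sl_sol_zero:
  assumes "sl_sol L p q lam u v" "t0 \<in> {0..L}" "u t0 = 0" "v t0 = 0" "t \<in> {0..L}"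
  shows "u t = 0 \<and> v t = 0"
proof -
  obtain M where M: "\<And>t. t \<in> {0..L} \<Longrightarrow> \<bar>1 / p t\<bar> + \<bar>lam * q t\<bar> \<le> M"
    using coeff_bound[of lam] by blast
  show ?thesis
    by (rule linear_system_zero[where P = "\<lambda>t. 1 / p t" and Q = "\<lambda>t. lam * q t" and M = M and a = 0 and b = L])
      (use assms M in \<open>auto simp: sl_sol_def\<close>)
qed

lemma sl_sol_energy_deriv:
  assumes "sl_sol L p q lam u v" "0 < r" "r < L"
  shows "((\<lambda>r. v r * u r) has_real_derivative (v r)\<^sup>2 / p r + lam * q r * (u r)\<^sup>2) (at r)"
proof -
  have "(u has_real_derivative v r / p r) (at r)" "(v has_real_derivative lam * q r * u r) (at r)"
    using assms unfolding sl_sol_def by auto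
  from DERIV_mult[OF this(2,1)] show ?thesis
    by (simp add: power2_eq_square algebra_simps)
qed

lemma sl_energy_nonneg:
  assumes "sl_sol L p q lam u v" "0 \<le> lam"
  shows "0 \<le> sl_energy L u v"
proof -
  have "v 0 * u 0 \<le> v L * u L"
    by (rule deriv_nonneg_imp_mono_closed[where f = "\<lambda>r. v r * u r" and a = 0 and b = L, OF _ sl_sol_energy_deriv[OF assms(1)]])
      (use assms(1,2) p_pos q_pos L in \<open>auto simp: sl_sol_def less_imp_le intro!: continuous_intros add_nonneg_nonneg divide_nonneg_nonneg mult_nonneg_nonneg\<close>)
  then show ?thesis by (simp add: sl_energy_def)
qed

text \<open>Nonpositive energy forces the energy density to vanish throughout the interior. Both of
  its summands are nonnegative, so the flux and \<open>lam * u\<close> vanish, and \<open>u\<close>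
  is constant.\<close>

lemma sl_energy_zero:
  assumes "sl_sol L p q lam u v" "0 \<le> lam" "sl_energy L u v \<le> 0" "r \<in> {0..L}"
  shows "v r = 0" "u r = u 0" "lam * u r = 0"
proof -
  have "(v r)\<^sup>2 / p r + lam * q r * (u r)\<^sup>2 = 0" if "0 < r" "r < L" for r
    by (rule nondecreasing_ends_deriv_zero[where f = "\<lambda>r. v r * u r", OF _ sl_sol_energy_deriv[OF assms(1)]])
      (use assms(1,2,3) p_pos q_pos L that in \<open>auto simp: sl_energy_def sl_sol_def less_imp_le intro!: continuous_intros add_nonneg_nonneg divide_nonneg_nonneg mult_nonneg_nonneg\<close>)
  moreover have "0 \<le> (v r)\<^sup>2 / p r" "0 \<le> lam * q r * (u r)\<^sup>2" "p r > 0" "q r > 0" if "0 < r" "r < L" for r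
    using that p_pos[of r] q_pos[of r] assms(2) by auto
  ultimately have *: "v r = 0 \<and> lam * u r = 0" if "0 < r" "r < L" for r
    using that by (smt (verit, best) divide_eq_0_iff mult_eq_0_iff power2_eq_square)
  have cu: "continuous_on {0..L} u" "continuous_on {0..L} v"
    using assms(1) by (auto simp: sl_sol_def)
  show v0: "v r = 0"
    by (rule constant_on_closed_intervalI[OF L cu(2)]) (use * assms(4) in auto)
  show "lam * u r = 0"
    by (rule constant_on_closed_intervalI[OF L, where f = "\<lambda>r. lam * u r"]) (use * assms(4) cu in \<open>auto intro!: continuous_intros\<close>)
  have "(u has_real_derivative 0) (at r)" if "0 < r" "r < L" for r
    using assms(1) * that by (force simp: sl_sol_def)
  then show "u r = u 0"
    using DERIV_isconst2[OF L cu(1), of r] assms(4) by simp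
qed

text \<open>By linearity, a solution is determined by its boundary values, so the passage from
  boundary values to fluxes is well defined.\<close>

lemma sl_sol_dirichlet_unique:
  assumes "sl_sol L p q lam u v" "0 \<le> lam" "u 0 = 0" "u L = 0" "r \<in> {0..L}"
  shows "u r = 0" "v r = 0"
  using sl_energy_zero[OF assms(1,2) _ assms(5)] assms(3,4) by (auto simp: sl_energy_def)

text \<open>Used twice: for the symmetry of the Dirichlet-to-Neumann matrix, and to show that
  boundary values belonging to different eigenvalues are orthogonal.\<close>

lemma sl_sol_wronskian:
  assumes "sl_sol L p q lam u v" "sl_sol L p q lam u' v'"
  shows "v L * u' L - v' L * u L = v 0 * u' 0 - v' 0 * u 0"
proof -
  let ?W = "\<lambda>r. v r * u' r - v' r * u r"
  have c: "continuous_on {0..L} ?W"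
    using assms by (auto simp: sl_sol_def intro!: continuous_intros)
  have d: "(?W has_real_derivative 0) (at r)" if "0 < r" "r < L" for r
    using assms that by (auto simp: sl_sol_def intro!: derivative_eq_intros)
  show ?thesis
    using DERIV_isconst2[OF L c d, of L] L by simp
qed

text \<open>The boundary vector is expanded in the orthonormal pair of eigenvectors; uniqueness for
  the Dirichlet problem carries the expansion into the interval, and the energy becomes
  diagonal.\<close>

lemma sl_eigen_expand:
  assumes "sl_eigen L p q lam \<mu> U V" "sl_sol L p q lam u v" "0 \<le> lam" "r \<in> {0..L}"
  defines "c \<equiv> \<lambda>e. u 0 * U e 0 + u L * U e L"
  shows "u r = c False * U False r + c True * U True r" "v r = c False * V False r + c True * V True r"
    and "u 0 * u 0 + u L * u L = c False * c False + c True * c True"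
    and "sl_energy L u v = \<mu> False * (c False * c False) + \<mu> True * (c True * c True)"
proof -
  have o: "U e 0 * U d 0 + U e L * U d L = (if e = d then 1 else 0)" for e d
    using assms(1) unfolding sl_eigen_def by blast
  have s: "sl_sol L p q lam (U e) (V e)" and b: "- V e 0 = \<mu> e * U e 0" "V e L = \<mu> e * U e L" for e
    using assms(1) unfolding sl_eigen_def by auto
  have "U False 0 * U False 0 + U False L * U False L = 1" "U True 0 * U True 0 + U True L * U True L = 1"
    "U False 0 * U True 0 + U False L * U True L = 0"
    using o[of False False] o[of True True] o[of False True] by simp_all
  note e = orthonormal_pair_complete[OF this, where x = "u 0" and y = "u L"]
  have u0: "u 0 = c False * U False 0 + c True * U True 0"
    and uL: "u L = c False * U False L + c True * U True L"
    using e by (simp_all only: c_def)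
  have main: "u r = c False * U False r + c True * U True r \<and> v r = c False * V False r + c True * V True r"
    if "r \<in> {0..L}" for r
  proof -
    have "sl_sol L p q lam (\<lambda>r. c False * U False r + c True * U True r) (\<lambda>r. c False * V False r + c True * V True r)"
      by (intro sl_sol_lincomb s)
    from sl_sol_lincomb[OF assms(2) this, of 1 "-1"]
    have *: "sl_sol L p q lam (\<lambda>r. u r - (c False * U False r + c True * U True r))
        (\<lambda>r. v r - (c False * V False r + c True * V True r))"
      by (simp only: mult_1 mult_minus1 add_uminus_conv_diff)
    show ?thesis
      using sl_sol_dirichlet_unique[OF * assms(3) _ _ that] u0 uL by simp
  qed
  show "u r = c False * U False r + c True * U True r" "v r = c False * V False r + c True * V True r"
    using main[OF assms(4)] by auto
  have "u 0 * u 0 + u L * u L = c False * (c False * U False 0 + c True * U True 0) * U False 0 + c True * (c False * U False 0 + c True * U True 0) * U True 0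
    + c False * (c False * U False L + c True * U True L) * U False L + c True * (c False * U False L + c True * U True L) * U True L"
    by (subst u0, subst u0, subst uL, subst uL) (simp add: algebra_simps)
  also have "\<dots> = c False * c False * (U False 0 * U False 0 + U False L * U False L) + c True * c True * (U True 0 * U True 0 + U True L * U True L) +
     2 * c True * c False * (U True 0 * U False 0 + U True L * U False L)"
    by (simp add: algebra_simps)
  finally show "u 0 * u 0 + u L * u L = c False * c False + c True * c True"
    by (simp add: o)
  have "sl_energy L u v = (c False * V False L + c True * V True L) * u L + (c False * (- V False 0) + c True * (- V True 0)) * u 0"
    unfolding sl_energy_def using main[of 0] main[of L] L by (simp add: algebra_simps)
  also have "\<dots> = \<mu> False * (c False * (u 0 * U False 0 + u L * U False L)) + \<mu> True * (c True * (u 0 * U True 0 + u L * U True L))"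
    unfolding b by (simp add: algebra_simps)
  finally show "sl_energy L u v = \<mu> False * (c False * c False) + \<mu> True * (c True * c True)"
    by (simp add: c_def)
qed

lemma sl_eigen_energy:
  assumes "sl_eigen L p q lam \<mu> U V"
  shows "sl_energy L (U e) (V e) = \<mu> e"
proof -
  have b: "- V e 0 = \<mu> e * U e 0" "V e L = \<mu> e * U e L" and o: "U e 0 * U e 0 + U e L * U e L = 1"
    using assms unfolding sl_eigen_def by auto
  have "sl_energy L (U e) (V e) = V e L * U e L + (- V e 0) * U e 0"
    by (simp add: sl_energy_def)
  also have "\<dots> = \<mu> e * (U e 0 * U e 0 + U e L * U e L)"
    unfolding b by (simp add: algebra_simps)
  finally show ?thesis by (simp add: o)
qed

lemma sl_eigen_nonneg:
  assumes "sl_eigen L p q lam \<mu> U V" "0 \<le> lam"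
  shows "0 \<le> \<mu> e"
  using sl_energy_nonneg[of lam "U e" "V e"] sl_eigen_energy[OF assms(1), of e] assms
  by (auto simp: sl_eigen_def)

lemma sl_eigen_pos:
  assumes "sl_eigen L p q lam \<mu> U V" "0 < lam"
  shows "0 < \<mu> e"
proof (rule ccontr)
  assume "\<not> 0 < \<mu> e"
  then have "sl_energy L (U e) (V e) \<le> 0"
    using sl_eigen_energy[OF assms(1), of e] by auto
  moreover have "sl_sol L p q lam (U e) (V e)" "U e 0 * U e 0 + U e L * U e L = 1"
    using assms by (auto simp: sl_eigen_def)
  ultimately show False
    using sl_energy_zero(3)[of lam "U e" "V e" 0] sl_energy_zero(3)[of lam "U e" "V e" L] L assms(2) by auto
qed

text \<open>The constant 1 is a solution of energy zero, which forces the lower eigenvalue to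
  vanish. If the upper one were zero too, both eigenvectors would be multiples of (1, 1) and could
  not be orthogonal.\<close>

lemma sl_eigen_lam0:
  assumes "sl_eigen L p q 0 \<mu> U V"
  shows "\<mu> False = 0" "0 < \<mu> True"
proof -
  have one: "sl_sol L p q 0 (\<lambda>r. 1) (\<lambda>r. 0)"
    by (auto simp: sl_sol_def)
  have o: "U e 0 * U d 0 + U e L * U d L = (if e = d then 1 else 0)" for e d
    using assms(1) unfolding sl_eigen_def by blast
  have s: "sl_sol L p q 0 (U e) (V e)" for e
    using assms(1) unfolding sl_eigen_def by auto
  note nn = sl_eigen_nonneg[OF assms, of False] 
  have le: "\<mu> False \<le> \<mu> True" using assms by (auto simp: sl_eigen_def)
  show F: "\<mu> False = 0"
  proof (rule ccontr)
    assume "\<mu> False \<noteq> 0"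
    then have pos: "0 < \<mu> False" "0 < \<mu> True" using nn le by auto
    let ?c = "\<lambda>e. U e 0 + U e L"
    have "(\<mu> False * (?c False * ?c False) + \<mu> True * (?c True * ?c True)) = 0"
      using sl_eigen_expand(4)[OF assms one, of 0] L by (simp add: sl_energy_def)
    moreover have "0 \<le> \<mu> False * (?c False * ?c False)" "0 \<le> \<mu> True * (?c True * ?c True)"
      using pos by auto
    ultimately have "\<mu> False * (?c False * ?c False) = 0" "\<mu> True * (?c True * ?c True) = 0"
      by linarith+
    then have "?c False = 0" "?c True = 0" using pos by auto
    then show False
      using sl_eigen_expand(3)[OF assms one, of 0] L by auto
  qed
  show "0 < \<mu> True"
  proof (rule ccontr)
    assume "\<not> 0 < \<mu> True"
    then have "\<mu> e \<le> 0" for e using F by (cases e) auto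
    then have "sl_energy L (U e) (V e) \<le> 0" for e
      using sl_eigen_energy[OF assms(1), of e] by auto
    then have "U e L = U e 0" for e
      using sl_energy_zero(2)[OF s, of e L] L by auto
    then show False
      using o[of False False] o[of True True] o[of False True] by (auto simp: mult_eq_0_iff)
  qed
qed

text \<open>Makes the eigenvalues grow with \<open>lam\<close>, which is what will leave only
  finitely many modes below any bound. The auxiliary function \<open>\<psi>\<close> turns a trace
  inequality into monotonicity of \<open>v u - \<psi> u\<^sup>2\<close>.\<close>

lemma sl_energy_lower_bound:
  "\<exists>\<Lambda>. \<forall>lam u v. lam \<ge> \<Lambda> \<longrightarrow> sl_sol L p q lam u v \<longrightarrow> K * (u 0 * u 0 + u L * u L) \<le> sl_energy L u v"
proof -
  \<comment> \<open>Linear from \<open>- K\<close> at 0 to \<open>K\<close> at \<open>L\<close>: the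
    end terms then subtract exactly \<open>K\<close> times the squared boundary values, and the
    constant slope costs \<open>2 K / L\<close>.\<close>
  define \<psi> where "\<psi> r = K * (2 * r / L - 1)" for r
  have "continuous_on {0..L} (\<lambda>r. (2 * K / L + (\<psi> r)\<^sup>2 / p r) / q r)"
    unfolding \<psi>_def using p_pos q_pos L by (intro continuous_intros cont_p cont_q) force+
  then obtain \<Lambda> where \<Lambda>: "\<And>r. r \<in> {0..L} \<Longrightarrow> (2 * K / L + (\<psi> r)\<^sup>2 / p r) / q r \<le> \<Lambda>"
    using continuous_on_interval_bounded_above by blast
  show ?thesis
  proof (intro exI[of _ \<Lambda>] allI impI)
    fix lam u v assume lam: "lam \<ge> \<Lambda>" and sol: "sl_sol L p q lam u v"
    let ?w = "\<lambda>r. v r * u r - \<psi> r * (u r)\<^sup>2"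
    have "?w 0 \<le> ?w L"
    proof (rule deriv_nonneg_imp_mono_closed[where f = ?w])
      show "continuous_on {0..L} ?w"
        using sol unfolding \<psi>_def sl_sol_def using L by (auto intro!: continuous_intros)
      fix r assume r: "0 < r" "r < L"
      have \<psi>: "(\<psi> has_real_derivative 2 * K / L) (at r)"
        unfolding \<psi>_def using L by (auto intro!: derivative_eq_intros)
      have u: "(u has_real_derivative v r / p r) (at r)"
        using sol r by (auto simp: sl_sol_def)
      show "(?w has_real_derivative ((v r)\<^sup>2 / p r + lam * q r * (u r)\<^sup>2) - (2 * K / L * (u r)\<^sup>2 + \<psi> r * (2 * u r * (v r / p r)))) (at r)"
        by (rule derivative_eq_intros sl_sol_energy_deriv[OF sol r] \<psi> u refl)+ (simp add: power2_eq_square)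
      have "p r > 0" "q r > 0" using r p_pos q_pos by auto
      have "2 * K / L + (\<psi> r)\<^sup>2 / p r \<le> lam * q r"
        using \<Lambda>[of r] r lam \<open>q r > 0\<close> by (simp add: pos_divide_le_eq) (meson mult_right_mono less_imp_le order_trans)
      then have "(2 * K / L + (\<psi> r)\<^sup>2 / p r) * (u r)\<^sup>2 \<le> lam * q r * (u r)\<^sup>2"
        by (intro mult_right_mono) auto
      \<comment> \<open>Completing the square in \<open>v\<close> absorbs the mixed term; the
        remaining \<open>\<psi>\<^sup>2 / p\<close> is what \<open>\<Lambda>\<close> was chosen to
        dominate.\<close>
      moreover have "0 \<le> (v r - \<psi> r * u r)\<^sup>2 / p r" using \<open>p r > 0\<close> by simp
      moreover have "(v r - \<psi> r * u r)\<^sup>2 / p r = (v r)\<^sup>2 / p r - \<psi> r * (2 * u r * (v r / p r)) + (\<psi> r)\<^sup>2 / p r * (u r)\<^sup>2"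
        using \<open>p r > 0\<close> by (simp add: field_simps power2_eq_square)
      ultimately show "0 \<le> ((v r)\<^sup>2 / p r + lam * q r * (u r)\<^sup>2) - (2 * K / L * (u r)\<^sup>2 + \<psi> r * (2 * u r * (v r / p r)))"
        by (simp add: algebra_simps)
    qed (use L in auto)
    then show "K * (u 0 * u 0 + u L * u L) \<le> sl_energy L u v"
      using L by (simp add: \<psi>_def sl_energy_def power2_eq_square algebra_simps)
  qed
qed

lemma sl_eigen_lower_bound:
  "\<exists>\<Lambda>. \<forall>lam \<mu> U V e. lam \<ge> \<Lambda> \<longrightarrow> sl_eigen L p q lam \<mu> U V \<longrightarrow> K \<le> \<mu> e"
proof -
  obtain \<Lambda> where \<Lambda>: "\<And>lam u v. lam \<ge> \<Lambda> \<Longrightarrow> sl_sol L p q lam u v \<Longrightarrow> K * (u 0 * u 0 + u L * u L) \<le> sl_energy L u v"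
    using sl_energy_lower_bound[of K] by blast
  show ?thesis
  proof (intro exI[of _ \<Lambda>] allI impI)
    fix lam \<mu> U V e assume "lam \<ge> \<Lambda>" and eig: "sl_eigen L p q lam \<mu> U V"
    then have "sl_sol L p q lam (U e) (V e)" "U e 0 * U e 0 + U e L * U e L = 1"
      by (auto simp: sl_eigen_def)
    with \<Lambda>[of lam "U e" "V e"] \<open>lam \<ge> \<Lambda>\<close> sl_eigen_energy[OF eig, of e] show "K \<le> \<mu> e" by simp
  qed
qed

end

text \<open>Dirichlet's principle made pointwise: the energy difference is the increment of one
  function \<open>?W\<close> whose derivative is a sum of nonnegative terms. In the equality case
  the flux \<open>v'\<close> vanishes where \<open>p < p'\<close>. For positive \<open>lam\<close>
  unique continuation then makes the whole solution vanish; for \<open>lam = 0\<close> the flux is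
  constant, hence zero, and so is the energy.\<close>

lemma sl_comparison:
  assumes c1: "sl_coeffs L p q" and c2: "sl_coeffs L p' q'"
    and le: "\<And>r. r \<in> {0..L} \<Longrightarrow> p r \<le> p' r \<and> q r \<le> q' r"
    and r0: "0 < r0" "r0 < L" "p r0 < p' r0"
    and s1: "sl_sol L p q lam u v" and s2: "sl_sol L p' q' lam u' v'"
    and bd: "u 0 = u' 0" "u L = u' L" and lam: "0 \<le> lam"
  shows "sl_energy L u v \<le> sl_energy L u' v'"
    and "sl_energy L u' v' \<le> sl_energy L u v \<Longrightarrow> sl_energy L u' v' = 0"
    and "sl_energy L u' v' \<le> sl_energy L u v \<Longrightarrow> 0 < lam \<Longrightarrow> u' 0 = 0 \<and> u' L = 0"
proof -
  interpret c1: sl_coeffs L p q by fact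
  interpret c2: sl_coeffs L p' q' by fact
  \<comment> \<open>Boundary values agree, so at the ends this reduces to
    \<open>v' u' - v u\<close>. Inside, \<open>?A\<close> is the gain from the larger
    \<open>p\<close>, and \<open>?B\<close> collects the gain from the larger \<open>q\<close> and
    the excess energy of \<open>u'\<close> over the minimiser \<open>u\<close> for the smaller
    coefficients.\<close>
  let ?W = "\<lambda>r. v' r * u' r - 2 * (v r * u' r) + v r * u r"
  let ?A = "\<lambda>r. (p' r - p r) * (v' r / p' r)\<^sup>2"
  let ?B = "\<lambda>r. p r * (v' r / p' r - v r / p r)\<^sup>2 + lam * (q' r - q r) * (u' r)\<^sup>2 + lam * q r * (u' r - u r)\<^sup>2"
  have cW: "continuous_on {0..L} ?W"
    using s1 s2 by (auto simp: sl_sol_def intro!: continuous_intros)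
  have dW: "(?W has_real_derivative ?A r + ?B r) (at r)" if r: "0 < r" "r < L" for r
  proof -
    have "p r > 0" "p' r > 0" using r c1.p_pos c2.p_pos by auto
    have d: "(u has_real_derivative v r / p r) (at r)" "(v has_real_derivative lam * q r * u r) (at r)"
      "(u' has_real_derivative v' r / p' r) (at r)" "(v' has_real_derivative lam * q' r * u' r) (at r)"
      using s1 s2 r by (auto simp: sl_sol_def)
    have "v r = p r * (v r / p r)" "v' r = p' r * (v' r / p' r)"
      using \<open>p r > 0\<close> \<open>p' r > 0\<close> by auto
    then have "lam * q' r * u' r * u' r + v' r / p' r * v' r - 2 * (lam * q r * u r * u' r + v' r / p' r * v r) + (lam * q r * u r * u r + v r / p r * v r)
        = ?A r + ?B r"
      by algebra
    moreover have "(?W has_real_derivative lam * q' r * u' r * u' r + v' r / p' r * v' r - 2 * (lam * q r * u r * u' r + v' r / p' r * v r) + (lam * q r * u r * u r + v r / p r * v r)) (at r)"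
      by (intro DERIV_add DERIV_diff DERIV_cmult DERIV_mult d)
    ultimately show ?thesis by simp
  qed
  have AB: "0 \<le> ?A r" "0 \<le> ?B r" if "0 < r" "r < L" for r
    using that le[of r] c1.p_pos[of r] c1.q_pos[of r] lam by (auto intro!: add_nonneg_nonneg mult_nonneg_nonneg)
  have W: "?W L - ?W 0 = sl_energy L u' v' - sl_energy L u v"
    using bd by (simp add: sl_energy_def)
  have "?W 0 \<le> ?W L"
    by (rule deriv_nonneg_imp_mono_closed[OF cW dW]) (use AB c1.L in \<open>auto intro: add_nonneg_nonneg\<close>)
  with W show "sl_energy L u v \<le> sl_energy L u' v'" by simp
  assume *: "sl_energy L u' v' \<le> sl_energy L u v"
  have zero: "?A r + ?B r = 0" if "0 < r" "r < L" for r
    by (rule nondecreasing_ends_deriv_zero[OF cW dW]) (use AB W * that in \<open>auto intro: add_nonneg_nonneg\<close>)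
  \<comment> \<open>The strict inequality is spread to a neighbourhood of \<open>r0\<close>, because
    the flux has to vanish on an open set before its derivative at \<open>r0\<close> can be read
    off.\<close>
  have "continuous_on {0..L} (\<lambda>r. p' r - p r)"
    by (intro continuous_intros c1.cont_p c2.cont_p)
  then have "isCont (\<lambda>r. p' r - p r) r0"
    using r0 by (intro continuous_on_interior[of "{0..L}"]) auto
  then obtain d0 where d0: "d0 > 0" "\<And>r. \<bar>r - r0\<bar> < d0 \<Longrightarrow> \<bar>(p' r - p r) - (p' r0 - p r0)\<bar> < p' r0 - p r0"
    using r0(3) unfolding continuous_at_eps_delta dist_real_def by (metis diff_gt_0_iff_gt)
  define d where "d = min d0 (min r0 (L - r0))"
  have "p r < p' r" if "\<bar>r - r0\<bar> < d" for r
    using d0(2)[of r] that by (auto simp: d_def abs_less_iff)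
  then have d: "d > 0" "\<And>r. \<bar>r - r0\<bar> < d \<Longrightarrow> 0 < r \<and> r < L \<and> p r < p' r"
    using d0(1) r0 by (auto simp: d_def abs_less_iff)
  have v0: "v' r = 0" if "\<bar>r - r0\<bar> < d" for r
  proof -
    have "?A r = 0" using AB[of r] zero[of r] d(2)[OF that] by linarith
    then show ?thesis using d(2)[OF that] c2.p_pos[of r] by auto
  qed
  have "(v' has_real_derivative 0) (at r0)"
    by (rule has_field_derivative_transform_within_open[where f = "\<lambda>_. 0" and S = "ball r0 d"])
      (use v0 d(1) in \<open>auto simp: dist_real_def\<close>)
  moreover have "(v' has_real_derivative lam * q' r0 * u' r0) (at r0)"
    using s2 r0 by (auto simp: sl_sol_def)
  ultimately have "lam * q' r0 * u' r0 = 0"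
    using DERIV_unique by blast
  \<comment> \<open>Together with \<open>v' r0 = 0\<close> this gives zero Cauchy data at
    \<open>r0\<close> when \<open>lam\<close> is positive.\<close>
  then have lu: "lam * u' r0 = 0"
    using c2.q_pos[of r0] r0 by auto
  have v': "v' r0 = 0" using v0[of r0] d(1) by simp
  show pos: "u' 0 = 0 \<and> u' L = 0" if "0 < lam"
    using c2.sl_sol_zero[OF s2, of r0 0] c2.sl_sol_zero[OF s2, of r0 L] lu v' that r0 by auto
  show "sl_energy L u' v' = 0"
  proof (cases "lam = 0")
    case False
    then show ?thesis using pos lam by (simp add: sl_energy_def)
  next
    case True
    have "v' r = v' 0" if "r \<in> {0..L}" for r
      using DERIV_isconst2[OF c1.L, of v' r] s2 that True by (auto simp: sl_sol_def)
    from this[of r0] this[of L] show ?thesis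
      using v' r0 by (simp add: sl_energy_def)
  qed
qed

text \<open>In the plane the minimum and the maximum of the quadratic form over unit vectors are the
  two eigenvalues, so one test vector suffices for each. The excluded case \<open>lam = 0\<close>,
  \<open>e = False\<close> is the constant function, with eigenvalue 0 for both coefficient
  pairs.\<close>

lemma sl_eigen_comparison:
  assumes c1: "sl_coeffs L p q" and c2: "sl_coeffs L p' q'"
    and le: "\<And>r. r \<in> {0..L} \<Longrightarrow> p r \<le> p' r \<and> q r \<le> q' r"
    and r0: "0 < r0" "r0 < L" "p r0 < p' r0"
    and e1: "sl_eigen L p q lam \<mu> U V" and e2: "sl_eigen L p' q' lam \<mu>' U' V'" and lam: "0 \<le> lam"
    and pos: "0 < lam \<or> e"
  shows "\<mu> e < \<mu>' e"
proof -
  interpret c1: sl_coeffs L p q by fact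
  interpret c2: sl_coeffs L p' q' by fact
  have m: "\<mu> False \<le> \<mu> True" "\<mu>' False \<le> \<mu>' True"
    and s1: "sl_sol L p q lam (U d) (V d)" and s2: "sl_sol L p' q' lam (U' d) (V' d)"
    and o1: "U d 0 * U d 0 + U d L * U d L = 1" and o2: "U' d 0 * U' d 0 + U' d L * U' d L = 1"
    and o3: "U False 0 * U True 0 + U False L * U True L = 0" and o4: "U' False 0 * U' True 0 + U' False L * U' True L = 0" for d
    using e1 e2 by (auto simp: sl_eigen_def)
  note o1' = o1[of True] o1[of False] and o2' = o2[of True] o2[of False]
  show ?thesis
  proof (cases e)
    case False
    text \<open>Test the first Dirichlet-to-Neumann form on the lowest eigenvector of the second.\<close>
    let ?c = "\<lambda>e. U' False 0 * U e 0 + U' False L * U e L"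
    let ?u = "\<lambda>r. ?c False * U False r + ?c True * U True r"
    let ?v = "\<lambda>r. ?c False * V False r + ?c True * V True r"
    have s: "sl_sol L p q lam ?u ?v" by (intro sl_sol_lincomb s1)
    note pc = orthonormal_pair_complete[OF o1'(2) o1'(1) o3, where x = "U' False 0" and y = "U' False L"]
    have b: "?u 0 = U' False 0" "?u L = U' False L"
      using pc by simp_all
    note ex = c1.sl_eigen_expand(3,4)[OF e1 s lam, of 0]
    have nrm: "?c False * ?c False + ?c True * ?c True = 1"
      using ex(1) c1.L unfolding b by (simp add: o2)
    have "sl_energy L ?u ?v = \<mu> False * (?c False * ?c False) + \<mu> True * (?c True * ?c True)"
      using ex(2) c1.L unfolding b by simp
    also have "\<dots> \<ge> \<mu> False * (?c False * ?c False) + \<mu> False * (?c True * ?c True)"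
      using m(1) by (intro add_left_mono mult_right_mono) auto
    also have "\<mu> False * (?c False * ?c False) + \<mu> False * (?c True * ?c True) = \<mu> False"
      using nrm by (simp flip: distrib_left)
    finally have lower: "\<mu> False \<le> sl_energy L ?u ?v" .
    have "sl_energy L ?u ?v < sl_energy L (U' False) (V' False)"
    proof (rule ccontr)
      assume "\<not> ?thesis"
      then have "U' False 0 = 0 \<and> U' False L = 0"
        using sl_comparison(3)[OF c1 c2 le r0 s s2[of False] b lam] pos False by auto
      then show False using o2'(2) by simp
    qed
    then show ?thesis
      using lower c2.sl_eigen_energy[OF e2, of False] False by simp
  next
    case True
    text \<open>Test the second form on the highest eigenvector of the first.\<close>
    let ?c = "\<lambda>e. U True 0 * U' e 0 + U True L * U' e L"
    let ?u = "\<lambda>r. ?c False * U' False r + ?c True * U' True r"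
    let ?v = "\<lambda>r. ?c False * V' False r + ?c True * V' True r"
    have s: "sl_sol L p' q' lam ?u ?v" by (intro sl_sol_lincomb s2)
    note pc = orthonormal_pair_complete[OF o2'(2) o2'(1) o4, where x = "U True 0" and y = "U True L"]
    have b: "?u 0 = U True 0" "?u L = U True L"
      using pc by simp_all
    note ex = c2.sl_eigen_expand(3,4)[OF e2 s lam, of 0]
    have nrm: "?c False * ?c False + ?c True * ?c True = 1"
      using ex(1) c1.L unfolding b by (simp add: o1)
    have "sl_energy L ?u ?v = \<mu>' False * (?c False * ?c False) + \<mu>' True * (?c True * ?c True)"
      using ex(2) c1.L unfolding b by simp
    also have "\<dots> \<le> \<mu>' True * (?c False * ?c False) + \<mu>' True * (?c True * ?c True)"
      using m(2) by (intro add_right_mono mult_right_mono) auto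
    also have "\<dots> = \<mu>' True"
      using nrm by (simp flip: distrib_left)
    finally have upper: "sl_energy L ?u ?v \<le> \<mu>' True" .
    have en: "sl_energy L (U True) (V True) = \<mu> True"
      by (rule c1.sl_eigen_energy[OF e1])
    \<comment> \<open>Rules out equality also when \<open>lam = 0\<close>: equality would make the
      energy of the second solution zero, while it is at least \<open>\<mu> True\<close>.\<close>
    have "0 < \<mu> True"
      using c1.sl_eigen_pos[OF e1] c1.sl_eigen_lam0(2)[of \<mu> U V] e1 lam by (cases "lam = 0") auto
    have "sl_energy L (U True) (V True) < sl_energy L ?u ?v"
    proof (rule ccontr)
      assume **: "\<not> ?thesis"
      note cmp = sl_comparison[OF c1 c2 le r0 s1[of True] s b(1)[symmetric] b(2)[symmetric] lam]
      show False
        using cmp(1) cmp(2) ** en \<open>0 < \<mu> True\<close> by auto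
    qed
    then show ?thesis
      using upper en True by simp
  qed
qed

section \<open>Existence and smoothness of the radial eigenfunctions\<close>

lemma linear_system_smooth:
  fixes u v P Q :: "real \<Rightarrow> real"
  assumes "open S" "\<And>r. r \<in> S \<Longrightarrow> (u has_real_derivative P r * v r) (at r)"
    "\<And>r. r \<in> S \<Longrightarrow> (v has_real_derivative Q r * u r) (at r)"
    and PQ: "\<And>k. Ck_on k P S" "\<And>k. Ck_on k Q S"
  shows "Ck_on k u S \<and> Ck_on k v S"
proof (induction k)
  case 0
  then show ?case
    using DERIV_continuous_on[of S u "\<lambda>r. P r * v r"] DERIV_continuous_on[of S v "\<lambda>r. Q r * u r"]
      assms(2,3) by (simp add: has_field_derivative_at_within)
next
  case (Suc k)
  \<comment> \<open>Bootstrapping: the right-hand sides are as smooth as \<open>u\<close> and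
    \<open>v\<close> themselves, which gains one derivative in each round.\<close>
  then have "Ck_on k (\<lambda>r. P r * v r) S" "Ck_on k (\<lambda>r. Q r * u r) S"
    by (simp_all add: Ck_on_mult assms)
  with Ck_on_SucI_real[OF assms(1,2)] Ck_on_SucI_real[OF assms(1,3)] show ?case by blast
qed

text \<open>The system is solved on an interval containing [0, L] in its interior, since smoothness
  on the closed cylinder asks for an extension to an open set. The eigenfunctions come from
  diagonalising the Dirichlet-to-Neumann matrix of the two solutions with boundary values (1, 0) and
  (0, 1).\<close>

lemma sl_eigen_exists:
  fixes p q :: "real \<Rightarrow> real"
  assumes "A < 0" "0 < L" "L < B" and smooth: "\<And>k. Ck_on k p {A<..<B}" "\<And>k. Ck_on k q {A<..<B}"
    and pos: "\<And>r. r \<in> {A<..<B} \<Longrightarrow> 0 < p r" "\<And>r. r \<in> {A<..<B} \<Longrightarrow> 0 < q r" and lam: "0 \<le> lam"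
  shows "\<exists>\<mu> U V. sl_eigen L p q lam \<mu> U V \<and>
     (\<exists>a b. a < 0 \<and> L < b \<and> (\<forall>e k. Ck_on k (U e) {a<..<b}) \<and> (\<forall>e. \<forall>r\<in>{a<..<b}. (U e has_real_derivative V e r / p r) (at r)
          \<and> (V e has_real_derivative lam * q r * U e r) (at r)))"
proof -
  \<comment> \<open>Halfway points keep the closed interval inside \<open>{A<..<B}\<close>, where
    continuity bounds the coefficients.\<close>
  define a where "a = A / 2"
  define b where "b = (L + B) / 2"
  have ab: "A < a" "a < 0" "L < b" "b < B" "a < b" using assms(1-3) by (auto simp: a_def b_def)
  have sub: "{a..b} \<subseteq> {A<..<B}" using ab by auto
  have contp: "continuous_on {A<..<B} p" and contq: "continuous_on {A<..<B} q"
    using smooth(1)[of 0] smooth(2)[of 0] by auto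
  have cP: "continuous_on {a..b} (\<lambda>t. 1 / p t)" and cQ: "continuous_on {a..b} (\<lambda>t. lam * q t)"
    using sub pos(1) by (auto intro!: continuous_intros continuous_on_subset[OF contp] continuous_on_subset[OF contq])
      force
  interpret sl_coeffs L p q
    using ab pos \<open>0 < L\<close> by unfold_locales
      (auto intro: continuous_on_subset[OF contp] continuous_on_subset[OF contq])
  define sol where "sol u v \<longleftrightarrow> (\<forall>t\<in>{a..b}. (u has_real_derivative 1 / p t * v t) (at t within {a..b}) \<and>
     (v has_real_derivative lam * q t * u t) (at t within {a..b}))" for u v
  have cont: "continuous_on {a..b} u" "continuous_on {a..b} v" if "sol u v" for u v
    using that unfolding sol_def by (auto intro!: DERIV_continuous_on)
  have der: "(u has_real_derivative v t / p t) (at t) \<and> (v has_real_derivative lam * q t * u t) (at t)"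
    if "sol u v" "t \<in> {a<..<b}" for u v t
    using that at_within_interior[of t "{a..b}"] unfolding sol_def by (auto dest!: bspec[of _ _ t])
  have sl: "sl_sol L p q lam u v" if "sol u v" for u v
    using der[OF that] cont[OF that] ab unfolding sl_sol_def by (auto intro: continuous_on_subset)
  have lin: "sol (\<lambda>r. x * u r + y * u' r) (\<lambda>r. x * v r + y * v' r)" if "sol u v" "sol u' v'" for x y u v u' v'
    using that unfolding sol_def
    by (auto intro!: derivative_eq_intros simp: algebra_simps add_divide_distrib)
  obtain u1 v1 where i1: "u1 a = 1" "v1 a = 0" and s1: "sol u1 v1"
    using linear_system_exists[OF _ cP cQ, of 1 0] ab unfolding sol_def by (metis less_imp_le)
  obtain u2 v2 where i2: "u2 a = 0" "v2 a = 1" and s2: "sol u2 v2"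
    using linear_system_exists[OF _ cP cQ, of 0 1] ab unfolding sol_def by (metis less_imp_le)
  define Dt where "Dt = u1 0 * u2 L - u2 0 * u1 L"
  have "Dt \<noteq> 0"
  proof
    assume "Dt = 0"
    \<comment> \<open>The matrix of boundary values has trivial kernel: a solution vanishing at both
      ends vanishes with its flux at 0, hence back to \<open>a\<close>, where the initial data are
      independent. A zero determinant would put vectors of cofactors into the kernel.\<close>
    have z: "x = 0 \<and> y = 0" if "x * u1 0 + y * u2 0 = 0" "x * u1 L + y * u2 L = 0" for x y
    proof -
      let ?u = "\<lambda>r. x * u1 r + y * u2 r" and ?v = "\<lambda>r. x * v1 r + y * v2 r"
      have s: "sol ?u ?v" by (intro lin s1 s2)
      have "?u 0 = 0" "?v 0 = 0"
        using sl_sol_dirichlet_unique[OF sl[OF s] lam that, of 0] \<open>0 < L\<close> by auto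
      moreover obtain M where M: "\<And>t. t \<in> {a..b} \<Longrightarrow> \<bar>1 / p t\<bar> + \<bar>lam * q t\<bar> \<le> M"
        using continuous_on_interval_bounded_above[OF continuous_on_add[OF continuous_on_rabs[OF cP] continuous_on_rabs[OF cQ]]]
        by blast
      ultimately have "?u a = 0 \<and> ?v a = 0"
        using linear_system_zero[OF cont[OF s], of "\<lambda>t. 1 / p t" "\<lambda>t. lam * q t" M 0 a] der[OF s] ab \<open>0 < L\<close> by simp
      then show ?thesis using i1 i2 by simp
    qed
    have "u2 L = 0 \<and> - u1 L = 0" using z[of "u2 L" "- u1 L"] \<open>Dt = 0\<close> by (simp add: Dt_def algebra_simps)
    moreover have "u2 0 = 0 \<and> - u1 0 = 0" using z[of "u2 0" "- u1 0"] \<open>Dt = 0\<close> by (simp add: Dt_def algebra_simps)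
    ultimately show False using z[of 1 1] by simp
  qed
  have bvp: "\<exists>u v. sol u v \<and> u 0 = c \<and> u L = d" for c d
  proof (intro exI conjI)
    let ?x = "(c * u2 L - d * u2 0) / Dt" and ?y = "(d * u1 0 - c * u1 L) / Dt"
    show "sol (\<lambda>r. ?x * u1 r + ?y * u2 r) (\<lambda>r. ?x * v1 r + ?y * v2 r)"
      by (intro lin s1 s2)
    have "(c * u2 L - d * u2 0) * u1 0 + (d * u1 0 - c * u1 L) * u2 0 = c * Dt"
      "(c * u2 L - d * u2 0) * u1 L + (d * u1 0 - c * u1 L) * u2 L = d * Dt"
      by (simp_all add: Dt_def algebra_simps)
    then show "?x * u1 0 + ?y * u2 0 = c" "?x * u1 L + ?y * u2 L = d"
      using \<open>Dt \<noteq> 0\<close> by (simp_all add: add_divide_distrib[symmetric])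
  qed
  obtain f f' where f: "sol f f'" "f 0 = 1" "f L = 0" using bvp by blast
  obtain g g' where g: "sol g g'" "g 0 = 0" "g L = 1" using bvp by blast
  \<comment> \<open>The off-diagonal entries of the Dirichlet-to-Neumann matrix are
    \<open>f' L\<close> and \<open>- g' 0\<close>.\<close>
  have sym: "f' L = - g' 0"
    using sl_sol_wronskian[OF sl[OF f(1)] sl[OF g(1)]] f g by simp
  obtain x y m0 m1 where xy: "x * x + y * y = 1" "- f' 0 * x + f' L * y = m0 * x" "f' L * x + g' L * y = m0 * y"
      "- f' 0 * (- y) + f' L * x = m1 * (- y)" "f' L * (- y) + g' L * x = m1 * x" "m0 \<le> m1"
    using symmetric_matrix_2[of "- f' 0" "f' L" "g' L"] by metis
  define \<mu> where "\<mu> e = (if e then m1 else m0)" for e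
  define X where "X e = (if e then - y else x)" for e
  define Y where "Y e = (if e then x else y)" for e
  define U where "U e r = X e * f r + Y e * g r" for e r
  define V where "V e r = X e * f' r + Y e * g' r" for e r
  have sU: "sol (U e) (V e)" for e
    unfolding U_def V_def by (intro lin f g)
  have bU: "U e 0 = X e" "U e L = Y e" for e
    by (simp_all add: U_def f g)
  have "sl_eigen L p q lam \<mu> U V"
    unfolding sl_eigen_def
  proof (intro conjI allI)
    fix e d
    show "sl_sol L p q lam (U e) (V e)" by (rule sl[OF sU])
    show "- V e 0 = \<mu> e * U e 0" "V e L = \<mu> e * U e L"
      unfolding bU using xy sym by (auto simp: V_def \<mu>_def X_def Y_def algebra_simps)
    show "U e 0 * U d 0 + U e L * U d L = (if e = d then 1 else 0)"
      unfolding bU using xy(1) by (auto simp: X_def Y_def algebra_simps)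
    show "\<mu> False \<le> \<mu> True" using xy by (simp add: \<mu>_def)
  qed
  moreover have "Ck_on k (U e) {a<..<b}" for e k
  proof -
    have "p r \<noteq> 0" if "r \<in> {a<..<b}" for r
      using pos(1)[of r] that ab by auto
    then have "Ck_on k (\<lambda>r. inverse (p r)) {a<..<b}" for k
      using ab by (intro Ck_on_inverse Ck_on_subset[OF smooth(1)]) auto
    moreover have "Ck_on k (\<lambda>r. lam * q r) {a<..<b}" for k
      using ab by (intro Ck_on_mult Ck_on_const Ck_on_subset[OF smooth(2)]) auto
    ultimately show ?thesis
      using linear_system_smooth[of "{a<..<b}" "U e" "\<lambda>r. inverse (p r)" "V e" "\<lambda>r. lam * q r" k] der[OF sU]
      by (auto simp: field_simps)
  qed
  ultimately show ?thesis
    using der[OF sU] ab by (intro exI[of _ \<mu>] exI[of _ U] exI[of _ V]) blast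
qed

section \<open>Rotations and an invariant mean over the sphere\<close>

text \<open>
  The library proves that Lebesgue measure on \<open>real^'m\<close> is invariant under orthogonal maps only for
  well-ordered index types. The copy \<open>'n wo\<close> of a finite type carries such an order.
\<close>

typedef 'a wo = "UNIV :: 'a set" by auto

instance wo :: (finite) finite
proof
  have "(UNIV :: 'a wo set) = range Abs_wo"
    by (metis Rep_wo_inverse surjI)
  then show "finite (UNIV :: 'a wo set)" by (metis finite_imageI finite)
qed

instantiation wo :: (finite) linorder
begin

definition less_eq_wo :: "'a wo \<Rightarrow> 'a wo \<Rightarrow> bool" where
  "x \<le> y \<longleftrightarrow> to_nat_on UNIV (Rep_wo x) \<le> to_nat_on UNIV (Rep_wo y)"

definition less_wo :: "'a wo \<Rightarrow> 'a wo \<Rightarrow> bool" where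
  "x < y \<longleftrightarrow> to_nat_on UNIV (Rep_wo x) < to_nat_on UNIV (Rep_wo y)"

instance
proof
  fix x y :: "'a wo"
  assume "x \<le> y" "y \<le> x"
  then have "to_nat_on (UNIV :: 'a set) (Rep_wo x) = to_nat_on UNIV (Rep_wo y)"
    by (simp add: less_eq_wo_def)
  then have "Rep_wo x = Rep_wo y"
    by (metis UNIV_I countable_finite finite inj_on_to_nat_on inj_on_contraD)
  then show "x = y" by (simp add: Rep_wo_inject)
qed (auto simp: less_eq_wo_def less_wo_def)

end

instance wo :: (finite) wellorder
proof
  fix P :: "'a wo \<Rightarrow> bool" and a
  assume *: "\<And>x. (\<And>y. y < x \<Longrightarrow> P y) \<Longrightarrow> P x"
  have "wf {(x, y :: 'a wo). x < y}"
    by (rule wf_subset[OF wf_measure[of "\<lambda>x. to_nat_on UNIV (Rep_wo x)"]]) (auto simp: less_wo_def)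
  then show "P a"
    by (rule wf_induct_rule) (rule *, simp)
qed

definition of_wo :: "real^('n::finite wo) \<Rightarrow> real^'n" where
  "of_wo x = (\<chi> k. x $ Abs_wo k)"

definition to_wo :: "real^'n::finite \<Rightarrow> real^('n wo)" where
  "to_wo x = (\<chi> k. x $ Rep_wo k)"

lemma of_wo_to_wo [simp]: "of_wo (to_wo x) = x" and to_wo_of_wo [simp]: "to_wo (of_wo y) = y"
  by (simp_all add: of_wo_def to_wo_def Abs_wo_inverse Rep_wo_inverse vec_eq_iff)

lemma bij_Abs_wo: "bij Abs_wo"
  by (metis (mono_tags, lifting) Abs_wo_inject Abs_wo_cases UNIV_I bijI' )

lemma norm_of_wo [simp]: "norm (of_wo x) = norm x"
proof -
  have "(\<Sum>k\<in>UNIV. (x $ Abs_wo k)\<^sup>2) = (\<Sum>k\<in>UNIV. (x $ k)\<^sup>2)"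
    by (rule sum.reindex_bij_betw[OF bij_Abs_wo])
  then show ?thesis by (simp add: norm_vec_def L2_set_def of_wo_def)
qed

lemma norm_to_wo [simp]: "norm (to_wo x) = norm x"
  by (metis norm_of_wo of_wo_to_wo)

lemma linear_of_wo: "linear of_wo" and linear_to_wo: "linear to_wo"
  by (auto simp: linear_iff of_wo_def to_wo_def vec_eq_iff)

text \<open>Taken to be the identity for \<open>i = j\<close>, so that sums over all ordered pairs
  carry no side condition.\<close>

definition rot :: "'n::finite \<Rightarrow> 'n \<Rightarrow> real \<Rightarrow> real^'n \<Rightarrow> real^'n" where
  "rot i j t p = (\<chi> k. if i = j then p $ k else if k = i then cos t * p $ i - sin t * p $ j
      else if k = j then sin t * p $ i + cos t * p $ j else p $ k)"

definition rot_gen :: "'n::finite \<Rightarrow> 'n \<Rightarrow> real^'n \<Rightarrow> real^'n" where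
  "rot_gen i j p = p $ i *\<^sub>R axis j 1 - p $ j *\<^sub>R axis i 1"

lemma rot_0 [simp]: "rot i j 0 p = p"
  by (auto simp: rot_def vec_eq_iff)

lemma linear_rot: "linear (rot i j t)"
  by (auto simp: linear_iff rot_def vec_eq_iff algebra_simps)

lemma rot_add: "rot i j s (rot i j t p) = rot i j (s + t) p"
  by (auto simp: rot_def vec_eq_iff cos_add sin_add algebra_simps)

lemma norm_rot [simp]: "norm (rot i j t p) = norm p"
proof (cases "i = j")
  case True
  then show ?thesis by (simp add: rot_def)
next
  case False
  have split: "(\<Sum>k\<in>UNIV. g k) = g i + g j + (\<Sum>k\<in>UNIV - {i, j}. g k)" for g :: "'a \<Rightarrow> real"
    using False by (subst sum.subset_diff[of "{i, j}"]) auto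
  have "(cos t * p $ i - sin t * p $ j)\<^sup>2 + (sin t * p $ i + cos t * p $ j)\<^sup>2 = ((sin t)\<^sup>2 + (cos t)\<^sup>2) * ((p $ i)\<^sup>2 + (p $ j)\<^sup>2)"
    by algebra
  then have "(\<Sum>k\<in>UNIV. (rot i j t p $ k)\<^sup>2) = (\<Sum>k\<in>UNIV. (p $ k)\<^sup>2)"
    using False unfolding split by (simp add: rot_def)
  then show ?thesis by (simp add: norm_vec_def L2_set_def)
qed

lemma rot_scaleR: "rot i j t (c *\<^sub>R p) = c *\<^sub>R rot i j t p"
  by (simp add: linear_rot linear_scale)

lemma has_vector_derivative_rot:
  "((\<lambda>t. rot i j t p) has_vector_derivative rot_gen i j p) (at 0)"
proof (cases "i = j")
  case True
  then show ?thesis by (simp add: rot_def rot_gen_def)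
next
  case False
  then have *: "rot i j t p = p + (cos t - 1) *\<^sub>R (p $ i *\<^sub>R axis i 1 + p $ j *\<^sub>R axis j 1) + sin t *\<^sub>R rot_gen i j p" for t
    by (auto simp: rot_def rot_gen_def vec_eq_iff axis_def algebra_simps)
  show ?thesis
    unfolding * by (auto intro!: derivative_eq_intros simp: has_real_derivative_iff_has_vector_derivative[symmetric])
qed

text \<open>Lebesgue measure is determined by the volumes of boxes; the preimage of a box is its
  image under the inverse, which is again orthogonal and preserves volume.\<close>

lemma distr_lborel_orthogonal:
  fixes T :: "real^'m::{finite,wellorder} \<Rightarrow> real^'m::_"
  assumes "orthogonal_transformation T"
  shows "distr lborel borel T = lborel"
proof (rule lborel_eqI[symmetric])
  have [measurable]: "T \<in> borel \<rightarrow>\<^sub>M borel"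
    using assms by (intro borel_measurable_continuous_onI linear_continuous_on)
      (simp add: linear_linear orthogonal_transformation_linear)
  have inv: "orthogonal_transformation (inv T)"
    using assms by (rule orthogonal_transformation_inv)
  fix l u :: "real^'m::_" assume le: "\<And>b. b \<in> Basis \<Longrightarrow> l \<bullet> b \<le> u \<bullet> b"
  have vim: "T -` box l u = inv T ` box l u"
    using orthogonal_transformation_bij[OF assms] by (simp add: bij_vimage_eq_inv_image)
  have "measure lebesgue (inv T ` box l u) = measure lebesgue (box l u)"
    by (intro measure_orthogonal_image inv) simp
  moreover have "inv T ` box l u \<in> sets borel"
    using measurable_sets[of T borel borel "box l u"] by (simp add: vim)
  moreover have "emeasure lebesgue (inv T ` box l u) \<noteq> \<infinity>"
    using fmeasurableD2[OF measurable_orthogonal_image[OF inv lmeasurable_box]] by (simp only: infinity_ennreal_def not_False_eq_True)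
  ultimately have "emeasure lebesgue (inv T ` box l u) = emeasure lebesgue (box l u)"
    using fmeasurableD2[OF lmeasurable_box, of l u] by (simp add: emeasure_eq_ennreal_measure)
  then have "emeasure lborel (inv T ` box l u) = emeasure lborel (box l u)"
    using \<open>inv T ` box l u \<in> sets borel\<close> by simp
  then show "emeasure (distr lborel borel T) (box l u) = (\<Prod>b\<in>Basis. (u - l) \<bullet> b)"
    using le by (simp add: emeasure_distr vim emeasure_lborel_box_eq)
qed simp

text \<open>The function is extended constantly along rays and cut off to a shell away from the
  origin. In polar coordinates the radial integral splits off as a positive constant, so Lebesgue
  measure can stand in for surface measure.\<close>

definition sph_lift :: "(real^'n::finite \<Rightarrow> real) \<Rightarrow> real^('n wo) \<Rightarrow> real" where
  "sph_lift \<phi> x = indicator {x. 1 \<le> norm x \<and> norm x \<le> 2} x *\<^sub>R \<phi> (of_wo x /\<^sub>R norm x)"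

text \<open>A constant multiple of the surface integral over the unit sphere.\<close>

definition sph_int :: "(real^'n::finite \<Rightarrow> real) \<Rightarrow> real" where
  "sph_int \<phi> = integral\<^sup>L lborel (sph_lift \<phi>)"

lemma norm_of_wo_unit: "x \<noteq> 0 \<Longrightarrow> norm (of_wo x /\<^sub>R norm x) = 1"
  by simp

lemma sph_lift_arg: "1 \<le> norm x \<Longrightarrow> norm (of_wo x /\<^sub>R norm x) = 1"
  by (rule norm_of_wo_unit) auto

lemma continuous_on_of_wo: "continuous_on S (\<lambda>x. of_wo x /\<^sub>R norm x)" if "0 \<notin> S"
  using that by (intro continuous_intros linear_continuous_on linear_linear[THEN iffD2] linear_of_wo) auto

lemma sph_lift_integrable:
  assumes "continuous_on (sphere 0 1) \<phi>"
  shows "integrable lborel (sph_lift \<phi>)"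
  unfolding sph_lift_def
proof (rule borel_integrable_compact)
  have "{x :: real^('a wo). 1 \<le> norm x \<and> norm x \<le> 2} = cball 0 2 - ball 0 1"
    by auto
  then show "compact {x :: real^('a wo). 1 \<le> norm x \<and> norm x \<le> 2}"
    by (metis compact_cball compact_diff open_ball)
  show "continuous_on {x. 1 \<le> norm x \<and> norm x \<le> 2} (\<lambda>x. \<phi> (of_wo x /\<^sub>R norm x))"
    by (rule continuous_on_compose2[OF assms continuous_on_of_wo])
      (auto simp del: norm_scaleR intro!: norm_of_wo_unit)
qed

section \<open>Linearity, positivity, invariance and differentiation of the mean\<close>

lemma sph_int_add:
  assumes "continuous_on (sphere 0 1) \<phi>" "continuous_on (sphere 0 1) \<psi>"
  shows "sph_int (\<lambda>p. \<phi> p + \<psi> p) = sph_int \<phi> + sph_int \<psi>"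
proof -
  have "sph_lift (\<lambda>p. \<phi> p + \<psi> p) = (\<lambda>x. sph_lift \<phi> x + sph_lift \<psi> x)"
    by (auto simp: sph_lift_def algebra_simps)
  then show ?thesis
    by (simp add: sph_int_def sph_lift_integrable assms)
qed

lemma sph_int_cmult: "sph_int (\<lambda>p. c * \<phi> p) = c * sph_int \<phi>"
proof -
  have "sph_lift (\<lambda>p. c * \<phi> p) = (\<lambda>x. c * sph_lift \<phi> x)"
    by (auto simp: sph_lift_def)
  then show ?thesis by (simp add: sph_int_def)
qed

lemma sph_int_diff:
  assumes "continuous_on (sphere 0 1) \<phi>" "continuous_on (sphere 0 1) \<psi>"
  shows "sph_int (\<lambda>p. \<phi> p - \<psi> p) = sph_int \<phi> - sph_int \<psi>"
proof -
  have "continuous_on (sphere 0 1) (\<lambda>p. -1 * \<psi> p)"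
    by (intro continuous_intros assms)
  from sph_int_add[OF assms(1) this] show ?thesis
    unfolding sph_int_cmult by simp
qed

lemma sph_int_sum:
  assumes "\<And>a. a \<in> A \<Longrightarrow> continuous_on (sphere 0 1) (\<phi> a)"
  shows "sph_int (\<lambda>p. \<Sum>a\<in>A. \<phi> a p) = (\<Sum>a\<in>A. sph_int (\<phi> a))"
  using assms
proof (induction A rule: infinite_finite_induct)
  case (insert a A)
  then show ?case by (simp add: sph_int_add continuous_on_sum)
qed (simp_all add: sph_int_cmult[of 0 "\<lambda>_. 0", simplified])

lemma sph_int_cong:
  assumes "\<And>p. norm p = 1 \<Longrightarrow> \<phi> p = \<psi> p"
  shows "sph_int \<phi> = sph_int \<psi>"
  unfolding sph_int_def
  by (rule Bochner_Integration.integral_cong[OF refl])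
    (auto simp: sph_lift_def indicator_def assms sph_lift_arg simp del: norm_scaleR)

lemma sph_int_mono:
  assumes "continuous_on (sphere 0 1) \<phi>" "continuous_on (sphere 0 1) \<psi>"
    and "\<And>p. norm p = 1 \<Longrightarrow> \<phi> p \<le> \<psi> p"
  shows "sph_int \<phi> \<le> sph_int \<psi>"
  unfolding sph_int_def
  by (rule integral_mono[OF sph_lift_integrable[OF assms(1)] sph_lift_integrable[OF assms(2)]])
    (auto simp: sph_lift_def indicator_def sph_lift_arg simp del: norm_scaleR intro!: assms(3))

lemma sph_int_nonneg:
  assumes "continuous_on (sphere 0 1) \<phi>" "\<And>p. norm p = 1 \<Longrightarrow> 0 \<le> \<phi> p"
  shows "0 \<le> sph_int \<phi>"
  using sph_int_mono[of "\<lambda>_. 0" \<phi>] sph_int_cmult[of 0 "\<lambda>_ :: real^'a. 0"] assms by auto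

lemma sph_int_abs_le:
  fixes \<phi> :: "real^'n::finite \<Rightarrow> real"
  assumes "continuous_on (sphere 0 1) \<phi>" "\<And>p. norm p = 1 \<Longrightarrow> \<bar>\<phi> p\<bar> \<le> M"
  shows "\<bar>sph_int \<phi>\<bar> \<le> M * sph_int (\<lambda>_ :: real^'n. 1)"
proof -
  have *: "\<phi> p \<le> M * 1" "- M * 1 \<le> \<phi> p" if "norm p = 1" for p
    using assms(2)[OF that] by auto
  have "sph_int \<phi> \<le> sph_int (\<lambda>_ :: real^'n. M * 1)"
    by (intro sph_int_mono assms(1) continuous_on_const *(1))
  moreover have "sph_int (\<lambda>_ :: real^'n. (- M) * 1) \<le> sph_int \<phi>"
    by (intro sph_int_mono assms(1) continuous_on_const *(2))
  ultimately show ?thesis unfolding sph_int_cmult by auto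
qed

text \<open>A positive value at \<open>p\<close> persists on an open part of the shell, and a
  nonempty open set is not negligible.\<close>

lemma sph_int_eq_0D:
  fixes \<phi> :: "real^'n::finite \<Rightarrow> real"
  assumes cont: "continuous_on (sphere 0 1) \<phi>" and nonneg: "\<And>p. norm p = 1 \<Longrightarrow> 0 \<le> \<phi> p"
    and zero: "sph_int \<phi> = 0" and p: "norm p = 1"
  shows "\<phi> p = 0"
proof (rule ccontr)
  assume "\<phi> p \<noteq> 0"
  let ?A = "{x :: real^('n wo). 1 < norm x \<and> norm x < 2}"
  define W where "W = ?A \<inter> (\<lambda>x. \<phi> (of_wo x /\<^sub>R norm x)) -` {0<..}"
  have "?A = ball 0 2 - cball 0 1" by auto
  then have "open ?A" by (metis open_ball open_Diff closed_cball)
  moreover have "continuous_on ?A (\<lambda>x. \<phi> (of_wo x /\<^sub>R norm x))"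
    by (rule continuous_on_compose2[OF cont continuous_on_of_wo])
      (auto simp del: norm_scaleR intro!: norm_of_wo_unit)
  ultimately have "open W"
    unfolding W_def by (intro continuous_open_preimage) auto
  \<comment> \<open>Radius 3/2 puts the point strictly inside the shell.\<close>
  have "(3/2) *\<^sub>R to_wo p \<in> W"
    using p nonneg[OF p] \<open>\<phi> p \<noteq> 0\<close> by (auto simp: W_def linear_scale[OF linear_of_wo])
  then have "W \<noteq> {}" by blast
  have "0 \<le> sph_lift \<phi> x" for x :: "real^('n wo)"
    by (auto simp: sph_lift_def indicator_def sph_lift_arg simp del: norm_scaleR intro!: nonneg)
  then have "AE x in lborel. sph_lift \<phi> x = 0"
    using integral_nonneg_eq_0_iff_AE[OF sph_lift_integrable[OF cont]] zero by (simp add: sph_int_def)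
  then have "AE x in lborel. x \<notin> W"
    by eventually_elim (auto simp: W_def sph_lift_def indicator_def)
  then have "AE x in lebesgue. x \<notin> W"
    by (rule AE_completion)
  then have "negligible W"
    using \<open>open W\<close> by (simp add: AE_iff_null_sets negligible_iff_null_sets lmeasurable_open borel_open)
  then show False
    using open_not_negligible[OF \<open>open W\<close> \<open>W \<noteq> {}\<close>] by simp
qed

lemma sph_int_rot:
  fixes \<phi> :: "real^'n::finite \<Rightarrow> real"
  assumes "continuous_on (sphere 0 1) \<phi>"
  shows "sph_int (\<lambda>p. \<phi> (rot i j t p)) = sph_int \<phi>"
proof -
  define T :: "real^('n wo) \<Rightarrow> real^('n wo)" where "T x = to_wo (rot i j t (of_wo x))" for x
  have "linear T"
    using linear_compose[OF linear_compose[OF linear_of_wo linear_rot] linear_to_wo] by (simp add: T_def[abs_def] o_def)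
  then have T: "orthogonal_transformation T"
    unfolding orthogonal_transformation by (simp add: T_def)
  have [measurable]: "T \<in> borel \<rightarrow>\<^sub>M borel"
    using \<open>linear T\<close> by (intro borel_measurable_continuous_onI linear_continuous_on) (simp add: linear_linear)
  have [measurable]: "sph_lift \<phi> \<in> borel_measurable borel"
    using borel_measurable_integrable[OF sph_lift_integrable[OF assms]] by simp
  have "sph_lift (\<lambda>p. \<phi> (rot i j t p)) x = sph_lift \<phi> (T x)" for x :: "real^('n wo)"
    by (simp add: sph_lift_def T_def indicator_def rot_scaleR)
  then have "sph_int (\<lambda>p. \<phi> (rot i j t p)) = integral\<^sup>L lborel (\<lambda>x. sph_lift \<phi> (T x))"
    unfolding sph_int_def by presburger
  also have "\<dots> = integral\<^sup>L (distr lborel borel T) (sph_lift \<phi>)"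
    by (subst integral_distr) auto
  also have "\<dots> = sph_int \<phi>"
    by (simp add: distr_lborel_orthogonal[OF T] sph_int_def)
  finally show ?thesis .
qed

lemma sph_int_continuous:
  fixes G :: "real \<Rightarrow> real^'n::finite \<Rightarrow> real"
  assumes "continuous_on ({a..b} \<times> sphere 0 1) (\<lambda>(t, p). G t p)"
  shows "continuous_on {a..b} (\<lambda>t. sph_int (G t))"
  unfolding continuous_on_iff
proof (intro ballI allI impI)
  fix t e :: real assume t: "t \<in> {a..b}" and "0 < e"
  have c: "continuous_on (sphere 0 1) (G s)" if "s \<in> {a..b}" for s
    using continuous_on_compose2[OF assms, of "sphere 0 1" "\<lambda>p. (s, p)"] that
    by (simp add: continuous_on_Pair image_subset_iff)
  \<comment> \<open>Adding 1 makes \<open>C\<close> positive and strictly larger than the total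
    mass, so the last estimate is strict.\<close>
  define C where "C = 1 + \<bar>sph_int (\<lambda>_ :: real^'n. 1)\<bar>"
  have "uniformly_continuous_on ({a..b} \<times> sphere 0 1) (\<lambda>(t, p). G t p)"
    by (intro compact_uniformly_continuous assms compact_Times) auto
  then obtain d where "d > 0" and d: "\<And>s p s' p'. \<lbrakk>s \<in> {a..b}; norm p = 1; s' \<in> {a..b}; norm p' = 1;
      dist (s', p') (s, p) < d\<rbrakk> \<Longrightarrow> dist (G s' p') (G s p) < e / C"
    using \<open>0 < e\<close> unfolding uniformly_continuous_on_def
    by (metis (no_types, lifting) C_def case_prod_conv mem_Sigma_iff mem_sphere_0 abs_ge_zero add_pos_nonneg divide_pos_pos zero_less_one)
  show "\<exists>d>0. \<forall>x'\<in>{a..b}. dist x' t < d \<longrightarrow> dist (sph_int (G x')) (sph_int (G t)) < e"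
  proof (intro exI[of _ d] conjI ballI impI)
    fix s assume s: "s \<in> {a..b}" "dist s t < d"
    have "\<bar>G s p - G t p\<bar> \<le> e / C" if "norm p = 1" for p
      using d[OF t that s(1) that] s(2) by (simp add: dist_Pair_Pair dist_real_def)
    then have "\<bar>sph_int (\<lambda>p. G s p - G t p)\<bar> \<le> e / C * sph_int (\<lambda>_ :: real^'n. 1)"
      by (intro sph_int_abs_le continuous_intros c s t)
    also have "\<dots> < e / C * C"
      using \<open>0 < e\<close> by (intro mult_strict_left_mono) (auto simp: C_def intro!: divide_pos_pos add_pos_nonneg)
    also have "\<dots> = e" by (simp add: C_def)
    finally show "dist (sph_int (G s)) (sph_int (G t)) < e"
      by (simp add: sph_int_diff[OF c[OF s(1)] c[OF t]] dist_real_def)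
  qed fact
qed

text \<open>The mean value theorem replaces the difference quotient by \<open>G'\<close> at a nearby
  parameter, and uniform continuity on the compact product makes the error small uniformly in
  \<open>p\<close>.\<close>

lemma sph_int_has_derivative:
  fixes G G' :: "real \<Rightarrow> real^'n::finite \<Rightarrow> real"
  assumes der: "\<And>t p. \<lbrakk>t \<in> {a..b}; norm p = 1\<rbrakk> \<Longrightarrow> ((\<lambda>t. G t p) has_real_derivative G' t p) (at t)"
    and cG: "\<And>t. t \<in> {a..b} \<Longrightarrow> continuous_on (sphere 0 1) (G t)"
    and cG': "continuous_on ({a..b} \<times> sphere 0 1) (\<lambda>(t, p). G' t p)"
    and t: "a < t" "t < b"
  shows "((\<lambda>t. sph_int (G t)) has_real_derivative sph_int (G' t)) (at t)"
  unfolding DERIV_def LIM_eq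
proof (intro allI impI)
  fix e :: real assume "0 < e"
  have c: "continuous_on (sphere 0 1) (G' s)" if "s \<in> {a..b}" for s
    using continuous_on_compose2[OF cG', of "sphere 0 1" "\<lambda>p. (s, p)"] that
    by (simp add: continuous_on_Pair image_subset_iff)
  define C where "C = 1 + \<bar>sph_int (\<lambda>_ :: real^'n. 1)\<bar>"
  have "C > 0" by (auto simp: C_def)
  have "uniformly_continuous_on ({a..b} \<times> sphere 0 1) (\<lambda>(t, p). G' t p)"
    by (intro compact_uniformly_continuous cG' compact_Times) auto
  then obtain d where "d > 0" and d: "\<And>s p s' p'. \<lbrakk>s \<in> {a..b}; norm p = 1; s' \<in> {a..b}; norm p' = 1;
      dist (s', p') (s, p) < d\<rbrakk> \<Longrightarrow> dist (G' s' p') (G' s p) < e / C"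
    using \<open>0 < e\<close> \<open>C > 0\<close> unfolding uniformly_continuous_on_def
    by (metis (no_types, lifting) case_prod_conv mem_Sigma_iff mem_sphere_0 divide_pos_pos)
  define d' where "d' = min d (min (t - a) (b - t))"
  show "\<exists>s>0. \<forall>h. h \<noteq> 0 \<and> norm (h - 0) < s \<longrightarrow>
      norm ((sph_int (G (t + h)) - sph_int (G t)) / h - sph_int (G' t)) < e"
  proof (intro exI[of _ d'] conjI allI impI)
    show "0 < d'" using \<open>d > 0\<close> t by (simp add: d'_def)
    fix h :: real assume h: "h \<noteq> 0 \<and> norm (h - 0) < d'"
    have th: "t \<in> {a..b}" "t + h \<in> {a..b}" using h t by (auto simp: d'_def abs_less_iff)
    have bound: "\<bar>(1 / h) * (G (t + h) p - G t p) - G' t p\<bar> \<le> e / C" if p: "norm p = 1" for p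
    proof -
      obtain s where s: "\<bar>s - t\<bar> \<le> \<bar>h\<bar>" "s \<in> {a..b}" and eq: "G (t + h) p - G t p = h * G' s p"
      proof (cases "h > 0")
        case True
        have "\<exists>z>t. z < t + h \<and> G (t + h) p - G t p = (t + h - t) * G' z p"
          by (rule MVT2) (use True th der p in auto)
        then obtain z where "t < z" "z < t + h" "G (t + h) p - G t p = h * G' z p" by auto
        then show ?thesis using th True by (intro that[of z]) auto
      next
        case False
        have "\<exists>z>t + h. z < t \<and> G t p - G (t + h) p = (t - (t + h)) * G' z p"
          by (rule MVT2) (use False h th der p in auto)
        then obtain z where "t + h < z" "z < t" "G t p - G (t + h) p = - h * G' z p" by auto
        then show ?thesis using th False by (intro that[of z]) auto
      qed
      have "\<bar>G' s p - G' t p\<bar> < e / C"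
        using d[OF th(1) p s(2) p] s(1) h by (simp add: dist_Pair_Pair dist_real_def d'_def)
      then show ?thesis unfolding eq using h by simp
    qed
    have "continuous_on (sphere 0 1) (\<lambda>p. (1 / h) * (G (t + h) p - G t p))"
      by (intro continuous_intros cG th)
    note cc = this
    have split: "sph_int (\<lambda>p. (1 / h) * (G (t + h) p - G t p) - G' t p) = (1 / h) * (sph_int (G (t + h)) - sph_int (G t)) - sph_int (G' t)"
      unfolding sph_int_diff[OF cc c[OF th(1)]] sph_int_cmult sph_int_diff[OF cG[OF th(2)] cG[OF th(1)]] ..
    have "\<bar>sph_int (\<lambda>p. (1 / h) * (G (t + h) p - G t p) - G' t p)\<bar> \<le> e / C * sph_int (\<lambda>_ :: real^'n. 1)"
      by (intro sph_int_abs_le continuous_on_diff cc c th bound)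
    also have "\<dots> < e / C * C"
      using \<open>0 < e\<close> \<open>C > 0\<close> by (intro mult_strict_left_mono) (auto simp: C_def)
    also have "\<dots> = e" using \<open>C > 0\<close> by simp
    finally show "norm ((sph_int (G (t + h)) - sph_int (G t)) / h - sph_int (G' t)) < e"
      unfolding split by simp
  qed
qed

section \<open>The spherical Laplacian\<close>

text \<open>
  The fields \<open>x\<^sub>i \<partial>\<^sub>j - x\<^sub>j \<partial>\<^sub>i\<close> generate the rotations, and the sum of their squares over
  unordered pairs is the Laplacian of the unit sphere; \<open>sph_lap\<close> sums over ordered pairs.
\<close>

definition Lop :: "'n::finite \<Rightarrow> 'n \<Rightarrow> (real^'n \<Rightarrow> real) \<Rightarrow> real^'n \<Rightarrow> real" where
  "Lop i j \<phi> p = deriv (\<lambda>t. \<phi> (rot i j t p)) 0"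

definition sph_lap :: "(real^'n::finite \<Rightarrow> real) \<Rightarrow> real^'n \<Rightarrow> real" where
  "sph_lap \<phi> p = (\<Sum>i\<in>UNIV. \<Sum>j\<in>UNIV. Lop i j (Lop i j \<phi>) p) / 2"

text \<open>Differentiability is asked only along rotation orbits, which stay on the sphere, so
  values off the sphere never enter and no extension has to be chosen.\<close>

definition rot_diff :: "(real^'n::finite \<Rightarrow> real) \<Rightarrow> bool" where
  "rot_diff \<phi> \<longleftrightarrow> continuous_on (sphere 0 1) \<phi> \<and>
     (\<forall>i j. continuous_on (sphere 0 1) (Lop i j \<phi>) \<and>
        (\<forall>p. norm p = 1 \<longrightarrow> ((\<lambda>t. \<phi> (rot i j t p)) has_real_derivative Lop i j \<phi> p) (at 0)))"

definition rot_C2 :: "(real^'n::finite \<Rightarrow> real) \<Rightarrow> bool" where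
  "rot_C2 \<phi> \<longleftrightarrow> rot_diff \<phi> \<and> (\<forall>i j. rot_diff (Lop i j \<phi>))"

lemma rot_diffD:
  assumes "rot_diff \<phi>"
  shows "continuous_on (sphere 0 1) \<phi>" "continuous_on (sphere 0 1) (Lop i j \<phi>)"
    and "norm p = 1 \<Longrightarrow> ((\<lambda>t. \<phi> (rot i j t p)) has_real_derivative Lop i j \<phi> p) (at 0)"
  using assms by (auto simp: rot_diff_def)

lemma LopI: "((\<lambda>t. \<phi> (rot i j t p)) has_real_derivative d) (at 0) \<Longrightarrow> Lop i j \<phi> p = d"
  by (simp add: Lop_def DERIV_imp_deriv)

lemma rot_diffI:
  assumes "continuous_on (sphere 0 1) \<phi>" "\<And>i j. continuous_on (sphere 0 1) (\<phi>' i j)"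
    and "\<And>i j p. norm p = 1 \<Longrightarrow> ((\<lambda>t. \<phi> (rot i j t p)) has_real_derivative \<phi>' i j p) (at 0)"
  shows "rot_diff \<phi>"
proof -
  have L: "\<phi>' i j p = Lop i j \<phi> p" if "norm p = 1" for i j p
    using LopI[OF assms(3)[OF that]] by simp
  have "continuous_on (sphere 0 1) (Lop i j \<phi>)" for i j
    by (rule continuous_on_eq[OF assms(2)[of i j]]) (simp add: L)
  then show ?thesis
    using assms(1,3) L by (auto simp: rot_diff_def)
qed

lemma rot_derivative:
  assumes "rot_diff \<phi>" "norm p = 1"
  shows "((\<lambda>t. \<phi> (rot i j t p)) has_real_derivative Lop i j \<phi> (rot i j t p)) (at t)"
proof -
  have "((\<lambda>s. \<phi> (rot i j s (rot i j t p))) has_real_derivative Lop i j \<phi> (rot i j t p)) (at 0)"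
    using assms by (simp add: rot_diff_def)
  then have "((\<lambda>s. \<phi> (rot i j (s + t) p)) has_real_derivative Lop i j \<phi> (rot i j t p)) (at 0)"
    by (simp add: rot_add)
  from DERIV_at_within_shift[of "\<lambda>s. \<phi> (rot i j s p)" "Lop i j \<phi> (rot i j t p)" t 0 UNIV] this show ?thesis
    by (simp add: add.commute)
qed

lemma continuous_on_rot: "continuous_on UNIV (\<lambda>(t, p :: real^'n::finite). rot i j t p)"
  unfolding rot_def case_prod_beta
proof (intro continuous_on_vec_lambda)
  fix k
  have cs: "continuous_on UNIV (\<lambda>x :: real \<times> (real^'n). cos (fst x))" "continuous_on UNIV (\<lambda>x :: real \<times> (real^'n). sin (fst x))"
    by (rule continuous_on_cos continuous_on_sin, rule continuous_on_fst, rule continuous_on_id)+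
  show "continuous_on UNIV (\<lambda>x :: real \<times> (real^'n). if i = j then snd x $ k
      else if k = i then cos (fst x) * snd x $ i - sin (fst x) * snd x $ j
      else if k = j then sin (fst x) * snd x $ i + cos (fst x) * snd x $ j else snd x $ k)"
    by (cases "i = j"; cases "k = i"; cases "k = j"; simp; intro continuous_intros cs)
qed

text \<open>The mean of a rotated function does not depend on the angle; its derivative at angle 0
  is this mean.\<close>

lemma sph_int_Lop:
  assumes "rot_diff \<phi>"
  shows "sph_int (Lop i j \<phi>) = 0"
proof -
  have c: "continuous_on (sphere 0 1) \<phi>" "continuous_on (sphere 0 1) (Lop i j \<phi>)"
    using assms by (auto simp: rot_diff_def)
  have "((\<lambda>t. sph_int (\<lambda>p. \<phi> (rot i j t p))) has_real_derivative sph_int (\<lambda>p. Lop i j \<phi> (rot i j 0 p))) (at 0)"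
  proof (rule sph_int_has_derivative[where a = "-1" and b = 1])
    show "((\<lambda>t. \<phi> (rot i j t p)) has_real_derivative Lop i j \<phi> (rot i j t p)) (at t)" if "norm p = 1" for t p
      by (rule rot_derivative[OF assms that])
    have r: "continuous_on S (\<lambda>x. rot i j (fst x) (snd x))" for S
      using continuous_on_subset[OF continuous_on_rot[of i j], of S] by (simp add: case_prod_beta)
    show "continuous_on (sphere 0 1) (\<lambda>p. \<phi> (rot i j t p))" for t
      by (rule continuous_on_compose2[OF c(1) linear_continuous_on])
        (auto simp: linear_linear linear_rot)
    show "continuous_on ({-1..1} \<times> sphere 0 1) (\<lambda>(t, p). Lop i j \<phi> (rot i j t p))"
      unfolding case_prod_beta by (rule continuous_on_compose2[OF c(2) r]) auto
  qed auto
  moreover have "(\<lambda>t. sph_int (\<lambda>p. \<phi> (rot i j t p))) = (\<lambda>t. sph_int \<phi>)"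
    using sph_int_rot[OF c(1)] by auto
  ultimately have "((\<lambda>t. sph_int \<phi>) has_real_derivative sph_int (Lop i j \<phi>)) (at 0)"
    by simp
  then show ?thesis using DERIV_const DERIV_unique by blast
qed

lemma Lop_mult:
  assumes "rot_diff \<phi>" "rot_diff \<psi>" "norm p = 1"
  shows "Lop i j (\<lambda>p. \<phi> p * \<psi> p) p = \<phi> p * Lop i j \<psi> p + Lop i j \<phi> p * \<psi> p"
proof (rule LopI)
  show "((\<lambda>t. \<phi> (rot i j t p) * \<psi> (rot i j t p)) has_real_derivative \<phi> p * Lop i j \<psi> p + Lop i j \<phi> p * \<psi> p) (at 0)"
    using DERIV_mult[OF rot_diffD(3)[OF assms(1,3)] rot_diffD(3)[OF assms(2,3)]] by (simp add: algebra_simps)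
qed

lemma rot_diff_cong:
  assumes "rot_diff \<phi>" "\<And>p. norm p = 1 \<Longrightarrow> \<phi> p = \<psi> p"
  shows "rot_diff \<psi>" "norm p = 1 \<Longrightarrow> Lop i j \<psi> p = Lop i j \<phi> p"
proof -
  have *: "(\<lambda>t. \<psi> (rot i j t p)) = (\<lambda>t. \<phi> (rot i j t p))" if "norm p = 1" for p i j
    using assms(2) that by (auto simp: fun_eq_iff)
  then show L: "Lop i j \<psi> p = Lop i j \<phi> p" if "norm p = 1" for p i j
    using that by (simp add: Lop_def)
  have "continuous_on (sphere 0 1) \<psi>"
    by (rule continuous_on_eq[OF rot_diffD(1)[OF assms(1)]]) (simp add: assms(2))
  then show "rot_diff \<psi>"
    using rot_diffD[OF assms(1)] * by (intro rot_diffI[where \<phi>' = "\<lambda>i j. Lop i j \<phi>"]) auto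
qed

lemma rot_diff_mult:
  assumes "rot_diff \<phi>" "rot_diff \<psi>"
  shows "rot_diff (\<lambda>p. \<phi> p * \<psi> p)"
proof (rule rot_diffI[where \<phi>' = "\<lambda>i j p. \<phi> p * Lop i j \<psi> p + Lop i j \<phi> p * \<psi> p"])
  show "((\<lambda>t. \<phi> (rot i j t p) * \<psi> (rot i j t p)) has_real_derivative \<phi> p * Lop i j \<psi> p + Lop i j \<phi> p * \<psi> p) (at 0)"
    if "norm p = 1" for i j p
    using DERIV_mult[OF rot_diffD(3)[OF assms(1) that] rot_diffD(3)[OF assms(2) that]] by (simp add: algebra_simps)
qed (intro continuous_intros rot_diffD assms)+

text \<open>Integration by parts: the product rule together with the vanishing mean of a rotational
  derivative.\<close>

lemma sph_int_Lop_skew: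
  assumes "rot_diff \<phi>" "rot_diff \<psi>"
  shows "sph_int (\<lambda>p. Lop i j \<phi> p * \<psi> p) = - sph_int (\<lambda>p. \<phi> p * Lop i j \<psi> p)"
proof -
  have c: "continuous_on (sphere 0 1) \<phi>" "continuous_on (sphere 0 1) \<psi>"
    "continuous_on (sphere 0 1) (Lop i j \<phi>)" "continuous_on (sphere 0 1) (Lop i j \<psi>)"
    using assms by (auto simp: rot_diff_def)
  have "0 = sph_int (Lop i j (\<lambda>p. \<phi> p * \<psi> p))"
    using sph_int_Lop[OF rot_diff_mult[OF assms]] by simp
  also have "\<dots> = sph_int (\<lambda>p. \<phi> p * Lop i j \<psi> p + Lop i j \<phi> p * \<psi> p)"
    by (rule sph_int_cong) (rule Lop_mult[OF assms])
  also have "\<dots> = sph_int (\<lambda>p. \<phi> p * Lop i j \<psi> p) + sph_int (\<lambda>p. Lop i j \<phi> p * \<psi> p)"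
    by (intro sph_int_add continuous_intros c)
  finally show ?thesis by simp
qed

lemma continuous_on_sph_lap:
  assumes "rot_C2 \<phi>" shows "continuous_on (sphere 0 1) (sph_lap \<phi>)"
  unfolding sph_lap_def using assms unfolding rot_C2_def
  by (intro continuous_intros rot_diffD(2)) auto

lemma sph_lap_symmetric:
  assumes "rot_C2 \<phi>" "rot_C2 \<psi>"
  shows "sph_int (\<lambda>p. sph_lap \<phi> p * \<psi> p) = sph_int (\<lambda>p. \<phi> p * sph_lap \<psi> p)"
proof -
  have d: "rot_diff \<phi>" "rot_diff \<psi>" "rot_diff (Lop i j \<phi>)" "rot_diff (Lop i j \<psi>)" for i j
    using assms by (auto simp: rot_C2_def)
  have c: "continuous_on (sphere 0 1) \<phi>" "continuous_on (sphere 0 1) \<psi>"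
    "continuous_on (sphere 0 1) (Lop i j (Lop i j \<phi>))" "continuous_on (sphere 0 1) (Lop i j (Lop i j \<psi>))" for i j
    using d by (auto simp: rot_diff_def)
  have eq: "sph_int (\<lambda>p. Lop i j (Lop i j \<phi>) p * \<psi> p) = sph_int (\<lambda>p. \<phi> p * Lop i j (Lop i j \<psi>) p)" for i j
    using sph_int_Lop_skew[OF d(3) d(2)] sph_int_Lop_skew[OF d(1) d(4)] by simp
  have "sph_int (\<lambda>p. sph_lap \<phi> p * \<psi> p) = sph_int (\<lambda>p. 1/2 * (\<Sum>i\<in>UNIV. \<Sum>j\<in>UNIV. Lop i j (Lop i j \<phi>) p * \<psi> p))"
    by (simp add: sph_lap_def sum_distrib_right)
  also have "\<dots> = 1/2 * (\<Sum>i\<in>UNIV. \<Sum>j\<in>UNIV. sph_int (\<lambda>p. Lop i j (Lop i j \<phi>) p * \<psi> p))"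
    unfolding sph_int_cmult
    by (simp add: sph_int_sum c continuous_on_mult continuous_on_sum)
  also have "\<dots> = 1/2 * (\<Sum>i\<in>UNIV. \<Sum>j\<in>UNIV. sph_int (\<lambda>p. \<phi> p * Lop i j (Lop i j \<psi>) p))"
    by (simp only: eq)
  also have "\<dots> = sph_int (\<lambda>p. 1/2 * (\<Sum>i\<in>UNIV. \<Sum>j\<in>UNIV. \<phi> p * Lop i j (Lop i j \<psi>) p))"
    unfolding sph_int_cmult
    by (simp add: sph_int_sum c continuous_on_mult continuous_on_sum)
  also have "\<dots> = sph_int (\<lambda>p. \<phi> p * sph_lap \<psi> p)"
    by (simp add: sph_lap_def sum_distrib_left sum_divide_distrib)
  finally show ?thesis .
qed

lemma rot_diff_add:
  assumes "rot_diff \<phi>" "rot_diff \<psi>"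
  shows "rot_diff (\<lambda>p. a * \<phi> p + b * \<psi> p)"
    and "norm p = 1 \<Longrightarrow> Lop i j (\<lambda>p. a * \<phi> p + b * \<psi> p) p = a * Lop i j \<phi> p + b * Lop i j \<psi> p"
proof -
  have D: "((\<lambda>t. a * \<phi> (rot i j t p) + b * \<psi> (rot i j t p)) has_real_derivative a * Lop i j \<phi> p + b * Lop i j \<psi> p) (at 0)"
    if "norm p = 1" for i j p
    using assms that by (intro DERIV_add DERIV_cmult rot_diffD(3))
  then show L: "Lop i j (\<lambda>p. a * \<phi> p + b * \<psi> p) p = a * Lop i j \<phi> p + b * Lop i j \<psi> p" if "norm p = 1" for i j p
    using that by (intro LopI)
  show "rot_diff (\<lambda>p. a * \<phi> p + b * \<psi> p)"
    by (rule rot_diffI[OF _ _ D]) (intro continuous_intros rot_diffD assms)+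
qed

lemma rot_C2_add:
  assumes "rot_C2 \<phi>" "rot_C2 \<psi>"
  shows "rot_C2 (\<lambda>p. a * \<phi> p + b * \<psi> p)"
    and "norm p = 1 \<Longrightarrow> sph_lap (\<lambda>p. a * \<phi> p + b * \<psi> p) p = a * sph_lap \<phi> p + b * sph_lap \<psi> p"
proof -
  have d: "rot_diff \<phi>" "rot_diff \<psi>" "rot_diff (Lop i j \<phi>)" "rot_diff (Lop i j \<psi>)" for i j
    using assms by (auto simp: rot_C2_def)
  have L: "a * Lop i j \<phi> p + b * Lop i j \<psi> p = Lop i j (\<lambda>p. a * \<phi> p + b * \<psi> p) p" if "norm p = 1" for i j p
    using rot_diff_add(2)[OF d(1,2) that] by simp
  note LL = rot_diff_cong[OF rot_diff_add(1)[OF d(3,4)] L]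
  show "rot_C2 (\<lambda>p. a * \<phi> p + b * \<psi> p)"
    unfolding rot_C2_def using rot_diff_add(1)[OF d(1,2)] LL(1) by blast
  show "sph_lap (\<lambda>p. a * \<phi> p + b * \<psi> p) p = a * sph_lap \<phi> p + b * sph_lap \<psi> p" if p: "norm p = 1"
    unfolding sph_lap_def using LL(2)[OF _ p] rot_diff_add(2)[OF d(3,4) p]
    by (simp add: sum.distrib sum_distrib_left add_divide_distrib)
qed

text \<open>The mixed term occurs twice in each second derivative; the factor 1/2 in
  \<open>sph_lap\<close> leaves it once.\<close>

lemma rot_C2_mult:
  assumes "rot_C2 \<phi>" "rot_C2 \<psi>"
  shows "rot_C2 (\<lambda>p. \<phi> p * \<psi> p)"
    and "norm p = 1 \<Longrightarrow> sph_lap (\<lambda>p. \<phi> p * \<psi> p) p =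
      \<phi> p * sph_lap \<psi> p + sph_lap \<phi> p * \<psi> p + (\<Sum>i\<in>UNIV. \<Sum>j\<in>UNIV. Lop i j \<phi> p * Lop i j \<psi> p)"
proof -
  have d: "rot_diff \<phi>" "rot_diff \<psi>" "rot_diff (Lop i j \<phi>)" "rot_diff (Lop i j \<psi>)" for i j
    using assms by (auto simp: rot_C2_def)
  have L: "1 * (\<phi> p * Lop i j \<psi> p) + 1 * (Lop i j \<phi> p * \<psi> p) = Lop i j (\<lambda>p. \<phi> p * \<psi> p) p" if "norm p = 1" for i j p
    using Lop_mult[OF d(1,2) that] by simp
  note dd = rot_diff_mult[OF d(1) d(4)] rot_diff_mult[OF d(3) d(2)]
  note LL = rot_diff_cong[OF rot_diff_add(1)[OF dd] L]
  show "rot_C2 (\<lambda>p. \<phi> p * \<psi> p)"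
    unfolding rot_C2_def using rot_diff_mult[OF d(1,2)] LL(1) by blast
  assume p: "norm p = 1"
  have "Lop i j (Lop i j (\<lambda>p. \<phi> p * \<psi> p)) p = \<phi> p * Lop i j (Lop i j \<psi>) p + 2 * (Lop i j \<phi> p * Lop i j \<psi> p) + Lop i j (Lop i j \<phi>) p * \<psi> p" for i j
    using LL(2)[OF _ p] rot_diff_add(2)[OF dd p, where a = 1 and b = 1] Lop_mult[OF d(1) d(4) p] Lop_mult[OF d(3) d(2) p]
    by simp
  then show "sph_lap (\<lambda>p. \<phi> p * \<psi> p) p =
      \<phi> p * sph_lap \<psi> p + sph_lap \<phi> p * \<psi> p + (\<Sum>i\<in>UNIV. \<Sum>j\<in>UNIV. Lop i j \<phi> p * Lop i j \<psi> p)"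
    unfolding sph_lap_def
    by (simp add: sum.distrib add_divide_distrib flip: sum_distrib_left sum_distrib_right)
qed

section \<open>Sorted enumerations\<close>

text \<open>Greedy choice of a minimiser among the elements not yet used; finite sublevel sets make
  minimisers exist and leave nothing out.\<close>

lemma sorted_enumeration:
  fixes v :: "'a \<Rightarrow> real"
  assumes "infinite A" and fin: "\<And>t. finite {a \<in> A. v a \<le> t}"
  obtains e :: "nat \<Rightarrow> 'a" where "bij_betw e UNIV A" "mono (v \<circ> e)"
proof -
  have ex: "\<exists>a. a \<in> A - X \<and> (\<forall>b\<in>A - X. v a \<le> v b)" if X: "finite X" for X
  proof -
    have "infinite (A - X)" using \<open>infinite A\<close> X by simp
    then obtain c where c: "c \<in> A - X" by (metis ex_in_conv infinite_imp_nonempty)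
    let ?F = "{a \<in> A - X. v a \<le> v c}"
    have F: "finite ?F" by (rule finite_subset[OF _ fin[of "v c"]]) auto
    have "c \<in> ?F" using c by auto
    then have "?F \<noteq> {}" by blast
    then obtain a where a: "a \<in> ?F" "\<And>b. b \<in> ?F \<Longrightarrow> v a \<le> v b"
      using arg_min_if_finite(1)[OF F, of v] arg_min_least[OF F, of _ v] by blast
    then have "v a \<le> v b" if "b \<in> A - X" for b
      using that c by (cases "v b \<le> v c") force+
    with a show ?thesis by blast
  qed
  define step where "step X = (SOME a. a \<in> A - X \<and> (\<forall>b\<in>A - X. v a \<le> v b))" for X
  have step: "step X \<in> A - X" "\<And>b. b \<in> A - X \<Longrightarrow> v (step X) \<le> v b" if "finite X" for X
    using someI_ex[OF ex[OF that]] unfolding step_def by auto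
  define Xs where "Xs = rec_nat {} (\<lambda>_ X. insert (step X) X)"
  have X0: "Xs 0 = {}" and XS: "Xs (Suc n) = insert (step (Xs n)) (Xs n)" for n
    by (simp_all add: Xs_def)
  have finX: "finite (Xs n)" for n by (induction n) (auto simp: X0 XS)
  have mem: "step (Xs m) \<in> Xs n" if "m < n" for m n
    using that by (induction n) (auto simp: XS less_Suc_eq)
  define e where "e n = step (Xs n)" for n
  have inj: "inj e"
  proof (rule linorder_injI)
    show "e m \<noteq> e n" if "m < n" for m n
      using mem[OF that] step(1)[OF finX, of n] by (auto simp: e_def)
  qed
  have eA: "e n \<in> A" for n using step(1)[OF finX] by (auto simp: e_def)
  have "mono (v \<circ> e)"
  proof (rule incseq_SucI)
    show "(v \<circ> e) n \<le> (v \<circ> e) (Suc n)" for n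
      using step(1)[OF finX, of "Suc n"] step(2)[OF finX, of "step (Xs (Suc n))" n]
      by (auto simp: e_def XS)
  qed
  moreover have "range e = A"
  proof (rule ccontr)
    assume "range e \<noteq> A"
    then obtain a where a: "a \<in> A" "a \<notin> range e" using eA by auto
    have "Xs n \<subseteq> range e" for n by (induction n) (auto simp: X0 XS e_def)
    \<comment> \<open>An element never chosen would bound all chosen values, putting infinitely many
      of them into one sublevel set.\<close>
    then have "v (e n) \<le> v a" for n
      using step(2)[OF finX, of a n] a by (auto simp: e_def)
    then have "range e \<subseteq> {b \<in> A. v b \<le> v a}" using eA by auto
    then have "finite (range e)" using fin finite_subset by blast
    then show False using inj finite_imageD by blast
  qed
  ultimately show ?thesis
    using inj by (intro that[of e]) (auto simp: bij_betw_def)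
qed

lemma finite_sublevel_if_at_top:
  fixes s :: "nat \<Rightarrow> real"
  assumes "filterlim s at_top sequentially"
  shows "finite {k. s k \<le> t}"
proof -
  obtain N where "\<And>k. k \<ge> N \<Longrightarrow> t < s k"
    using assms by (force simp: filterlim_at_top_dense eventually_sequentially)
  then have "{k. s k \<le> t} \<subseteq> {..<N}" by (auto simp: not_le[symmetric])
  then show ?thesis by (rule finite_subset) simp
qed

text \<open>At the first index \<open>k\<close> where the sequences differ, let \<open>s\<close> be
  the smaller one. The value \<open>s k\<close> is taken by \<open>s'\<close> only at earlier
  indices, where \<open>s\<close> takes it as well; but \<open>s\<close> takes it also at
  \<open>k\<close>, so the multiplicities differ.\<close>

lemma sorted_sequence_unique:
  fixes s s' :: "nat \<Rightarrow> real"
  assumes "mono s" "mono s'" "filterlim s at_top sequentially" "filterlim s' at_top sequentially"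
    and card: "\<And>\<tau>. card {k. s k = \<tau>} = card {k. s' k = \<tau>}"
  shows "s = s'"
proof (rule ccontr)
  have *: False if m: "mono s" "mono s'" and fin: "\<And>t. finite {k. s k \<le> t}"
     and card: "\<And>\<tau>. card {k. s k = \<tau>} = card {k. s' k = \<tau>}"
     and k: "\<And>i. i < k \<Longrightarrow> s i = s' i" "s k < s' k" for s s' :: "nat \<Rightarrow> real" and k
  proof -
    have "{i. s' i = s k} \<subseteq> {i. s i = s k} - {k}"
    proof
      fix i assume i: "i \<in> {i. s' i = s k}"
      then have "i < k" using m(2) k(2) by (metis (mono_tags) linorder_not_le mem_Collect_eq monoD)
      then show "i \<in> {i. s i = s k} - {k}" using i k(1) by auto
    qed
    moreover have f: "finite {i. s i = s k}" by (rule finite_subset[OF _ fin[of "s k"]]) auto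
    ultimately have "card {i. s' i = s k} \<le> card ({i. s i = s k} - {k})"
      by (intro card_mono) auto
    also have "\<dots> < card {i. s i = s k}" using f by (intro psubset_card_mono) auto
    finally show False using card by simp
  qed
  assume "s \<noteq> s'"
  then have ex: "\<exists>k. s k \<noteq> s' k" by auto
  define k where "k = (LEAST k. s k \<noteq> s' k)"
  have k: "s k \<noteq> s' k" "\<And>i. i < k \<Longrightarrow> s i = s' i"
    using LeastI_ex[OF ex] not_less_Least unfolding k_def by blast+
  show False
  proof (cases "s k < s' k")
    case True
    then show False using *[of s s' k] assms k finite_sublevel_if_at_top by auto
  next
    case False
    then have "s' k < s k" using k by simp
    then show False using *[of s' s k] assms k finite_sublevel_if_at_top by auto
  qed
qed

text \<open>Pigeonhole principle: if the claim failed, the \<open>k + 1\<close> elements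
  \<open>f 0, ..., f k\<close> would all have \<open>v\<close>-values below \<open>v (e k)\<close>
  and so would lie among the \<open>k\<close> elements \<open>e 0, ..., e (k - 1)\<close>. For the
  exceptional \<open>a0\<close>, whose two values are both 0, this uses that \<open>w (f k)\<close>
  is positive.\<close>

lemma sorted_enumeration_less:
  fixes v w :: "'a \<Rightarrow> real"
  assumes e: "bij_betw e UNIV A" "mono (v \<circ> e)" and f: "bij_betw f UNIV A" "mono (w \<circ> f)"
    and a0: "v a0 = 0" "w a0 = 0" and less: "\<And>a. a \<in> A \<Longrightarrow> a \<noteq> a0 \<Longrightarrow> 0 < v a \<and> v a < w a"
    and "1 \<le> (k :: nat)"
  shows "v (e k) < w (f k)"
proof (rule ccontr)
  assume "\<not> ?thesis"
  then have le: "w (f k) \<le> v (e k)" by simp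
  have fA: "f i \<in> A" for i using f(1) by (auto simp: bij_betw_def)
  have ef: "inj e" "inj f" "range e = A" using e(1) f(1) by (auto simp: bij_betw_def)
  have mf: "w (f i) \<le> w (f k)" if "i \<le> k" for i using f(2) that by (auto simp: mono_def)
  \<comment> \<open>This is where \<open>1 \<le> k\<close> matters: one of \<open>f 0\<close> and
    \<open>f 1\<close> differs from \<open>a0\<close>.\<close>
  have "0 < w (f k)"
  proof (cases "f 0 = a0")
    case True
    then have "f 1 \<noteq> a0" using injD[OF ef(2), of 1 0] by auto
    then show ?thesis using less[OF fA, of 1] mf[of 1] \<open>1 \<le> k\<close> by auto
  next
    case False
    then show ?thesis using less[OF fA, of 0] mf[of 0] by auto
  qed
  have "f ` {..k} \<subseteq> e ` {..<k}"
  proof (intro image_subsetI)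
    fix i assume "i \<in> {..k}"
    then have "w (f i) \<le> w (f k)" using mf by simp
    then have *: "v (f i) < w (f k)"
      using a0 less[OF fA, of i] \<open>0 < w (f k)\<close> by (cases "f i = a0") auto
    obtain j where j: "f i = e j" using ef(3) fA by blast
    have "j < k"
    proof (rule ccontr)
      assume "\<not> j < k"
      then have "v (e k) \<le> v (e j)" using e(2) by (auto simp: mono_def)
      then show False using * le j by simp
    qed
    then show "f i \<in> e ` {..<k}" using j by simp
  qed
  then have "card (f ` {..k}) \<le> card (e ` {..<k})" by (intro card_mono) auto
  moreover have "card (f ` {..k}) = k + 1" "card (e ` {..<k}) \<le> k"
    using ef(2) card_image[of f "{..k}"] card_image_le[of "{..<k}" e] by (auto simp: inj_on_subset)
  ultimately show False by simp
qed

section \<open>Linear independence of a finite family of functions\<close>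

lemma sum_fun_apply: "(\<Sum>a\<in>A. f a) x = (\<Sum>a\<in>A. f a x)" for f :: "'b \<Rightarrow> 'a \<Rightarrow> 'c::comm_monoid_add"
  by (induction A rule: infinite_finite_induct) auto

text \<open>Injectivity is part of the conclusion because dimensions count elements of the image: a
  coincidence of two members would be a nontrivial relation with coefficients 1 and -1.\<close>

lemma independent_family:
  fixes f :: "'b \<Rightarrow> 'a \<Rightarrow> real"
  assumes "finite A" and *: "\<And>c. (\<And>x. (\<Sum>a\<in>A. c a * f a x) = 0) \<Longrightarrow> \<forall>a\<in>A. c a = 0"
  shows "inj_on f A" "fun_space.independent (f ` A)"
proof -
  show inj: "inj_on f A"
  proof (rule inj_onI, rule ccontr)
    fix a b assume ab: "a \<in> A" "b \<in> A" "f a = f b" "a \<noteq> b"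
    let ?c = "\<lambda>x. (if x = a then 1 else 0) - (if x = b then 1 else (0::real))"
    have "(\<Sum>z\<in>A. ?c z * f z x) = 0" for x
      using ab \<open>finite A\<close> by (simp add: left_diff_distrib sum_subtractf if_distrib[of "\<lambda>y. y * _"] sum.delta cong: if_cong)
    from *[OF this] ab show False by force
  qed
  show "fun_space.independent (f ` A)"
  proof
    assume "fun_space.dependent (f ` A)"
    then obtain u v where v: "v \<in> f ` A" "u v \<noteq> 0" and u: "(\<Sum>g\<in>f ` A. (\<lambda>x. u g * g x)) = 0"
      using fun_space.dependent_finite[of "f ` A"] \<open>finite A\<close> by auto
    have "(\<Sum>a\<in>A. u (f a) * f a x) = 0" for x
      using fun_cong[OF u, of x] by (simp add: sum.reindex[OF inj] sum_fun_apply zero_fun_def)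
    from *[OF this] v show False by auto
  qed
qed

section \<open>Spherical harmonics\<close>

text \<open>Monomials are indexed by words, so permuted words give the same function, and on the
  sphere the squares of the coordinates sum to 1. Both kinds of dependence are removed after
  orthogonalisation by discarding zero functions.\<close>

definition mono_fn :: "'n::finite list \<Rightarrow> real^'n \<Rightarrow> real" where
  "mono_fn xs p = prod_list (map (\<lambda>k. p $ k) xs)"

lemma mono_fn_simps [simp]: "mono_fn [] = (\<lambda>p. 1)" "mono_fn (k # xs) = (\<lambda>p. p $ k * mono_fn xs p)"
  by (auto simp: mono_fn_def)

text \<open>Restrictions to the sphere of polynomials of degree strictly less than \<open>m\<close>,
  with equality required on the sphere only. The strict bound lets \<open>sph_poly m\<close> hold
  the lower-order remainders of monomials of degree \<open>m\<close>.\<close>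

inductive sph_poly :: "nat \<Rightarrow> (real^'n::finite \<Rightarrow> real) \<Rightarrow> bool" for m where
  zero: "(\<And>p. norm p = 1 \<Longrightarrow> f p = 0) \<Longrightarrow> sph_poly m f"
| mono_fn: "length xs < m \<Longrightarrow> (\<And>p. norm p = 1 \<Longrightarrow> f p = mono_fn xs p) \<Longrightarrow> sph_poly m f"
| lin: "sph_poly m f \<Longrightarrow> sph_poly m g \<Longrightarrow> (\<And>p. norm p = 1 \<Longrightarrow> h p = a * f p + b * g p) \<Longrightarrow> sph_poly m h"

lemma sph_poly_cong:
  assumes "sph_poly m f" "\<And>p. norm p = 1 \<Longrightarrow> g p = f p"
  shows "sph_poly m g"
  by (rule sph_poly.lin[OF assms(1) assms(1), where a = 1 and b = 0]) (use assms(2) in auto)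

lemma sph_poly_add: "sph_poly m f \<Longrightarrow> sph_poly m g \<Longrightarrow> sph_poly m (\<lambda>p. f p + g p)"
  by (rule sph_poly.lin[where a = 1 and b = 1]) auto

lemma sph_poly_diff: "sph_poly m f \<Longrightarrow> sph_poly m g \<Longrightarrow> sph_poly m (\<lambda>p. f p - g p)"
  by (rule sph_poly.lin[where a = 1 and b = "-1"]) auto

lemma sph_poly_cmult: "sph_poly m f \<Longrightarrow> sph_poly m (\<lambda>p. c * f p)"
  by (rule sph_poly.lin[where a = c and b = 0]) auto

lemma sph_poly_sum: "(\<And>a. a \<in> A \<Longrightarrow> sph_poly m (f a)) \<Longrightarrow> sph_poly m (\<lambda>p. \<Sum>a\<in>A. f a p)"
  by (induction A rule: infinite_finite_induct) (auto intro: sph_poly_add sph_poly.zero)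

lemma sph_poly_mono: "sph_poly m f \<Longrightarrow> m \<le> m' \<Longrightarrow> sph_poly m' f"
proof (induction rule: sph_poly.induct)
  case (mono_fn xs f)
  then show ?case by (intro sph_poly.mono_fn[of xs]) auto
qed (auto intro: sph_poly.zero sph_poly.lin)

lemma sph_poly_coord: "sph_poly m f \<Longrightarrow> sph_poly (Suc m) (\<lambda>p. p $ k * f p)"
proof (induction rule: sph_poly.induct)
  case (zero f)
  then show ?case by (auto intro: sph_poly.zero)
next
  case (mono_fn xs f)
  then show ?case by (intro sph_poly.mono_fn[of "k # xs"]) auto
next
  case (lin f g h a b)
  then show ?case by (intro sph_poly.lin[OF lin.IH, where a = a and b = b]) (auto simp: algebra_simps)
qed

lemma sph_poly_mono_fn: "sph_poly (Suc (length xs)) (mono_fn xs)"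
  by (rule sph_poly.mono_fn[of xs]) auto

section \<open>The spherical Laplacian of coordinates and monomials\<close>

lemma rot_diff_const: "rot_diff (\<lambda>p. c)" and Lop_const: "Lop i j (\<lambda>p. c) = (\<lambda>p. 0)"
  by (auto simp: Lop_def[abs_def] intro!: rot_diffI[where \<phi>' = "\<lambda>i j p. 0"])

lemma rot_C2_const: "rot_C2 (\<lambda>p. c)" and sph_lap_const: "sph_lap (\<lambda>p. c) p = 0"
  by (simp_all add: rot_C2_def rot_diff_const Lop_const sph_lap_def)

lemma has_derivative_coord_rot:
  "((\<lambda>t. rot i j t p $ k) has_real_derivative rot_gen i j p $ k) (at 0)"
  using bounded_linear.has_vector_derivative[OF bounded_linear_vec_nth has_vector_derivative_rot]
  by (simp add: has_real_derivative_iff_has_vector_derivative)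

lemma Lop_coord: "Lop i j (\<lambda>p. p $ k) = (\<lambda>p. rot_gen i j p $ k)"
  by (auto intro: LopI has_derivative_coord_rot)

text \<open>Put as a combination with constant coefficients, the form to which
  \<open>rot_diff_add\<close> applies.\<close>

lemma rot_gen_nth: "rot_gen i j p $ k = (if j = k then 1 else 0) * p $ i + (- (if i = k then 1 else 0)) * p $ j"
  by (auto simp: rot_gen_def axis_def)

lemma rot_diff_coord: "rot_diff (\<lambda>p. p $ k)"
  by (rule rot_diffI[where \<phi>' = "\<lambda>i j p. rot_gen i j p $ k", OF _ _ has_derivative_coord_rot])
    (auto simp: rot_gen_nth intro!: continuous_intros)

lemma rot_C2_coord: "rot_C2 (\<lambda>p. p $ k)"
  unfolding rot_C2_def Lop_coord rot_gen_nth
  by (intro conjI allI rot_diff_add(1) rot_diff_coord)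

lemma Lop_Lop_coord:
  assumes "norm p = 1"
  shows "Lop i j (Lop i j (\<lambda>p. p $ k)) p =
    (if j = k then 1 else 0) * rot_gen i j p $ i + (- (if i = k then 1 else 0)) * rot_gen i j p $ j"
  unfolding Lop_coord rot_gen_nth[of i j _ k]
  using rot_diff_add(2)[OF rot_diff_coord rot_diff_coord assms] by (simp only: Lop_coord)

lemma sum_delta_mult:
  fixes f :: "'n::finite \<Rightarrow> real"
  shows "(\<Sum>i\<in>UNIV. (if i = k then c else 0) * f i) = c * f k" "(\<Sum>i\<in>UNIV. (if k = i then c else 0) * f i) = c * f k"
  by (simp_all add: if_distrib[of "\<lambda>x. x * _"] sum.delta sum.delta' cong: if_cong)

lemma sph_lap_coord:
  fixes p :: "real^'n::finite"
  assumes "norm p = 1"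
  shows "sph_lap (\<lambda>p. p $ k) p = - (real CARD('n) - 1) * p $ k"
proof -
  let ?d = "\<lambda>i j. if i = (j::'n) then 1 else (0::real)"
  have "(\<Sum>i\<in>UNIV. \<Sum>j\<in>UNIV. Lop i j (Lop i j (\<lambda>p. p $ k)) p)
     = (\<Sum>i\<in>UNIV. \<Sum>j\<in>UNIV. ?d j k * (?d j i * p $ i - p $ j)) + (\<Sum>i\<in>UNIV. \<Sum>j\<in>UNIV. ?d i k * (?d i j * p $ j - p $ i))"
    unfolding Lop_Lop_coord[OF assms] sum.distrib[symmetric]
    by (intro sum.cong refl) (auto simp: rot_gen_nth)
  also have "(\<Sum>i\<in>UNIV. \<Sum>j\<in>UNIV. ?d j k * (?d j i * p $ i - p $ j)) = (\<Sum>i\<in>UNIV. ?d k i * p $ i - p $ k)"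
    by (simp only: sum_delta_mult mult_1)
  also have "\<dots> = p $ k - real CARD('n) * p $ k"
    by (simp only: sum_subtractf sum_delta_mult mult_1) simp
  also have "(\<Sum>i\<in>UNIV. \<Sum>j\<in>UNIV. ?d i k * (?d i j * p $ j - p $ i)) = (\<Sum>i\<in>UNIV. ?d i k * (p $ i - real CARD('n) * p $ i))"
    by (simp only: sum_distrib_left[symmetric] sum_subtractf sum_delta_mult mult_1) simp
  also have "\<dots> = p $ k - real CARD('n) * p $ k"
    by (simp only: sum_delta_mult mult_1)
  finally show ?thesis by (simp add: sph_lap_def algebra_simps)
qed

text \<open>On the sphere the tangential gradients of two coordinates have inner product
  \<open>\<delta>_kl - p_k p_l\<close>; summing over ordered pairs counts it twice.\<close>

lemma Lop_coord_product:
  fixes p :: "real^'n::finite"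
  assumes "norm p = 1"
  shows "(\<Sum>i\<in>UNIV. \<Sum>j\<in>UNIV. Lop i j (\<lambda>p. p $ k) p * Lop i j (\<lambda>p. p $ l) p)
    = 2 * ((if k = l then 1 else 0) - p $ k * p $ l)"
proof -
  let ?d = "\<lambda>i j. if i = (j::'n) then 1 else (0::real)"
  have nrm: "(\<Sum>i\<in>UNIV. p $ i * p $ i) = 1"
    using assms by (simp add: norm_vec_def L2_set_def power2_eq_square)
  have "(\<Sum>i\<in>UNIV. \<Sum>j\<in>UNIV. Lop i j (\<lambda>p. p $ k) p * Lop i j (\<lambda>p. p $ l) p)
    = (\<Sum>i\<in>UNIV. \<Sum>j\<in>UNIV. ?d k j * (?d l j * (p $ i * p $ i))) - (\<Sum>i\<in>UNIV. \<Sum>j\<in>UNIV. ?d k j * (?d l i * (p $ i * p $ j)))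
     - (\<Sum>i\<in>UNIV. \<Sum>j\<in>UNIV. ?d k i * (?d l j * (p $ i * p $ j))) + (\<Sum>i\<in>UNIV. \<Sum>j\<in>UNIV. ?d k i * (?d l i * (p $ j * p $ j)))"
    unfolding Lop_coord sum.distrib[symmetric] sum_subtractf[symmetric]
    by (intro sum.cong refl) (auto simp: rot_gen_nth algebra_simps)
  also have "\<dots> = 2 * (?d l k - p $ k * p $ l)"
    by (simp only: sum_distrib_left[symmetric] sum_delta_mult mult_1 nrm) simp
  finally show ?thesis by (simp add: eq_commute[of k l])
qed

lemma rot_C2_mono_fn: "rot_C2 (mono_fn xs)"
proof (induction xs)
  case Nil
  then show ?case by (simp add: rot_C2_const)
next
  case (Cons k xs)
  then show ?case using rot_C2_mult(1)[OF rot_C2_coord Cons] by simp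
qed

lemma rot_C2_cong:
  assumes "rot_C2 \<phi>" "\<And>p. norm p = 1 \<Longrightarrow> \<psi> p = \<phi> p"
  shows "rot_C2 \<psi>" "norm p = 1 \<Longrightarrow> sph_lap \<psi> p = sph_lap \<phi> p"
proof -
  have d: "rot_diff \<phi>" "rot_diff (Lop i j \<phi>)" for i j
    using assms(1) by (auto simp: rot_C2_def)
  have c: "Lop i j \<phi> p = Lop i j \<psi> p" if "norm p = 1" for i j p
    using rot_diff_cong(2)[OF d(1) _ that, of \<psi> i j] assms(2) by simp
  have "rot_diff \<psi>"
    using rot_diff_cong(1)[OF d(1), of \<psi>] assms(2) by simp
  then show "rot_C2 \<psi>"
    unfolding rot_C2_def using rot_diff_cong(1)[OF d(2) c] by blast
  show "sph_lap \<psi> p = sph_lap \<phi> p" if "norm p = 1"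
    unfolding sph_lap_def using rot_diff_cong(2)[OF d(2) c that] by simp
qed

lemma sph_poly_rot_C2: "sph_poly m f \<Longrightarrow> rot_C2 f"
proof (induction rule: sph_poly.induct)
  case (zero f)
  then show ?case by (rule rot_C2_cong(1)[OF rot_C2_const])
next
  case (mono_fn xs f)
  then show ?case by (intro rot_C2_cong(1)[OF rot_C2_mono_fn])
next
  case (lin f g h a b)
  then show ?case by (intro rot_C2_cong(1)[OF rot_C2_add(1)[OF lin.IH]])
qed

lemma rot_C2_continuous: "rot_C2 f \<Longrightarrow> continuous_on (sphere 0 1) f"
  by (simp add: rot_C2_def rot_diff_def)

definition sph_eig :: "'n::finite itself \<Rightarrow> nat \<Rightarrow> real" where
  "sph_eig _ m = real m * (real m + real CARD('n) - 2)"

text \<open>The double sum is twice the inner product of the tangential gradients. By Euler's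
  relation it equals twice the k-th partial derivative of the monomial minus
  \<open>2 * length xs\<close> times \<open>p $ k * mono_fn xs p\<close>, so in the stated
  combination the top degree cancels.\<close>

lemma Lop_coord_mono_fn:
  fixes xs :: "'n::finite list"
  shows "sph_poly (Suc (length xs)) (\<lambda>p. (\<Sum>i\<in>UNIV. \<Sum>j\<in>UNIV. Lop i j (\<lambda>p. p $ k) p * Lop i j (mono_fn xs) p)
     + 2 * real (length xs) * (p $ k * mono_fn xs p))"
proof (induction xs)
  case Nil
  show ?case by (rule sph_poly.zero) (simp add: Lop_const)
next
  case (Cons l ys)
  let ?G = "\<lambda>xs p. (\<Sum>i\<in>UNIV. \<Sum>j\<in>UNIV. Lop i j (\<lambda>p. p $ k) p * Lop i j (mono_fn xs) p)"
  let ?R = "\<lambda>p. ?G ys p + 2 * real (length ys) * (p $ k * mono_fn ys p)"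
  have d: "rot_diff (\<lambda>p. p $ l)" "rot_diff (mono_fn ys)"
    using rot_C2_coord rot_C2_mono_fn by (auto simp: rot_C2_def)
  have "?G (l # ys) p + 2 * real (length (l # ys)) * (p $ k * mono_fn (l # ys) p)
      = p $ l * ?R p + (2 * (if k = l then 1 else 0)) * mono_fn ys p" if p: "norm p = 1" for p
  proof -
    have "?G (l # ys) p = p $ l * ?G ys p + mono_fn ys p * (\<Sum>i\<in>UNIV. \<Sum>j\<in>UNIV. Lop i j (\<lambda>p. p $ k) p * Lop i j (\<lambda>p. p $ l) p)"
      unfolding sum_distrib_left sum.distrib[symmetric]
      by (intro sum.cong refl) (simp add: Lop_mult[OF d p] algebra_simps)
    also have "(\<Sum>i\<in>UNIV. \<Sum>j\<in>UNIV. Lop i j (\<lambda>p. p $ k) p * Lop i j (\<lambda>p. p $ l) p) = 2 * ((if k = l then 1 else 0) - p $ k * p $ l)"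
      by (rule Lop_coord_product[OF p])
    finally show ?thesis by (simp add: algebra_simps)
  qed
  moreover have "sph_poly (Suc (Suc (length ys))) (\<lambda>p. p $ l * ?R p + (2 * (if k = l then 1 else 0)) * mono_fn ys p)"
    by (intro sph_poly_add sph_poly_coord Cons sph_poly_cmult sph_poly_mono[OF sph_poly_mono_fn]) auto
  ultimately show ?case
    using sph_poly_cong by (metis (no_types, lifting) length_Cons)
qed

text \<open>A monomial of degree m is an eigenfunction up to lower order. One more coordinate raises
  the factor m (m + n - 2) by (n - 1) + 2 m: the first part is the eigenvalue of the coordinate, the
  second comes from the gradient product.\<close>

lemma sph_lap_mono_fn:
  fixes xs :: "'n::finite list"
  shows "sph_poly (length xs) (\<lambda>p. sph_lap (mono_fn xs) p + sph_eig TYPE('n) (length xs) * mono_fn xs p)"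
proof (induction xs)
  case Nil
  show ?case by (rule sph_poly.zero) (simp add: sph_lap_const sph_eig_def)
next
  case (Cons k ys)
  let ?G = "\<lambda>p. (\<Sum>i\<in>UNIV. \<Sum>j\<in>UNIV. Lop i j (\<lambda>p. p $ k) p * Lop i j (mono_fn ys) p)"
  let ?R = "\<lambda>p. sph_lap (mono_fn ys) p + sph_eig TYPE('n) (length ys) * mono_fn ys p"
  have "sph_lap (mono_fn (k # ys)) p + sph_eig TYPE('n) (length (k # ys)) * mono_fn (k # ys) p
     = p $ k * ?R p + (?G p + 2 * real (length ys) * (p $ k * mono_fn ys p))" if p: "norm p = 1" for p
  proof -
    have e1: "sph_lap (mono_fn (k # ys)) p = p $ k * sph_lap (mono_fn ys) p + (- (real CARD('n) - 1) * p $ k) * mono_fn ys p + ?G p"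
      using rot_C2_mult(2)[OF rot_C2_coord rot_C2_mono_fn p, of k ys] sph_lap_coord[OF p, of k] by simp
    have e2: "sph_eig TYPE('n) (length (k # ys)) = sph_eig TYPE('n) (length ys) + (real CARD('n) - 1) + 2 * real (length ys)"
      by (simp add: sph_eig_def algebra_simps)
    show ?thesis unfolding e1 e2 by (simp add: algebra_simps)
  qed
  moreover have "sph_poly (Suc (length ys)) (\<lambda>p. p $ k * ?R p + (?G p + 2 * real (length ys) * (p $ k * mono_fn ys p)))"
    by (rule sph_poly_add[OF sph_poly_coord[OF Cons] Lop_coord_mono_fn])
  ultimately show ?case
    using sph_poly_cong by (metis (no_types, lifting) length_Cons)
qed

lemma sph_poly_sph_lap: "sph_poly m f \<Longrightarrow> sph_poly m (sph_lap f)" for f :: "real^'n::finite \<Rightarrow> real"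
proof (induction rule: sph_poly.induct)
  case (zero f)
  show ?case
    by (rule sph_poly.zero) (use rot_C2_cong(2)[OF rot_C2_const[of 0] zero] in \<open>simp add: sph_lap_const\<close>)
next
  case (mono_fn xs f)
  have "sph_poly m (\<lambda>p. (sph_lap (mono_fn xs) p + sph_eig TYPE('n) (length xs) * mono_fn xs p) - sph_eig TYPE('n) (length xs) * mono_fn xs p)"
    using mono_fn(1) by (intro sph_poly_diff sph_poly_cmult sph_poly_mono[OF sph_lap_mono_fn] sph_poly_mono[OF sph_poly_mono_fn]) auto
  then show ?case
    by (rule sph_poly_cong) (use rot_C2_cong(2)[OF rot_C2_mono_fn mono_fn(2)] in simp)
next
  case (lin f g h a b)
  note c = sph_poly_rot_C2[OF lin.hyps(1)] sph_poly_rot_C2[OF lin.hyps(2)]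
  show ?case
    by (rule sph_poly.lin[OF lin.IH, where a = a and b = b])
      (use rot_C2_cong(2)[OF rot_C2_add(1)[OF c] lin.hyps(3)] rot_C2_add(2)[OF c] in simp)
qed

text \<open>Orthogonalisation without normalisation. If an earlier function vanishes on the sphere,
  its squared norm is 0 and the quotient is 0 by convention, so dependent functions may occur in the
  input.\<close>

fun gram_schmidt :: "(nat \<Rightarrow> real^'n::finite \<Rightarrow> real) \<Rightarrow> nat \<Rightarrow> real^'n \<Rightarrow> real" where
  "gram_schmidt q k = (\<lambda>p. q k p - (\<Sum>j<k. sph_int (\<lambda>p. q k p * gram_schmidt q j p) /
      sph_int (\<lambda>p. gram_schmidt q j p * gram_schmidt q j p) * gram_schmidt q j p))"

declare gram_schmidt.simps [simp del]

lemma gram_schmidt_continuous: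
  assumes "\<And>k. continuous_on (sphere 0 1) (q k)"
  shows "continuous_on (sphere 0 1) (gram_schmidt q k)"
proof (induction k rule: less_induct)
  case (less k)
  show ?case
    by (subst gram_schmidt.simps)
      (intro continuous_on_diff continuous_on_sum continuous_on_mult_left assms less, simp)
qed

lemma sph_int_mult_zero:
  assumes "continuous_on (sphere 0 1) f" "sph_int (\<lambda>p. f p * f p) = 0" "norm p = 1"
  shows "f p = 0"
proof -
  have "f p * f p = 0"
    by (rule sph_int_eq_0D[where \<phi> = "\<lambda>p. f p * f p"]) (use assms in \<open>auto intro!: continuous_intros\<close>)
  then show ?thesis by simp
qed

lemma gram_schmidt_orthogonal:
  assumes c: "\<And>k. continuous_on (sphere 0 1) (q k)" and "i \<noteq> j"
  shows "sph_int (\<lambda>p. gram_schmidt q i p * gram_schmidt q j p) = 0"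
proof -
  let ?g = "gram_schmidt q"
  let ?N = "\<lambda>j. sph_int (\<lambda>p. ?g j p * ?g j p)"
  note cg = gram_schmidt_continuous[OF c]
  have main: "\<forall>i<k. sph_int (\<lambda>p. ?g k p * ?g i p) = 0" for k
  proof (induction k rule: less_induct)
    case (less k)
    have comm: "sph_int (\<lambda>p. ?g a p * ?g b p) = sph_int (\<lambda>p. ?g b p * ?g a p)" for a b
      by (simp add: mult.commute)
    have IH: "sph_int (\<lambda>p. ?g a p * ?g b p) = 0" if "a < k" "b < k" "a \<noteq> b" for a b
      using less.IH that comm[of a b] by (cases "a < b") auto
    show ?case
    proof (intro allI impI)
      fix i assume i: "i < k"
      let ?c = "\<lambda>j. sph_int (\<lambda>p. q k p * ?g j p) / ?N j"
      have "sph_int (\<lambda>p. ?g k p * ?g i p) = sph_int (\<lambda>p. q k p * ?g i p - (\<Sum>j<k. ?c j * (?g j p * ?g i p)))"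
        by (subst gram_schmidt.simps) (simp add: left_diff_distrib sum_distrib_right mult.assoc)
      also have "\<dots> = sph_int (\<lambda>p. q k p * ?g i p) - sph_int (\<lambda>p. \<Sum>j<k. ?c j * (?g j p * ?g i p))"
        by (intro sph_int_diff continuous_intros c cg)
      also have "sph_int (\<lambda>p. \<Sum>j<k. ?c j * (?g j p * ?g i p)) = (\<Sum>j<k. ?c j * sph_int (\<lambda>p. ?g j p * ?g i p))"
        unfolding sph_int_cmult[symmetric] by (intro sph_int_sum continuous_intros c cg)
      also have "\<dots> = (\<Sum>j<k. if j = i then ?c i * ?N i else 0)"
        by (intro sum.cong refl) (use IH i in auto)
      also have "\<dots> = ?c i * ?N i" using i by simp
      also have "\<dots> = sph_int (\<lambda>p. q k p * ?g i p)"
      \<comment> \<open>In the degenerate case the quotient cannot be cancelled, but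
        \<open>?g i\<close> then vanishes on the sphere and both sides are 0.\<close>
      proof (cases "?N i = 0")
        case True
        have "?g i p = 0" if "norm p = 1" for p
          by (rule sph_int_mult_zero[OF cg True that])
        then have "sph_int (\<lambda>p. q k p * ?g i p) = sph_int (\<lambda>p. 0 * q k p)"
          by (intro sph_int_cong) simp
        also have "\<dots> = 0" by (simp only: sph_int_cmult)
        finally show ?thesis using True by simp
      qed simp
      finally show "sph_int (\<lambda>p. ?g k p * ?g i p) = 0" by simp
    qed
  qed
  show ?thesis
  proof (cases "i < j")
    case True
    then show ?thesis using main[of j] by (simp add: mult.commute)
  next
    case False
    then show ?thesis using main[of i] \<open>i \<noteq> j\<close> by simp
  qed
qed

text \<open>On the whole space, \<open>q k\<close> is a combination of the orthogonalised functions
  up to index \<open>k\<close>.\<close>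

lemma sph_int_gram_schmidt_zero:
  assumes c: "\<And>k. continuous_on (sphere 0 1) (q k)" and \<phi>: "continuous_on (sphere 0 1) \<phi>"
    and "\<And>j. j \<le> k \<Longrightarrow> sph_int (\<lambda>p. \<phi> p * gram_schmidt q j p) = 0"
  shows "sph_int (\<lambda>p. \<phi> p * q k p) = 0"
proof -
  let ?g = "gram_schmidt q"
  note cg = gram_schmidt_continuous[OF c]
  let ?c = "\<lambda>j. sph_int (\<lambda>p. q k p * ?g j p) / sph_int (\<lambda>p. ?g j p * ?g j p)"
  have "q k p = ?g k p + (\<Sum>j<k. ?c j * ?g j p)" for p
    by (subst gram_schmidt.simps) simp
  then have "\<phi> p * q k p = \<phi> p * (?g k p + (\<Sum>j<k. ?c j * ?g j p))" for p
    by (rule arg_cong)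
  then have "\<phi> p * q k p = \<phi> p * ?g k p + (\<Sum>j<k. ?c j * (\<phi> p * ?g j p))" for p
    by (simp only: distrib_left sum_distrib_left mult.left_commute)
  then have "sph_int (\<lambda>p. \<phi> p * q k p) = sph_int (\<lambda>p. \<phi> p * ?g k p + (\<Sum>j<k. ?c j * (\<phi> p * ?g j p)))"
    by (rule sph_int_cong)
  also have "\<dots> = sph_int (\<lambda>p. \<phi> p * ?g k p) + sph_int (\<lambda>p. \<Sum>j<k. ?c j * (\<phi> p * ?g j p))"
    by (intro sph_int_add continuous_intros cg \<phi>)
  also have "sph_int (\<lambda>p. \<Sum>j<k. ?c j * (\<phi> p * ?g j p)) = (\<Sum>j<k. ?c j * sph_int (\<lambda>p. \<phi> p * ?g j p))"
    unfolding sph_int_cmult[symmetric] by (intro sph_int_sum continuous_intros \<phi> cg)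
  finally show ?thesis using assms(3) by simp
qed

lemma real_polynomial_function_mono_fn: "real_polynomial_function (mono_fn xs)"
proof (induction xs)
  case (Cons k xs)
  then show ?case
    using real_polynomial_function.intros(4)[OF real_polynomial_function.intros(1)[OF bounded_linear_vec_nth[of k]]] by simp
qed (simp add: real_polynomial_function.intros(2))

lemma sph_poly_mult:
  assumes "sph_poly m f" "sph_poly m' g"
  shows "sph_poly (m + m') (\<lambda>p. f p * g p)"
  using assms(1)
proof (induction rule: sph_poly.induct)
  case (zero f)
  then show ?case by (intro sph_poly.zero) simp
next
  case (mono_fn xs f)
  have "sph_poly (length xs + m') (\<lambda>p. mono_fn xs p * g p)"
  proof (induction xs)
    case Nil
    then show ?case using assms(2) by simp
  next
    case (Cons k xs)
    then show ?case using sph_poly_coord[OF Cons, of k] by (simp add: mult.assoc)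
  qed
  then have "sph_poly (length xs + m') (\<lambda>p. f p * g p)"
    by (rule sph_poly_cong) (simp add: mono_fn(2))
  then show ?case by (rule sph_poly_mono) (use mono_fn(1) in simp)
next
  case (lin f g' h a b)
  then show ?case
    by (intro sph_poly.lin[OF lin.IH, where a = a and b = b]) (simp add: algebra_simps)
qed

lemma real_polynomial_function_sph_poly:
  fixes f :: "real^'n::finite \<Rightarrow> real"
  assumes "real_polynomial_function f"
  shows "\<exists>m. sph_poly m f"
  using assms
proof induction
  case (linear f)
  then have "f p = (\<Sum>k\<in>UNIV. f (axis k 1) * mono_fn [k] p)" for p
  proof -
    have "f p = f (\<Sum>k\<in>UNIV. p $ k *\<^sub>R axis k 1)"
      using basis_expansion[of p] by (simp add: scalar_mult_eq_scaleR)
    also have "\<dots> = (\<Sum>k\<in>UNIV. p $ k *\<^sub>R f (axis k 1))"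
      using linear by (simp add: bounded_linear.linear linear_sum linear_scale)
    finally show ?thesis by (simp add: mult.commute)
  qed
  then have "f = (\<lambda>p. \<Sum>k\<in>UNIV. f (axis k 1) * mono_fn [k] p)" by blast
  moreover have "sph_poly 2 (\<lambda>p. \<Sum>k\<in>UNIV. f (axis k 1) * mono_fn [k] p)"
    using sph_poly_mono_fn[of "[k]" for k] by (intro sph_poly_sum sph_poly_cmult) (simp add: numeral_2_eq_2)
  ultimately show ?case by metis
next
  case (const c)
  have "sph_poly 1 (\<lambda>p. c * mono_fn [] p)"
    using sph_poly_mono_fn[of "[]"] by (intro sph_poly_cmult) simp
  then show ?case by auto
next
  case (add f g)
  then obtain m m' where "sph_poly m f" "sph_poly m' g" by auto
  then have "sph_poly (max m m') (\<lambda>p. f p + g p)"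
    by (intro sph_poly_add) (auto elim: sph_poly_mono)
  then show ?case by blast
next
  case (mult f g)
  then show ?case using sph_poly_mult by blast
qed

text \<open>Orthogonality to monomials extends to all polynomials. If the polynomial g is uniformly
  close to \<open>\<phi>\<close>, the mean of \<open>\<phi>\<^sup>2\<close> equals that of
  \<open>\<phi> (\<phi> - g)\<close> and is therefore arbitrarily small.\<close>

lemma sph_int_poly_complete:
  fixes \<phi> :: "real^'n::finite \<Rightarrow> real"
  assumes \<phi>: "continuous_on (sphere 0 1) \<phi>" and ortho: "\<And>xs. sph_int (\<lambda>p. \<phi> p * mono_fn xs p) = 0"
    and p: "norm p = 1"
  shows "\<phi> p = 0"
proof -
  have *: "sph_int (\<lambda>p. \<phi> p * f p) = 0" if "sph_poly m f" for f m
    using that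
  proof (induction rule: sph_poly.induct)
    case (zero f)
    then have "sph_int (\<lambda>p. \<phi> p * f p) = sph_int (\<lambda>p. 0 * \<phi> p)"
      by (intro sph_int_cong) simp
    then show ?case by (simp only: sph_int_cmult)
  next
    case (mono_fn xs f)
    then show ?case using ortho[of xs] sph_int_cong[of "\<lambda>p. \<phi> p * f p" "\<lambda>p. \<phi> p * mono_fn xs p"] by simp
  next
    case (lin f g h a b)
    have c: "continuous_on (sphere 0 1) f" "continuous_on (sphere 0 1) g"
      using lin.hyps(1,2) by (auto intro: rot_C2_continuous sph_poly_rot_C2)
    have "sph_int (\<lambda>p. \<phi> p * h p) = sph_int (\<lambda>p. a * (\<phi> p * f p) + b * (\<phi> p * g p))"
      by (rule sph_int_cong) (simp add: lin.hyps algebra_simps)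
    also have "\<dots> = sph_int (\<lambda>p. a * (\<phi> p * f p)) + sph_int (\<lambda>p. b * (\<phi> p * g p))"
      by (intro sph_int_add continuous_intros \<phi> c)
    finally show ?case unfolding sph_int_cmult using lin.IH by simp
  qed
  have "sph_int (\<lambda>p. \<phi> p * \<phi> p) \<le> e" if "0 < e" for e
  proof -
    define C where "C = 1 + sph_int (\<lambda>p. \<bar>\<phi> p\<bar>)"
    have "0 \<le> sph_int (\<lambda>p. \<bar>\<phi> p\<bar>)" by (intro sph_int_nonneg continuous_intros \<phi>) auto
    then have "C > 0" by (simp add: C_def)
    obtain g where g: "real_polynomial_function g" "\<And>p. p \<in> sphere 0 1 \<Longrightarrow> \<bar>\<phi> p - g p\<bar> < e / C"
      using Stone_Weierstrass_real_polynomial_function[OF compact_sphere \<phi>, of "e / C"] \<open>0 < e\<close> \<open>C > 0\<close> by auto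
    obtain m where m: "sph_poly m g" using real_polynomial_function_sph_poly[OF g(1)] by blast
    have cg: "continuous_on (sphere 0 1) g" by (rule rot_C2_continuous[OF sph_poly_rot_C2[OF m]])
    have "sph_int (\<lambda>p. \<phi> p * \<phi> p) = sph_int (\<lambda>p. \<phi> p * \<phi> p) - sph_int (\<lambda>p. \<phi> p * g p)"
      using *[OF m] by simp
    also have "\<dots> = sph_int (\<lambda>p. \<phi> p * \<phi> p - \<phi> p * g p)"
      by (intro sph_int_diff[symmetric] continuous_intros \<phi> cg)
    also have "\<dots> \<le> sph_int (\<lambda>p. e / C * \<bar>\<phi> p\<bar>)"
    proof (intro sph_int_mono continuous_intros \<phi> cg)
      fix p :: "real^'n" assume "norm p = 1"
      then have "\<bar>\<phi> p - g p\<bar> \<le> e / C" using g(2)[of p] by simp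
      have "\<phi> p * \<phi> p - \<phi> p * g p = \<phi> p * (\<phi> p - g p)" by (simp add: algebra_simps)
      also have "\<dots> \<le> \<bar>\<phi> p\<bar> * \<bar>\<phi> p - g p\<bar>" by (metis abs_ge_self abs_mult)
      also have "\<dots> \<le> \<bar>\<phi> p\<bar> * (e / C)" using \<open>\<bar>\<phi> p - g p\<bar> \<le> e / C\<close> by (intro mult_left_mono) auto
      finally show "\<phi> p * \<phi> p - \<phi> p * g p \<le> e / C * \<bar>\<phi> p\<bar>" by (simp add: mult.commute)
    qed
    also have "\<dots> = e / C * sph_int (\<lambda>p. \<bar>\<phi> p\<bar>)" by (rule sph_int_cmult)
    also have "\<dots> \<le> e / C * C"
      using \<open>0 < e\<close> \<open>C > 0\<close> by (intro mult_left_mono) (auto simp: C_def)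
    also have "\<dots> = e" using \<open>C > 0\<close> by simp
    finally show ?thesis .
  qed
  then have "sph_int (\<lambda>p. \<phi> p * \<phi> p) \<le> 0" by (meson dense not_le)
  moreover have "0 \<le> sph_int (\<lambda>p. \<phi> p * \<phi> p)" by (intro sph_int_nonneg continuous_intros \<phi>) auto
  ultimately show ?thesis using sph_int_mult_zero[OF \<phi> _ p] by simp
qed

text \<open>Listing the words by length makes \<open>Y k\<close> orthogonal to all polynomials of
  degree less than m = \<open>length (e k)\<close>. The defect
  \<open>Z = sph_lap (Y k) + m (m + n - 2) Y k\<close> has degree less than m, and so has its
  spherical Laplacian; by symmetry the mean of \<open>Z\<^sup>2\<close> is a pairing of
  \<open>Y k\<close> with such polynomials, hence 0.\<close>

lemma gram_schmidt_eigenfunction: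
  fixes e :: "nat \<Rightarrow> 'n::finite list"
  assumes "bij e" "mono (\<lambda>k. length (e k))"
  defines "Y \<equiv> gram_schmidt (\<lambda>k. mono_fn (e k))"
  shows "sph_poly (Suc (length (e k))) (Y k)"
    and "norm p = 1 \<Longrightarrow> sph_lap (Y k) p = - sph_eig TYPE('n) (length (e k)) * Y k p"
proof -
  have cm: "continuous_on (sphere 0 1) (mono_fn (e k))" for k
    by (rule rot_C2_continuous[OF rot_C2_mono_fn])
  have cY: "continuous_on (sphere 0 1) (Y k)" for k
    unfolding Y_def by (rule gram_schmidt_continuous[OF cm])
  have len: "length (e j) \<le> length (e k)" if "j \<le> k" for j k
    using assms(2) that by (auto simp: mono_def)
  let ?c = "\<lambda>k j. sph_int (\<lambda>p. mono_fn (e k) p * Y j p) / sph_int (\<lambda>p. Y j p * Y j p)"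
  have Y: "Y k = (\<lambda>p. mono_fn (e k) p - (\<Sum>j<k. ?c k j * Y j p))" for k
    unfolding Y_def by (subst gram_schmidt.simps) (rule refl)
  show poly: "sph_poly (Suc (length (e k))) (Y k)" for k
  proof (induction k rule: less_induct)
    case (less k)
    show ?case
      by (subst Y) (intro sph_poly_diff sph_poly_mono_fn sph_poly_sum sph_poly_cmult sph_poly_mono[OF less];
        use len in simp)
  qed
  show "norm p = 1 \<Longrightarrow> sph_lap (Y k) p = - sph_eig TYPE('n) (length (e k)) * Y k p" for k p
  proof (induction k arbitrary: p rule: less_induct)
    case (less k)
    define m where "m = length (e k)"
    let ?l = "sph_eig TYPE('n) m"
    have C2: "rot_C2 (Y j)" for j using sph_poly_rot_C2[OF poly] .
    define Z where "Z p = sph_lap (Y k) p + ?l * Y k p" for p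
    have orth: "sph_int (\<lambda>p. Y k p * f p) = 0" if "sph_poly m f" for f
      using that
    proof (induction rule: sph_poly.induct)
      case (zero f)
      then have "sph_int (\<lambda>p. Y k p * f p) = sph_int (\<lambda>p. 0 * Y k p)"
        by (intro sph_int_cong) simp
      then show ?case by (simp only: sph_int_cmult)
    next
      case (mono_fn xs f)
      obtain j where j: "xs = e j" using \<open>bij e\<close> by (metis bij_pointE)
      have "j < k" using mono_fn(1) len[of k j] unfolding j m_def by (cases "k \<le> j") auto
      have "sph_int (\<lambda>p. Y k p * mono_fn (e j) p) = 0"
      proof (rule sph_int_gram_schmidt_zero[where q = "\<lambda>k. mono_fn (e k)", OF cm cY])
        show "sph_int (\<lambda>p. Y k p * gram_schmidt (\<lambda>k. mono_fn (e k)) i p) = 0" if "i \<le> j" for i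
          unfolding Y_def by (rule gram_schmidt_orthogonal[where q = "\<lambda>k. mono_fn (e k)", OF cm]) (use that \<open>j < k\<close> in simp)
      qed
      then show ?case using mono_fn(2) sph_int_cong[of "\<lambda>p. Y k p * f p" "\<lambda>p. Y k p * mono_fn xs p"] j by simp
    next
      case (lin f g h a b)
      have c: "continuous_on (sphere 0 1) f" "continuous_on (sphere 0 1) g"
        using lin.hyps(1,2) by (auto intro: rot_C2_continuous sph_poly_rot_C2)
      have "sph_int (\<lambda>p. Y k p * h p) = sph_int (\<lambda>p. a * (Y k p * f p) + b * (Y k p * g p))"
        by (rule sph_int_cong) (simp add: lin.hyps algebra_simps)
      also have "\<dots> = sph_int (\<lambda>p. a * (Y k p * f p)) + sph_int (\<lambda>p. b * (Y k p * g p))"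
        by (intro sph_int_add continuous_intros cY c)
      finally show ?case unfolding sph_int_cmult using lin.IH by simp
    qed
    \<comment> \<open>Earlier functions of the same degree contribute exactly 0 by the induction
      hypothesis; those of lower degree stay in \<open>sph_poly m\<close>.\<close>
    have low: "sph_poly m (\<lambda>p. sph_lap (Y j) p + ?l * Y j p)" if "j < k" for j
    proof (cases "length (e j) = m")
      case True
      then show ?thesis using less.IH[OF that] by (intro sph_poly.zero) simp
    next
      case False
      then have "sph_poly m (Y j)" using len[of j k] that unfolding m_def by (intro sph_poly_mono[OF poly]) auto
      then show ?thesis by (intro sph_poly_add sph_poly_sph_lap sph_poly_cmult)
    qed
    have sum: "rot_C2 (\<lambda>p. \<Sum>j\<in>A. c j * Y j p) \<and>
       (\<forall>p. norm p = 1 \<longrightarrow> sph_lap (\<lambda>p. \<Sum>j\<in>A. c j * Y j p) p = (\<Sum>j\<in>A. c j * sph_lap (Y j) p))"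
      if "finite A" for A and c :: "nat \<Rightarrow> real"
      using that
    proof (induction A)
      case empty
      show ?case by (simp add: rot_C2_const sph_lap_const)
    next
      case (insert j A)
      then have "(\<lambda>p. \<Sum>i\<in>insert j A. c i * Y i p) = (\<lambda>p. c j * Y j p + 1 * (\<Sum>i\<in>A. c i * Y i p))" by simp
      then show ?case
        using rot_C2_add[OF C2[of j] conjunct1[OF insert.IH], where a = "c j" and b = 1] insert by auto
    qed
    have "Z p = (sph_lap (mono_fn (e k)) p + ?l * mono_fn (e k) p) - (\<Sum>j<k. ?c k j * (sph_lap (Y j) p + ?l * Y j p))"
      if "norm p = 1" for p
    proof -
      have "Y k = (\<lambda>p. 1 * mono_fn (e k) p + (-1) * (\<Sum>j<k. ?c k j * Y j p))" by (subst Y) simp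
      then have a: "sph_lap (Y k) p = sph_lap (mono_fn (e k)) p - (\<Sum>j<k. ?c k j * sph_lap (Y j) p)"
        using rot_C2_add(2)[OF rot_C2_mono_fn conjunct1[OF sum[of "{..<k}" "?c k"]] that, where a = 1 and b = "-1"]
          sum[of "{..<k}" "?c k"] that by simp
      have b: "Y k p = mono_fn (e k) p - (\<Sum>j<k. ?c k j * Y j p)" by (subst Y) simp
      have "(\<Sum>j<k. ?c k j * (sph_lap (Y j) p + ?l * Y j p)) = (\<Sum>j<k. ?c k j * sph_lap (Y j) p) + ?l * (\<Sum>j<k. ?c k j * Y j p)"
        unfolding sum_distrib_left sum.distrib[symmetric] by (intro sum.cong refl) (simp add: distrib_left)
      then show ?thesis
        unfolding Z_def by (subst a, subst b) (simp add: right_diff_distrib)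
    qed
    moreover have "sph_poly m (\<lambda>p. (sph_lap (mono_fn (e k)) p + ?l * mono_fn (e k) p) - (\<Sum>j<k. ?c k j * (sph_lap (Y j) p + ?l * Y j p)))"
      using sph_lap_mono_fn[of "e k"] low unfolding m_def
      by (intro sph_poly_diff sph_poly_sum sph_poly_cmult) auto
    ultimately have Z: "sph_poly m Z" using sph_poly_cong by blast
    have cZ: "continuous_on (sphere 0 1) Z" by (rule rot_C2_continuous[OF sph_poly_rot_C2[OF Z]])
    have cl: "continuous_on (sphere 0 1) (sph_lap (Y k))" "continuous_on (sphere 0 1) (sph_lap Z)"
      using C2 sph_poly_rot_C2[OF Z] by (auto intro: continuous_on_sph_lap)
    have "sph_int (\<lambda>p. Z p * Z p) = sph_int (\<lambda>p. sph_lap (Y k) p * Z p + ?l * (Y k p * Z p))"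
      by (rule sph_int_cong) (simp add: Z_def algebra_simps)
    also have "\<dots> = sph_int (\<lambda>p. sph_lap (Y k) p * Z p) + sph_int (\<lambda>p. ?l * (Y k p * Z p))"
      by (intro sph_int_add continuous_intros cZ cl cY)
    also have "sph_int (\<lambda>p. sph_lap (Y k) p * Z p) = sph_int (\<lambda>p. Y k p * sph_lap Z p)"
      by (rule sph_lap_symmetric[OF C2 sph_poly_rot_C2[OF Z]])
    also have "\<dots> = 0" by (rule orth[OF sph_poly_sph_lap[OF Z]])
    also have "sph_int (\<lambda>p. ?l * (Y k p * Z p)) = 0" unfolding sph_int_cmult using orth[OF Z] by simp
    finally have "Z p = 0" using sph_int_mult_zero[OF cZ _ less.prems] by simp
    then show ?case by (simp add: Z_def m_def)
  qed
qed

section \<open>Continuous functions on the sphere form an infinite-dimensional space\<close>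

lemma infinite_unit_sphere:
  assumes "CARD('n::finite) \<ge> 2"
  shows "infinite (sphere 0 1 :: (real^'n) set)"
proof
  assume fin: "finite (sphere 0 1 :: (real^'n) set)"
  obtain i j :: 'n where "i \<noteq> j"
    using assms by (metis card_2_iff' ex_card subset_UNIV)
  have "x \<in> (\<lambda>p. p $ i) ` (sphere 0 1 :: (real^'n) set)" if "x \<in> {-1..1}" for x
  proof
    show "rot i j (arccos x) (axis i 1) \<in> sphere 0 1" by simp
    show "x = rot i j (arccos x) (axis i 1) $ i"
      using \<open>i \<noteq> j\<close> that by (simp add: rot_def axis_def cos_arccos)
  qed
  then have "{-1..1} \<subseteq> (\<lambda>p. p $ i) ` (sphere 0 1 :: (real^'n) set)" by blast
  then have "finite {-1..1::real}" using fin finite_surj by blast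
  then show False using infinite_Icc[of "-1::real" 1] by simp
qed

text \<open>Products of distances give, for a finite set of points, functions that vanish at all of
  the points but one; taking \<open>card K + 1\<close> points yields too many independent functions.
  This will provide infinitely many nonzero harmonics.\<close>

lemma not_finite_spanning_sphere:
  assumes card: "CARD('n::finite) \<ge> 2" and "finite K"
    and span: "\<And>\<phi> :: real^'n \<Rightarrow> real. continuous_on (sphere 0 1) \<phi> \<Longrightarrow>
      \<exists>c. \<forall>p. norm p = 1 \<longrightarrow> \<phi> p = (\<Sum>k\<in>K. c k * Y k p)"
  shows False
proof -
  obtain P :: "(real^'n) set" where P: "finite P" "card P = card K + 1" "P \<subseteq> sphere 0 1"
    using infinite_arbitrarily_large[OF infinite_unit_sphere[OF card]] by metis
  \<comment> \<open>Cutting off outside the sphere makes equality on the sphere the same as equality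
    of functions.\<close>
  define R where "R f p = (if norm p = 1 then f p else (0::real))" for f and p :: "real^'n"
  define f where "f a p = (\<Prod>b\<in>P - {a}. dist p b)" for a p :: "real^'n"
  have c: "continuous_on (sphere 0 1) (f a)" for a
    unfolding f_def by (intro continuous_intros)
  have f_eq: "f a b = 0 \<longleftrightarrow> b \<in> P - {a}" for a b
    using P(1) by (auto simp: f_def)
  have "\<forall>a\<in>P. c a = 0" if sum: "\<And>x. (\<Sum>a\<in>P. c a * R (f a) x) = 0" for c
  proof
    fix b assume b: "b \<in> P"
    then have "(\<Sum>a\<in>P. c a * R (f a) b) = (\<Sum>a\<in>P. if a = b then c b * f b b else 0)"
      using f_eq P(3) by (intro sum.cong refl) (auto simp: R_def)
    then have "c b * f b b = 0" using sum[of b] b P(1) by simp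
    then show "c b = 0" using f_eq[of b b] by simp
  qed
  note ind = independent_family[OF P(1), of "\<lambda>a. R (f a)", OF this]
  have "(\<lambda>a. R (f a)) ` P \<subseteq> fun_space.span ((\<lambda>k. R (Y k)) ` K)"
  proof
    fix g assume "g \<in> (\<lambda>a. R (f a)) ` P"
    then obtain a where a: "g = R (f a)" by blast
    obtain d where d: "\<And>p. norm p = 1 \<Longrightarrow> f a p = (\<Sum>k\<in>K. d k * Y k p)"
      using span[OF c] by blast
    have "g = (\<Sum>k\<in>K. (\<lambda>x. d k * R (Y k) x))"
      by (rule ext) (simp add: sum_fun_apply a R_def d)
    also have "\<dots> \<in> fun_space.span ((\<lambda>k. R (Y k)) ` K)"
      by (intro fun_space.span_sum fun_space.span_scale fun_space.span_base) auto
    finally show "g \<in> fun_space.span ((\<lambda>k. R (Y k)) ` K)" .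
  qed
  from fun_space.independent_span_bound[OF _ ind(2) this] \<open>finite K\<close>
  have "card ((\<lambda>a. R (f a)) ` P) \<le> card ((\<lambda>k. R (Y k)) ` K)" by auto
  also have "\<dots> \<le> card K" by (rule card_image_le) fact
  finally show False using card_image[OF ind(1)] P(2) by simp
qed

text \<open>Completeness is phrased as triviality of the orthogonal complement among continuous
  functions, so no series of harmonics has to converge. Eigenvalues repeat with multiplicity; only
  the place of 0 is fixed.\<close>

definition harmonic_basis :: "(nat \<Rightarrow> real^'n::finite \<Rightarrow> real) \<Rightarrow> (nat \<Rightarrow> real) \<Rightarrow> bool" where
  "harmonic_basis Y lam \<longleftrightarrow> (\<forall>k. real_polynomial_function (Y k) \<and> rot_C2 (Y k)) \<and>
     (\<forall>k p. norm p = 1 \<longrightarrow> sph_lap (Y k) p = - lam k * Y k p) \<and>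
     (\<forall>j k. j \<noteq> k \<longrightarrow> sph_int (\<lambda>p. Y j p * Y k p) = 0) \<and>
     (\<forall>k. 0 < sph_int (\<lambda>p. Y k p * Y k p)) \<and>
     lam 0 = 0 \<and> (\<forall>k>0. 0 < lam k) \<and> filterlim lam at_top sequentially \<and>
     (\<forall>\<phi>. continuous_on (sphere 0 1) \<phi> \<longrightarrow> (\<forall>k. sph_int (\<lambda>p. \<phi> p * Y k p) = 0) \<longrightarrow>
        (\<forall>p. norm p = 1 \<longrightarrow> \<phi> p = 0))"

lemma real_polynomial_function_gram_schmidt:
  assumes "\<And>k. real_polynomial_function (q k)"
  shows "real_polynomial_function (gram_schmidt q k)"
proof (induction k rule: less_induct)
  case (less k)
  have "real_polynomial_function (\<lambda>p. \<Sum>j<k. c j * gram_schmidt q j p)" for c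
    using less by (intro real_polynomial_function_sum real_polynomial_function.intros(2,4)) auto
  then show ?case
    by (subst gram_schmidt.simps) (intro real_polynomial_function_diff assms)
qed

lemma harmonic_basis_exists:
  assumes card: "CARD('n::finite) \<ge> 2"
  shows "\<exists>(Y :: nat \<Rightarrow> real^'n \<Rightarrow> real) lam. harmonic_basis Y lam"
proof -
  have fin: "finite {xs \<in> (UNIV :: 'n list set). real (length xs) \<le> t}" for t
  proof -
    have "{xs \<in> (UNIV :: 'n list set). real (length xs) \<le> t} \<subseteq> {xs. set xs \<subseteq> UNIV \<and> length xs \<le> nat \<lfloor>t\<rfloor>}"
      by (auto simp: le_nat_floor)
    then show ?thesis by (rule finite_subset) (rule finite_lists_length_le, simp)
  qed
  obtain e :: "nat \<Rightarrow> 'n list" where e: "bij e" and m: "mono ((\<lambda>xs. real (length xs)) \<circ> e)"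
    using sorted_enumeration[OF infinite_UNIV_listI fin] by metis
  have m': "mono (\<lambda>k. length (e k))" using m by (auto simp: mono_def)
  define q where "q k = mono_fn (e k)" for k
  define Y where "Y = gram_schmidt q"
  have cq: "continuous_on (sphere 0 1) (q k)" for k
    unfolding q_def by (rule rot_C2_continuous[OF rot_C2_mono_fn])
  have cY: "continuous_on (sphere 0 1) (Y k)" for k
    unfolding Y_def by (rule gram_schmidt_continuous[OF cq])
  note eig = gram_schmidt_eigenfunction[OF e m', folded q_def, folded Y_def]
  have orth: "sph_int (\<lambda>p. Y i p * Y j p) = 0" if "i \<noteq> j" for i j
    unfolding Y_def by (rule gram_schmidt_orthogonal[OF cq that])
  have nn: "0 \<le> sph_int (\<lambda>p. Y k p * Y k p)" for k
    by (intro sph_int_nonneg continuous_intros cY) auto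
  \<comment> \<open>The words whose function survives orthogonalisation; each other one was, on the
    sphere, a combination of earlier ones.\<close>
  define K where "K = {k. 0 < sph_int (\<lambda>p. Y k p * Y k p)}"
  have notK: "Y k p = 0" if "k \<notin> K" "norm p = 1" for k p
    by (rule sph_int_mult_zero[OF cY _ that(2)]) (use that(1) nn[of k] in \<open>simp add: K_def\<close>)
  have complete: "\<phi> p = 0" if \<phi>: "continuous_on (sphere 0 1) \<phi>" and "\<And>k. k \<in> K \<Longrightarrow> sph_int (\<lambda>p. \<phi> p * Y k p) = 0"
    and "norm p = 1" for \<phi> p
  proof -
    have "sph_int (\<lambda>p. \<phi> p * Y k p) = 0" for k
    proof (cases "k \<in> K")
      case False
      then have "sph_int (\<lambda>p. \<phi> p * Y k p) = sph_int (\<lambda>p. 0 * \<phi> p)"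
        using notK by (intro sph_int_cong) simp
      then show ?thesis by (simp only: sph_int_cmult)
    qed (rule that(2))
    then have *: "sph_int (\<lambda>p. \<phi> p * q k p) = 0" for k
      unfolding Y_def by (intro sph_int_gram_schmidt_zero[OF cq \<phi>]) 
    have "sph_int (\<lambda>p. \<phi> p * mono_fn xs p) = 0" for xs
      using *[of "inv e xs"] e by (simp add: q_def bij_is_surj surj_f_inv_f)
    then show ?thesis using sph_int_poly_complete[OF \<phi>] that(3) by blast
  qed
  have "infinite K"
  proof
    assume K: "finite K"
    show False
    proof (rule not_finite_spanning_sphere[OF card K])
      fix \<phi> :: "real^'n \<Rightarrow> real" assume \<phi>: "continuous_on (sphere 0 1) \<phi>"
      define c where "c k = sph_int (\<lambda>p. \<phi> p * Y k p) / sph_int (\<lambda>p. Y k p * Y k p)" for k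
      have cs: "continuous_on (sphere 0 1) (\<lambda>p. \<phi> p - (\<Sum>k\<in>K. c k * Y k p))"
        by (intro continuous_intros \<phi> cY)
      have "sph_int (\<lambda>p. (\<phi> p - (\<Sum>k\<in>K. c k * Y k p)) * Y i p) = 0" if i: "i \<in> K" for i
      proof -
        have "sph_int (\<lambda>p. (\<phi> p - (\<Sum>k\<in>K. c k * Y k p)) * Y i p)
           = sph_int (\<lambda>p. \<phi> p * Y i p - (\<Sum>k\<in>K. c k * (Y k p * Y i p)))"
          by (simp add: left_diff_distrib sum_distrib_right mult.assoc)
        also have "\<dots> = sph_int (\<lambda>p. \<phi> p * Y i p) - sph_int (\<lambda>p. \<Sum>k\<in>K. c k * (Y k p * Y i p))"
          by (intro sph_int_diff continuous_intros \<phi> cY)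
        also have "sph_int (\<lambda>p. \<Sum>k\<in>K. c k * (Y k p * Y i p)) = (\<Sum>k\<in>K. c k * sph_int (\<lambda>p. Y k p * Y i p))"
          unfolding sph_int_cmult[symmetric] by (intro sph_int_sum continuous_intros cY)
        also have "\<dots> = (\<Sum>k\<in>K. if k = i then c i * sph_int (\<lambda>p. Y i p * Y i p) else 0)"
          by (intro sum.cong refl) (auto simp: orth)
        also have "\<dots> = sph_int (\<lambda>p. \<phi> p * Y i p)"
          using i K by (simp add: c_def K_def)
        finally show ?thesis by simp
      qed
      from complete[OF cs this] show "\<exists>c. \<forall>p. norm p = 1 \<longrightarrow> \<phi> p = (\<Sum>k\<in>K. c k * Y k p)"
        by (intro exI[of _ c]) auto
    qed
  qed
  have e0: "e 0 = []"
  proof -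
    obtain j where "e j = []" using e by (metis bij_pointE)
    then show ?thesis using monoD[OF m', of 0 j] by simp
  qed
  have ne: "e k \<noteq> []" if "k > 0" for k
    using e0 that e by (metis bij_is_inj inj_eq not_less_zero)
  have Y0: "Y 0 = (\<lambda>p. 1)"
    unfolding Y_def by (subst gram_schmidt.simps) (simp add: q_def e0)
  have K0: "0 \<in> K"
  proof (rule ccontr)
    assume "0 \<notin> K"
    from notK[OF this, of "axis undefined 1"] show False by (simp add: Y0)
  qed
  \<comment> \<open>The surviving indices are renumbered in increasing order; index 0, the constant
    function, survives and keeps its place.\<close>
  define s where "s = enumerate K"
  have s: "strict_mono s" "\<And>k. s k \<in> K" "range s = K"
    using \<open>infinite K\<close> by (auto simp: s_def strict_mono_enumerate enumerate_in_set range_enumerate)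
  have s0: "s 0 = 0" unfolding s_def enumerate_0 using K0 by (simp add: Least_eq_0)
  define lam where "lam k = sph_eig TYPE('n) (length (e (s k)))" for k
  \<comment> \<open>The second factor m + n - 2 is at least 1, as n is at least 2.\<close>
  have lam_ge: "real m \<le> sph_eig TYPE('n) m" if "m > 0" for m
  proof -
    have "real m * 1 \<le> real m * (real m + real CARD('n) - 2)"
      using that card by (intro mult_left_mono) auto
    then show ?thesis by (simp add: sph_eig_def)
  qed
  have lam_pos: "0 < lam k" if "k > 0" for k
  proof -
    have "s k > 0" using s(1) that s0 by (metis strict_mono_less)
    then have "length (e (s k)) > 0" using ne by simp
    then have "0 < real (length (e (s k)))" "real (length (e (s k))) \<le> lam k"
      unfolding lam_def by (simp, rule lam_ge)
    then show ?thesis by (rule less_le_trans)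
  qed
  have "filterlim lam at_top sequentially"
    unfolding filterlim_at_top
  proof
    fix Z :: real
    have "finite {k. real (length (e (s k))) \<le> max 0 Z}"
    proof (rule finite_imageD[of "\<lambda>k. e (s k)"])
      show "finite ((\<lambda>k. e (s k)) ` {k. real (length (e (s k))) \<le> max 0 Z})"
        by (rule finite_subset[OF _ fin[of "max 0 Z"]]) auto
      show "inj_on (\<lambda>k. e (s k)) {k. real (length (e (s k))) \<le> max 0 Z}"
      proof (rule inj_onI)
        fix a b assume "e (s a) = e (s b)"
        then have "s a = s b" by (rule injD[OF bij_is_inj[OF e]])
        then show "a = b" by (simp only: strict_mono_eq[OF s(1)])
      qed
    qed
    then have "\<forall>\<^sub>F k in cofinite. \<not> real (length (e (s k))) \<le> max 0 Z"
      by (simp add: eventually_cofinite)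
    then have "\<forall>\<^sub>F k in sequentially. \<not> real (length (e (s k))) \<le> max 0 Z"
      by (simp add: cofinite_eq_sequentially)
    then show "\<forall>\<^sub>F k in sequentially. Z \<le> lam k"
    proof eventually_elim
      case (elim k)
      then have "0 < real (length (e (s k)))" "Z \<le> real (length (e (s k)))" by linarith+
      then show ?case using lam_ge[of "length (e (s k))"] unfolding lam_def of_nat_0_less_iff by linarith
    qed
  qed
  moreover have "real_polynomial_function (Y k)" for k
    unfolding Y_def q_def by (intro real_polynomial_function_gram_schmidt real_polynomial_function_mono_fn)
  moreover have "rot_C2 (Y k)" for k
    by (rule sph_poly_rot_C2[OF eig(1)])
  moreover have "sph_lap (Y (s k)) p = - lam k * Y (s k) p" if "norm p = 1" for k p
    unfolding lam_def by (rule eig(2)[OF that])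
  moreover have "sph_int (\<lambda>p. Y (s i) p * Y (s j) p) = 0" if "i \<noteq> j" for i j
    by (rule orth) (simp add: that strict_mono_eq[OF s(1)])
  moreover have "0 < sph_int (\<lambda>p. Y (s k) p * Y (s k) p)" for k
    using s(2)[of k] by (simp add: K_def)
  moreover have "lam 0 = 0" by (simp add: lam_def s0 e0 sph_eig_def)
  moreover have "\<phi> p = 0" if "continuous_on (sphere 0 1) \<phi>" "\<And>k. sph_int (\<lambda>p. \<phi> p * Y (s k) p) = 0" "norm p = 1" for \<phi> p
  proof (rule complete[OF that(1) _ that(3)])
    fix k assume "k \<in> K"
    then obtain i where "k = s i" using s(3) by blast
    then show "sph_int (\<lambda>p. \<phi> p * Y k p) = 0" using that(2) by simp
  qed
  ultimately have "harmonic_basis (\<lambda>k. Y (s k)) lam"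
    unfolding harmonic_basis_def using lam_pos by blast
  then show ?thesis by blast
qed

section \<open>The Laplace--Beltrami operator of a warped product\<close>

lemma has_derivative_cyl_param:
  fixes x :: "real^'n::finite"
  assumes "x \<noteq> 0"
  shows "(cyl_param has_derivative
    (\<lambda>v. ((x \<bullet> v) / norm x, v /\<^sub>R norm x - ((x \<bullet> v) / norm x ^ 3) *\<^sub>R x))) (at x)"
proof -
  have "norm x \<noteq> 0" using assms by simp
  have n: "(norm has_derivative (\<lambda>v. (x \<bullet> v) / norm x)) (at x)"
    using has_derivative_norm[OF assms] by (simp add: sgn_div_norm inner_commute divide_inverse mult.commute)
  have "((\<lambda>x. x /\<^sub>R norm x) has_derivative
     (\<lambda>v. v /\<^sub>R norm x + (- (inverse (norm x) * ((x \<bullet> v) / norm x) * inverse (norm x))) *\<^sub>R x)) (at x)"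
    using \<open>norm x \<noteq> 0\<close> by (auto intro!: derivative_eq_intros n simp: add.commute)
  then have "((\<lambda>x. x /\<^sub>R norm x) has_derivative (\<lambda>v. v /\<^sub>R norm x - ((x \<bullet> v) / norm x ^ 3) *\<^sub>R x)) (at x)"
    by (rule has_derivative_eq_rhs) (simp add: fun_eq_iff power3_eq_cube divide_inverse mult.assoc mult.left_commute)
  moreover have "((\<lambda>x. norm x - 1) has_derivative (\<lambda>v. (x \<bullet> v) / norm x)) (at x)"
    by (auto intro!: derivative_eq_intros n)
  ultimately show ?thesis
    unfolding cyl_param_def by (intro has_derivative_Pair)
qed

text \<open>\<open>c I + (1 - c) u u\<^sup>T\<close>: for a unit vector \<open>u\<close> it is 1
  along \<open>u\<close> and \<open>c\<close> on the orthogonal complement. The Gram matrix in the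
  chart and its inverse have this shape.\<close>

definition rank_one_matrix :: "real \<Rightarrow> real^'n::finite \<Rightarrow> real^'n^'n" where
  "rank_one_matrix c u = (\<chi> i j. (if i = j then c else 0) + (1 - c) * (u $ i * u $ j))"

lemma rank_one_matrix_mult_vec:
  "rank_one_matrix c u *v w = c *\<^sub>R w + ((1 - c) * (u \<bullet> w)) *\<^sub>R u"
proof (simp add: vec_eq_iff, intro allI)
  fix i
  have "(rank_one_matrix c u *v w) $ i = (\<Sum>j\<in>UNIV. (if i = j then c else 0) * w $ j) + (\<Sum>j\<in>UNIV. ((1 - c) * u $ i) * (u $ j * w $ j))"
    unfolding sum.distrib[symmetric] by (simp add: rank_one_matrix_def matrix_vector_mult_def distrib_right mult.assoc)
  also have "\<dots> = c * w $ i + (1 - c) * u $ i * (u \<bullet> w)"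
    by (simp only: sum_delta_mult sum_distrib_left[symmetric] inner_vec_def inner_real_def)
  finally show "(rank_one_matrix c u *v w) $ i = c * w $ i + (1 - c) * (u \<bullet> w) * u $ i"
    by (simp add: mult.assoc mult.commute)
qed

lemma rank_one_matrix_inverse:
  fixes u :: "real^'n::finite"
  assumes "norm u = 1" "c \<noteq> 0"
  shows "matrix_inv (rank_one_matrix c u) = rank_one_matrix (1 / c) u"
proof -
  have uu: "u \<bullet> u = 1" using assms(1) by (simp add: dot_square_norm)
  have "rank_one_matrix c u ** rank_one_matrix (1 / c) u = mat 1" if "c \<noteq> 0" for c
  proof -
    have "rank_one_matrix c u *v (rank_one_matrix (1 / c) u *v w) = w" for w
    proof -
      have "rank_one_matrix c u *v (rank_one_matrix (1 / c) u *v w) =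
        (c * (1 / c)) *\<^sub>R w + (c * ((1 - 1 / c) * (u \<bullet> w)) + (1 - c) * (1 / c * (u \<bullet> w) + (1 - 1 / c) * (u \<bullet> w))) *\<^sub>R u"
        unfolding rank_one_matrix_mult_vec by (simp add: inner_add_right uu scaleR_add_left scaleR_add_right)
      also have "c * ((1 - 1 / c) * (u \<bullet> w)) + (1 - c) * (1 / c * (u \<bullet> w) + (1 - 1 / c) * (u \<bullet> w)) = 0"
        using that by (simp add: field_simps)
      finally show ?thesis using that by simp
    qed
    then show ?thesis
      by (simp add: matrix_eq matrix_vector_mul_assoc[symmetric])
  qed
  from this[OF assms(2)] this[of "1 / c"] assms(2)
  have "rank_one_matrix c u ** rank_one_matrix (1 / c) u = mat 1" "rank_one_matrix (1 / c) u ** rank_one_matrix c u = mat 1"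
    by auto
  note AB = this
  \<comment> \<open>\<open>matrix_inv\<close> is a choice; exhibiting one two-sided inverse shows
    that the chosen matrix is an inverse, and inverses are unique.\<close>
  have "rank_one_matrix c u ** matrix_inv (rank_one_matrix c u) = mat 1 \<and> matrix_inv (rank_one_matrix c u) ** rank_one_matrix c u = mat 1"
    unfolding matrix_inv_def by (rule someI_ex) (use AB in blast)
  then show ?thesis
    by (metis AB(1) matrix_mul_assoc matrix_mul_lid matrix_mul_rid)
qed

text \<open>An orthogonal matrix sending a basis vector to \<open>u\<close> conjugates it to the
  diagonal matrix with one entry 1 and the others \<open>c\<close>.\<close>

lemma rank_one_matrix_det:
  fixes u :: "real^'n::finite"
  assumes "norm u = 1"
  shows "det (rank_one_matrix c u) = c ^ (CARD('n) - 1)"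
proof -
  obtain k :: 'n where True by simp
  obtain A :: "real^'n^'n" where A: "orthogonal_matrix A" "A *v axis k 1 = u"
    using orthogonal_matrix_exists_basis[OF assms] by metis
  define Dm :: "real^'n^'n" where "Dm = (\<chi> i j. if i = j then (if i = k then 1 else c) else 0)"
  have inv: "transpose A ** A = mat 1" "A ** transpose A = mat 1"
    using A(1) by (auto simp: orthogonal_matrix_def)
  have "rank_one_matrix c u ** A = A ** Dm"
  proof -
    have "rank_one_matrix c u *v (A *v w) = A *v (Dm *v w)" for w
    proof -
      have "u \<bullet> (A *v w) = (A *v axis k 1) \<bullet> (A *v w)" by (simp add: A(2))
      also have "\<dots> = axis k 1 \<bullet> (transpose A *v (A *v w))" by (metis dot_lmul_matrix transpose_matrix_vector transpose_transpose)
      also have "\<dots> = w $ k" by (simp add: matrix_vector_mul_assoc inv inner_axis')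
      finally have i: "u \<bullet> (A *v w) = w $ k" .
      have "(Dm *v w) $ i = (if i = k then 1 else c) * w $ i" for i
        by (simp only: Dm_def matrix_vector_mult_def vec_lambda_beta sum_delta_mult)
      then have "Dm *v w = c *\<^sub>R w + ((1 - c) * w $ k) *\<^sub>R axis k 1"
        by (auto simp: vec_eq_iff axis_def algebra_simps)
      then show ?thesis
        by (simp add: rank_one_matrix_mult_vec i matrix_vector_right_distrib matrix_vector_mult_scaleR A(2))
    qed
    then show ?thesis by (simp add: matrix_eq matrix_vector_mul_assoc[symmetric])
  qed
  then have "det (rank_one_matrix c u) * det A = det A * det Dm"
    by (metis det_mul)
  moreover have "det A \<noteq> 0" using det_orthogonal_matrix[OF A(1)] by auto
  moreover have "det Dm = (\<Prod>i\<in>UNIV. Dm $ i $ i)"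
    by (rule det_diagonal) (simp add: Dm_def)
  moreover have "\<dots> = (\<Prod>i\<in>UNIV. if i = k then 1 else c)" by (simp add: Dm_def)
  moreover have "\<dots> = c ^ (CARD('n) - 1)"
  proof -
    have "(\<Prod>i\<in>UNIV. if i = k then 1 else c) = (\<Prod>i\<in>UNIV - {k}. c)"
      by (subst prod.remove[of UNIV k]) auto
    then show ?thesis by (simp add: card_Diff_singleton)
  qed
  ultimately show ?thesis by simp
qed

text \<open>Radially the chart \<open>(1 + r) p\<close> preserves length; tangentially it multiplies
  vectors of the unit sphere by \<open>norm x\<close>, so the factor \<open>(h r)\<^sup>2\<close>
  becomes \<open>(h r / norm x)\<^sup>2\<close>.\<close>

lemma metric_matrix_warped:
  fixes g :: "'n::finite metric_tensor"
  assumes g: "induced_by L h g" and x: "1 \<le> norm x" "norm x \<le> 1 + L"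
  shows "metric_matrix g x = rank_one_matrix ((h (norm x - 1) / norm x)\<^sup>2) (x /\<^sub>R norm x)"
proof -
  have "x \<noteq> 0" using x by auto
  then have s: "norm x > 0" by simp
  define D where "D v = ((x \<bullet> v) / norm x, v /\<^sub>R norm x - ((x \<bullet> v) / norm x ^ 3) *\<^sub>R x)" for v
  have D: "frechet_derivative cyl_param (at x) = D"
    using frechet_derivative_at[OF has_derivative_cyl_param[OF \<open>x \<noteq> 0\<close>]] by (simp add: D_def[abs_def])
  have xx: "x \<bullet> x = norm x ^ 2" by (simp add: dot_square_norm)
  have cp: "cyl_param x = (norm x - 1, x /\<^sub>R norm x)" by (simp add: cyl_param_def)
  have mem: "(norm x - 1, x /\<^sub>R norm x) \<in> cyl L" using x s by (auto simp: cyl_def)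
  have tan: "D v \<in> cyl_tangent (norm x - 1, x /\<^sub>R norm x)" for v
    using s by (simp add: D_def cyl_tangent_def inner_diff_left xx inner_commute[of v x] field_simps power2_eq_square power3_eq_cube)
  have gD: "g (cyl_param x) (D v) (D w) = fst (D v) * fst (D w) + (h (norm x - 1))\<^sup>2 * (snd (D v) \<bullet> snd (D w))" for v w
    using g mem tan[of v] tan[of w] unfolding induced_by_def cp by (fastforce simp: case_prod_beta)
  have sD: "snd (D v) \<bullet> snd (D w) = (v \<bullet> w) / norm x ^ 2 - (x \<bullet> v) * (x \<bullet> w) / norm x ^ 4" for v w
  proof -
    have "snd (D v) \<bullet> snd (D w) = (v \<bullet> w) / norm x ^ 2 - 2 * ((x \<bullet> v) * (x \<bullet> w) / norm x ^ 4) + (x \<bullet> v) * (x \<bullet> w) * (norm x)\<^sup>2 / norm x ^ 6"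
      using s by (simp add: D_def inner_diff_left inner_diff_right xx inner_commute[of v x] field_simps power_numeral_reduce)
    also have "(x \<bullet> v) * (x \<bullet> w) * (norm x)\<^sup>2 / norm x ^ 6 = (x \<bullet> v) * (x \<bullet> w) / norm x ^ 4"
      using s by (simp add: field_simps power_numeral_reduce)
    finally show ?thesis by simp
  qed
  have entry: "metric_matrix g x $ i $ j = (x $ i / norm x) * (x $ j / norm x) +
      (h (norm x - 1))\<^sup>2 * ((if i = j then 1 else 0) / norm x ^ 2 - x $ i * x $ j / norm x ^ 4)" for i j
  proof -
    have a: "x \<bullet> axis i 1 = x $ i" "x \<bullet> axis j 1 = x $ j"
      by (simp_all add: inner_axis)
    have b: "axis i 1 \<bullet> axis j (1::real) = (if i = j then 1 else 0)"
      by (simp only: inner_axis) (simp add: axis_def)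
    have f: "fst (D v) = (x \<bullet> v) / norm x" for v by (simp add: D_def)
    show ?thesis
      unfolding metric_matrix_def D gD f vec_lambda_beta sD a b ..
  qed
  have "(x $ i / norm x) * (x $ j / norm x) + a\<^sup>2 * ((if i = j then 1 else 0) / norm x ^ 2 - x $ i * x $ j / norm x ^ 4)
     = (if i = j then (a / norm x)\<^sup>2 else 0) + (1 - (a / norm x)\<^sup>2) * (x $ i / norm x * (x $ j / norm x))" for i j a
    using s by (cases "i = j") (simp_all add: field_simps power_numeral_reduce)
  with entry show ?thesis
    by (simp add: vec_eq_iff rank_one_matrix_def divide_inverse mult.commute)
qed

lemma frechet_derivative_eqI: "(f has_derivative D) (at x) \<Longrightarrow> frechet_derivative f (at x) = D"
  using frechet_derivative_at by metis

text \<open>\<open>frechet_derivative\<close> is a choice among derivatives, so it agrees for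
  functions with the same derivatives at the point, even if there are none.\<close>

lemma frechet_derivative_cong_open:
  assumes "open S" "x \<in> S" "\<And>y. y \<in> S \<Longrightarrow> f y = g y"
  shows "frechet_derivative f (at x) = frechet_derivative g (at x)"
proof -
  have "(f has_derivative D) (at x) \<longleftrightarrow> (g has_derivative D) (at x)" for D
    using has_derivative_transform_within_open[OF _ assms(1,2), of f D UNIV g]
      has_derivative_transform_within_open[OF _ assms(1,2), of g D UNIV f] assms(3) by auto
  then show ?thesis by (simp add: frechet_derivative_def)
qed

lemma partial_deriv_cong_open:
  assumes "open S" "x \<in> S" "\<And>y. y \<in> S \<Longrightarrow> f y = g y"
  shows "partial_deriv i f x = partial_deriv i g x"
  unfolding partial_deriv_def by (simp add: frechet_derivative_cong_open[OF assms])

text \<open>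
  \<open>F1 v\<close> is the directional derivative of \<open>F\<close>; in the chart, \<open>E\<close> is the radial derivative
  \<open>x \<bullet> \<nabla>\<Phi>\<close> and \<open>P j\<close> the j-th partial derivative of \<open>\<Phi>\<close>. The key identity is
  \<open>|x|\<^sup>2 \<Delta> = \<Delta>\<^sub>S + (n - 2) E + E E\<close> with \<open>E\<close> as an operator.
\<close>

lemma laplace_beltrami_warped:
  fixes F f :: "real \<times> (real^'n::finite) \<Rightarrow> real" and g :: "'n metric_tensor"
  assumes g: "induced_by L h g"
    and h: "\<And>r. \<lbrakk>0 < r; r < L\<rbrakk> \<Longrightarrow> (h has_real_derivative h' r) (at r)" "\<And>r. \<lbrakk>0 < r; r < L\<rbrakk> \<Longrightarrow> 0 < h r"
    and U: "open U" "cyl_interior L \<subseteq> U" and F: "Ck_on 2 F U"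
    and f: "\<And>q. q \<in> cyl_interior L \<Longrightarrow> f q = F q"
    and r: "0 < r" "r < L" and p: "norm p = 1"
  defines "F1 \<equiv> \<lambda>v q. frechet_derivative F (at q) v"
  shows "laplace_beltrami g f (r, p) = frechet_derivative (F1 (1, 0)) (at (r, p)) (1, 0)
    + (real CARD('n) - 1) * (h' r / h r) * F1 (1, 0) (r, p) + sph_lap (\<lambda>p. F (r, p)) p / (h r)\<^sup>2"
proof -
  define \<Omega> where "\<Omega> = {x :: real^'n. 1 < norm x \<and> norm x < 1 + L}"
  define \<Phi> where "\<Phi> = F \<circ> cyl_param"
  define x where "x = cyl_chart (r, p)"
  define s where "s = norm x"
  let ?n = "real CARD('n)"
  have x: "x = (1 + r) *\<^sub>R p" "s = 1 + r" using r by (simp_all add: x_def s_def cyl_chart_def p)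
  have cpx: "cyl_param x = (r, p)" using r p by (simp add: x cyl_param_def)
  have "\<Omega> = ball 0 (1 + L) - cball 0 1" by (auto simp: \<Omega>_def)
  then have \<Omega>: "open \<Omega>" by (metis open_ball open_Diff closed_cball)
  have x\<Omega>: "x \<in> \<Omega>" using r x by (simp add: \<Omega>_def s_def)
  have \<Omega>nz: "y \<noteq> 0" "0 < norm y" if "y \<in> \<Omega>" for y using that by (auto simp: \<Omega>_def)
  have cpi: "cyl_param y \<in> cyl_interior L" if "y \<in> \<Omega>" for y
    using that \<Omega>nz[OF that] by (auto simp: \<Omega>_def cyl_param_def cyl_interior_def)
  then have cpU: "cyl_param y \<in> U" if "y \<in> \<Omega>" for y using that U by blast
  define Dc where "Dc y v = ((y \<bullet> v) / norm y, v /\<^sub>R norm y - ((y \<bullet> v) / norm y ^ 3) *\<^sub>R y)" for y v :: "real^'n"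
  have Dc: "(cyl_param has_derivative Dc y) (at y)" if "y \<in> \<Omega>" for y
    unfolding Dc_def using has_derivative_cyl_param \<Omega>nz[OF that] by blast
  have Ck: "F differentiable (at q)" "F1 v differentiable (at q)" if "q \<in> U" for q v
    using F that unfolding numeral_2_eq_2 F1_def Ck_on.simps by blast+
  have dF: "(F has_derivative (\<lambda>v. F1 v q)) (at q)" if "q \<in> U" for q
    using Ck(1)[OF that] by (simp add: F1_def frechet_derivative_works)
  have d\<Phi>: "(\<Phi> has_derivative (\<lambda>v. F1 (Dc y v) (cyl_param y))) (at y)" if "y \<in> \<Omega>" for y
    unfolding \<Phi>_def using diff_chain_at[OF Dc[OF that] dF[OF cpU[OF that]]] by (simp add: o_def)
  define P where "P j y = partial_deriv j \<Phi> y" for j y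
  define E where "E y = norm y * F1 (1, 0) (cyl_param y)" for y
  have lin: "linear (\<lambda>v. F1 v q)" if "q \<in> U" for q
    using has_derivative_linear[OF dF[OF that]] .
  have P: "P j y = F1 (Dc y (axis j 1)) (cyl_param y)" if "y \<in> \<Omega>" for j y
    unfolding P_def partial_deriv_def using frechet_derivative_eqI[OF d\<Phi>[OF that]] by simp
  have D\<Phi>: "F1 (Dc y v) (cyl_param y) = (\<Sum>j\<in>UNIV. v $ j * P j y)" if "y \<in> \<Omega>" for y v
  proof -
    have l: "linear (\<lambda>v. F1 (Dc y v) (cyl_param y))" by (rule has_derivative_linear[OF d\<Phi>[OF that]])
    have "v = (\<Sum>j\<in>UNIV. v $ j *\<^sub>R axis j 1)" using basis_expansion[of v] by (simp add: scalar_mult_eq_scaleR)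
    then have "F1 (Dc y v) (cyl_param y) = F1 (Dc y (\<Sum>j\<in>UNIV. v $ j *\<^sub>R axis j 1)) (cyl_param y)" by simp
    also have "\<dots> = (\<Sum>j\<in>UNIV. v $ j *\<^sub>R F1 (Dc y (axis j 1)) (cyl_param y))"
      using linear_sum[OF l, of "\<lambda>j. v $ j *\<^sub>R axis j 1" UNIV] linear_scale[OF l] by simp
    finally show ?thesis by (simp add: P[OF that])
  qed
  have E: "E y = (\<Sum>j\<in>UNIV. y $ j * P j y)" if "y \<in> \<Omega>" for y
  proof -
    have "Dc y y = norm y *\<^sub>R (1, 0)"
      using \<Omega>nz[OF that] by (simp add: Dc_def dot_square_norm power2_eq_square power3_eq_cube field_simps)
    then show ?thesis
      using D\<Phi>[OF that, of y] linear_scale[OF lin[OF cpU[OF that]], of "norm y" "(1, 0)"] by (simp add: E_def)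
  qed
  have diffP: "P j differentiable (at y)" if "y \<in> \<Omega>" for j y
  proof -
    \<comment> \<open>The direction \<open>Dc z (axis j 1)\<close> moves with z. Linearity rewrites
      the expression through derivatives of \<open>F\<close> in fixed directions, which are
      differentiable because \<open>F\<close> is of class C^2.\<close>
    have *: "P j z = (z $ j / norm z) * F1 (1, 0) (cyl_param z) + (\<Sum>k\<in>UNIV. (axis j 1 $ k / norm z - z $ j / norm z ^ 3 * z $ k) * F1 (0, axis k 1) (cyl_param z))"
      if "z \<in> \<Omega>" for z
    proof -
      note l = lin[OF cpU[OF that]]
      let ?w = "axis j 1 /\<^sub>R norm z - (z $ j / norm z ^ 3) *\<^sub>R z"
      have "(0, w) = (\<Sum>k\<in>UNIV. w $ k *\<^sub>R (0 :: real, axis k 1))" for w :: "real^'n"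
        using basis_expansion[of w] by (simp add: prod_eq_iff fst_sum snd_sum scalar_mult_eq_scaleR)
      note w = this[of ?w]
      have Dz: "Dc z (axis j 1) = (z $ j / norm z) *\<^sub>R (1, 0) + (0, ?w)"
        by (simp add: Dc_def inner_axis)
      then have "P j z = (z $ j / norm z) * F1 (1, 0) (cyl_param z) + F1 (0, ?w) (cyl_param z)"
        unfolding P[OF that] Dz linear_add[OF l] linear_scale[OF l] by simp
      also have "F1 (0, ?w) (cyl_param z) = (\<Sum>k\<in>UNIV. ?w $ k * F1 (0, axis k 1) (cyl_param z))"
        by (subst w) (simp only: linear_sum[OF l] linear_scale[OF l] real_scaleR_def)
      finally show ?thesis by (simp add: divide_inverse mult.commute)
    qed
    have dd: "(\<lambda>z. F1 v (cyl_param z)) differentiable (at y)" for v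
      using differentiable_chain_at[of cyl_param y "F1 v"] Dc[OF that] Ck(2)[OF cpU[OF that], of v]
      by (auto simp: o_def differentiable_def)
    have "(\<lambda>z. z $ k) differentiable (at y)" for k
      by (rule bounded_linear_imp_differentiable) (rule bounded_linear_vec_nth)
    then have "(\<lambda>z. (z $ j / norm z) * F1 (1, 0) (cyl_param z) + (\<Sum>k\<in>UNIV. (axis j 1 $ k / norm z - z $ j / norm z ^ 3 * z $ k) * F1 (0, axis k 1) (cyl_param z))) differentiable (at y)"
      using dd \<Omega>nz[OF that]
      by (intro differentiable_add differentiable_mult differentiable_sum differentiable_diff differentiable_divide
          differentiable_norm_at differentiable_power differentiable_const ballI) auto
    then obtain D where D: "((\<lambda>z. (z $ j / norm z) * F1 (1, 0) (cyl_param z) + (\<Sum>k\<in>UNIV. (axis j 1 $ k / norm z - z $ j / norm z ^ 3 * z $ k) * F1 (0, axis k 1) (cyl_param z))) has_derivative D) (at y)"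
      unfolding differentiable_def by blast
    have "(P j has_derivative D) (at y)"
      by (rule has_derivative_transform_within_open[OF D \<Omega> that]) (rule *[symmetric])
    then show ?thesis unfolding differentiable_def by blast
  qed
  have s: "s > 0" using r x by simp
  have Fr: "E x = s * F1 (1, 0) (r, p)" by (simp add: E_def cpx s_def)
  have Ex: "E x = (\<Sum>j\<in>UNIV. x $ j * P j x)" by (rule E[OF x\<Omega>])
  have ss: "(\<Sum>i\<in>UNIV. x $ i * x $ i) = s\<^sup>2"
    by (simp add: s_def norm_vec_def L2_set_def power2_eq_square sum_nonneg)
  define DP where "DP j = frechet_derivative (P j) (at x)" for j
  have dP: "(P j has_derivative DP j) (at x)" for j
    unfolding DP_def using diffP[OF x\<Omega>] by (simp add: frechet_derivative_works)
  define d where "d j k = DP j (axis k 1)" for j k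
  have DPl: "linear (DP j)" for j by (rule has_derivative_linear[OF dP])
  have DPs: "DP j v = (\<Sum>k\<in>UNIV. v $ k * d j k)" for j v
  proof -
    have "v = (\<Sum>k\<in>UNIV. v $ k *\<^sub>R axis k 1)" using basis_expansion[of v] by (simp add: scalar_mult_eq_scaleR)
    then have "DP j v = DP j (\<Sum>k\<in>UNIV. v $ k *\<^sub>R axis k 1)" by simp
    then show ?thesis by (simp add: linear_sum[OF DPl] linear_scale[OF DPl] d_def)
  qed
  \<comment> \<open>The Hessian of \<open>\<Phi>\<close> at x, applied twice to x; \<open>Lp\<close>
    below is the Euclidean Laplacian.\<close>
  define XX where "XX = (\<Sum>j\<in>UNIV. \<Sum>k\<in>UNIV. x $ j * (x $ k * d j k))"
  define Lp where "Lp = (\<Sum>i\<in>UNIV. d i i)"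
  define DE where "DE v = (\<Sum>j\<in>UNIV. x $ j * DP j v + v $ j * P j x)" for v
  have coord: "((\<lambda>y. y $ k) has_derivative (\<lambda>v. v $ k)) (at y)" for y :: "real^'n" and k
    by (rule bounded_linear_imp_has_derivative) (rule bounded_linear_vec_nth)
  have dE: "(E has_derivative DE) (at x)"
  proof (rule has_derivative_transform_within_open[OF _ \<Omega> x\<Omega>])
    show "((\<lambda>y. \<Sum>j\<in>UNIV. y $ j * P j y) has_derivative DE) (at x)"
      unfolding DE_def by (intro has_derivative_sum has_derivative_mult coord dP)
  qed (simp add: E)
  have nrm: "(norm has_derivative (\<lambda>v. (x \<bullet> v) / s)) (at x)"
    using has_derivative_norm[OF \<Omega>nz(1)[OF x\<Omega>]] by (simp add: s_def sgn_div_norm inner_commute divide_inverse mult.commute)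
  define Frr where "Frr = frechet_derivative (F1 (1, 0)) (at (r, p)) (1, 0)"
  have DEx: "DE x = E x + XX"
    by (simp add: DE_def sum.distrib Ex XX_def DPs sum_distrib_left)
  \<comment> \<open>\<open>E\<close> is differentiated once more in its other form
    \<open>norm y * F1 (1, 0) (cyl_param y)\<close>; comparing the two results identifies the
    Hessian term with the second radial derivative.\<close>
  have XX: "XX = s\<^sup>2 * Frr"
  proof -
    have dF1: "(F1 (1, 0) has_derivative frechet_derivative (F1 (1, 0)) (at (r, p))) (at (cyl_param x))"
      using Ck(2)[OF cpU[OF x\<Omega>]] by (simp add: cpx frechet_derivative_works)
    have "((\<lambda>y. norm y * F1 (1, 0) (cyl_param y)) has_derivative
       (\<lambda>v. norm x * frechet_derivative (F1 (1, 0)) (at (r, p)) (Dc x v) + (x \<bullet> v) / s * F1 (1, 0) (cyl_param x))) (at x)"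
      using diff_chain_at[OF Dc[OF x\<Omega>] dF1] by (intro has_derivative_mult nrm) (simp add: o_def)
    then have "DE = (\<lambda>v. norm x * frechet_derivative (F1 (1, 0)) (at (r, p)) (Dc x v) + (x \<bullet> v) / s * F1 (1, 0) (cyl_param x))"
      using dE has_derivative_unique unfolding E_def[abs_def] by blast
    then have "DE x = s * frechet_derivative (F1 (1, 0)) (at (r, p)) (Dc x x) + (x \<bullet> x) / s * F1 (1, 0) (r, p)"
      by (simp add: s_def cpx)
    moreover have "Dc x x = s *\<^sub>R (1, 0)"
      using \<Omega>nz[OF x\<Omega>] by (simp add: s_def Dc_def dot_square_norm power2_eq_square power3_eq_cube field_simps)
    moreover have "(x \<bullet> x) / s = s" using s by (simp add: s_def dot_square_norm power2_eq_square)
    ultimately have "DE x = s * (s * Frr) + s * F1 (1, 0) (r, p)"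
      using linear_scale[OF has_derivative_linear[OF dF1], of s "(1, 0)"] by (simp add: Frr_def)
    then show ?thesis using DEx Fr by (simp add: power2_eq_square)
  qed
  \<comment> \<open>The rotation fields in Cartesian coordinates of the chart. Rotations commute
    with scaling, so these can be evaluated on the sphere of radius s.\<close>
  define M where "M i j y = y $ i * P j y - y $ j * P i y" for i j y
  have chain: "((\<lambda>t. f (rot i j t y)) has_real_derivative f' (rot_gen i j y)) (at 0)"
    if "(f has_derivative f') (at y)" for f :: "real^'n \<Rightarrow> real" and f' y i j
  proof -
    have "((\<lambda>t. rot i j t y) has_derivative (\<lambda>t. t *\<^sub>R rot_gen i j y)) (at 0)"
      using has_vector_derivative_rot by (simp add: has_vector_derivative_def)
    from diff_chain_at[OF this, of f f'] that show ?thesis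
      using linear_scale[OF has_derivative_linear[OF that]]
      by (simp add: o_def has_field_derivative_def mult.commute[of "f' _"] mult_commute_abs)
  qed
  have LopM: "Lop i j (\<lambda>p. F (r, p)) q = M i j (s *\<^sub>R q)" if q: "norm q = 1" for i j q
  proof (rule LopI)
    have sq: "s *\<^sub>R q \<in> \<Omega>" using r x q by (simp add: \<Omega>_def)
    have "\<Phi> (rot i j t (s *\<^sub>R q)) = F (r, rot i j t q)" for t
      using s q x(2) by (simp add: \<Phi>_def cyl_param_def rot_scaleR)
    then have "((\<lambda>t. F (r, rot i j t q)) has_real_derivative F1 (Dc (s *\<^sub>R q) (rot_gen i j (s *\<^sub>R q))) (cyl_param (s *\<^sub>R q))) (at 0)"
      using chain[OF d\<Phi>[OF sq], of i j] by simp
    also have "F1 (Dc (s *\<^sub>R q) (rot_gen i j (s *\<^sub>R q))) (cyl_param (s *\<^sub>R q)) = M i j (s *\<^sub>R q)"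
      unfolding D\<Phi>[OF sq] rot_gen_def M_def
      by (simp add: left_diff_distrib sum_subtractf axis_def if_distrib[of "\<lambda>x. _ * x"] if_distrib[of "\<lambda>x. x * _"] cong: if_cong)
    finally show "((\<lambda>t. F (r, rot i j t q)) has_real_derivative M i j (s *\<^sub>R q)) (at 0)" .
  qed
  let ?\<delta> = "\<lambda>i j. if i = (j::'n) then 1 else (0::real)"
  have LopLop: "Lop i j (Lop i j (\<lambda>p. F (r, p))) p = (?\<delta> j i * x $ i - x $ j) * P j x + x $ i * (x $ i * d j j - x $ j * d j i)
      - ((x $ i - ?\<delta> i j * x $ j) * P i x + x $ j * (x $ i * d i j - x $ j * d i i))" for i j
  proof (rule LopI)
    let ?g = "rot_gen i j x"
    have "(M i j has_derivative (\<lambda>v. (x $ i * DP j v + v $ i * P j x) - (x $ j * DP i v + v $ j * P i x))) (at x)"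
      unfolding M_def by (intro has_derivative_diff has_derivative_mult coord dP)
    from chain[OF this, of i j]
    have "((\<lambda>t. M i j (rot i j t x)) has_real_derivative (x $ i * DP j ?g + ?g $ i * P j x) - (x $ j * DP i ?g + ?g $ j * P i x)) (at 0)" .
    moreover have "Lop i j (\<lambda>p. F (r, p)) (rot i j t p) = M i j (rot i j t x)" for t
      using LopM[of "rot i j t p"] p x by (simp add: rot_scaleR)
    moreover have "DP k ?g = x $ i * d k j - x $ j * d k i" for k
      by (simp add: rot_gen_def linear_diff[OF DPl] linear_scale[OF DPl] d_def)
    moreover have "?g $ i = ?\<delta> j i * x $ i - x $ j" "?g $ j = x $ i - ?\<delta> i j * x $ j"
      by (auto simp: rot_gen_nth)
    ultimately show "((\<lambda>t. Lop i j (\<lambda>p. F (r, p)) (rot i j t p)) has_real_derivative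
       (?\<delta> j i * x $ i - x $ j) * P j x + x $ i * (x $ i * d j j - x $ j * d j i)
      - ((x $ i - ?\<delta> i j * x $ j) * P i x + x $ j * (x $ i * d i j - x $ j * d i i))) (at 0)"
      by (simp add: add.commute)
  qed
  define S where "S = sph_lap (\<lambda>p. F (r, p)) p"
  \<comment> \<open>Summing the squares of the rotation fields over ordered pairs yields each term
    twice, which the factor 1/2 in \<open>sph_lap\<close> removes.\<close>
  have S: "S = E x - ?n * E x + s\<^sup>2 * Lp - XX"
  proof -
    have "(\<Sum>i\<in>UNIV. \<Sum>j\<in>UNIV. Lop i j (Lop i j (\<lambda>p. F (r, p))) p) =
      (\<Sum>i\<in>UNIV. \<Sum>j\<in>UNIV. ?\<delta> j i * (x $ i * P j x)) - (\<Sum>i\<in>(UNIV::'n set). \<Sum>j\<in>UNIV. x $ j * P j x)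
      + (\<Sum>i\<in>UNIV. \<Sum>j\<in>UNIV. (x $ i * x $ i) * d j j) - (\<Sum>i\<in>UNIV. \<Sum>j\<in>UNIV. x $ j * (x $ i * d j i))
      - (\<Sum>i\<in>UNIV. \<Sum>j\<in>(UNIV::'n set). x $ i * P i x) + (\<Sum>i\<in>UNIV. \<Sum>j\<in>UNIV. ?\<delta> i j * (x $ j * P i x))
      - (\<Sum>i\<in>UNIV. \<Sum>j\<in>UNIV. x $ i * (x $ j * d i j)) + (\<Sum>i\<in>UNIV. \<Sum>j\<in>UNIV. (x $ j * x $ j) * d i i)"
      unfolding LopLop sum.distrib[symmetric] sum_subtractf[symmetric]
      by (intro sum.cong refl) (simp add: algebra_simps)
    also have "(\<Sum>i\<in>UNIV. \<Sum>j\<in>UNIV. x $ j * (x $ i * d j i)) = XX"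
      unfolding XX_def by (rule sum.swap)
    also have "(\<Sum>i\<in>UNIV. \<Sum>j\<in>UNIV. x $ i * (x $ j * d i j)) = XX"
      unfolding XX_def ..
    also have "(\<Sum>i\<in>UNIV. \<Sum>j\<in>UNIV. (x $ i * x $ i) * d j j) = s\<^sup>2 * Lp"
      by (simp only: sum_distrib_left[symmetric] sum_distrib_right[symmetric] ss Lp_def)
    also have "(\<Sum>i\<in>UNIV. \<Sum>j\<in>UNIV. (x $ j * x $ j) * d i i) = s\<^sup>2 * Lp"
      by (simp only: sum_distrib_left[symmetric] sum_distrib_right[symmetric] ss Lp_def)
    also have "(\<Sum>i\<in>UNIV. \<Sum>j\<in>UNIV. ?\<delta> j i * (x $ i * P j x)) = E x"
      by (simp only: sum_delta_mult mult_1 Ex)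
    also have "(\<Sum>i\<in>UNIV. \<Sum>j\<in>UNIV. ?\<delta> i j * (x $ j * P i x)) = E x"
      by (simp only: sum_delta_mult mult_1 Ex)
    also have "(\<Sum>i\<in>(UNIV::'n set). \<Sum>j\<in>UNIV. x $ j * P j x) = ?n * E x"
      by (simp add: Ex)
    also have "(\<Sum>i\<in>UNIV. \<Sum>j\<in>(UNIV::'n set). x $ i * P i x) = ?n * E x"
      by (simp add: Ex sum_distrib_left)
    finally show ?thesis by (simp add: S_def sph_lap_def)
  qed
  \<comment> \<open>As functions of t = |y|: \<open>a\<close> is the root of the Gram determinant,
    \<open>c\<close> the tangential eigenvalue of the Gram matrix G, and \<open>b\<close> and
    \<open>\<gamma>\<close> are the coefficients in
    \<open>a G\<^sup>-\<^sup>1 = b I + \<gamma> y y\<^sup>T\<close>.\<close>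
  define a where "a t = (h (t - 1) / t) ^ (CARD('n) - 1)" for t
  define c where "c t = (h (t - 1) / t)\<^sup>2" for t
  define b where "b t = a t / c t" for t
  define \<gamma> where "\<gamma> t = (a t - b t) / t\<^sup>2" for t
  define \<rho> where "\<rho> = h r / s"
  define \<rho>' where "\<rho>' = (h' r * s - h r) / s\<^sup>2"
  have sr: "s - 1 = r" using x by simp
  have hr: "h r > 0" using h r by simp
  then have \<rho>0: "\<rho> > 0" using s by (simp add: \<rho>_def)
  have d\<rho>: "((\<lambda>t. h (t - 1) / t) has_real_derivative \<rho>') (at s)"
  proof -
    have "((\<lambda>t. h (t - 1)) has_real_derivative h' r * 1) (at s)"
      by (rule DERIV_chain2[where g = "\<lambda>t. t - 1"]) (use h(1)[OF r] sr in \<open>auto intro!: derivative_eq_intros\<close>)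
    from DERIV_divide[OF this DERIV_ident] s show ?thesis
      by (simp add: \<rho>'_def sr power2_eq_square)
  qed
  define a' where "a' = real (CARD('n) - 1) * \<rho> ^ (CARD('n) - 1 - 1) * \<rho>'"
  have da: "(a has_real_derivative a') (at s)"
    unfolding a_def[abs_def] a'_def using DERIV_power[OF d\<rho>, of "CARD('n) - 1"] by (simp add: sr \<rho>_def mult_ac)
  have dc: "(c has_real_derivative 2 * \<rho> * \<rho>') (at s)"
    unfolding c_def[abs_def] using DERIV_power[OF d\<rho>, of 2] by (simp add: sr \<rho>_def mult_ac)
  have cs: "c s = \<rho>\<^sup>2" "a s = \<rho> ^ (CARD('n) - 1)" by (simp_all add: c_def a_def \<rho>_def sr)
  define b' where "b' = (a' * c s - a s * (2 * \<rho> * \<rho>')) / (c s * c s)"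
  have db: "(b has_real_derivative b') (at s)"
    unfolding b_def[abs_def] b'_def using \<rho>0 by (intro DERIV_divide da dc) (simp add: cs)
  define \<gamma>' where "\<gamma>' = ((a' - b') * s\<^sup>2 - (a s - b s) * (2 * s)) / (s\<^sup>2 * s\<^sup>2)"
  have d\<gamma>: "(\<gamma> has_real_derivative \<gamma>') (at s)"
    unfolding \<gamma>_def[abs_def] \<gamma>'_def using s by (intro DERIV_divide DERIV_diff da db) (auto intro!: derivative_eq_intros)
  have dcomp: "((\<lambda>y. q (norm y)) has_derivative (\<lambda>v. q' * ((x \<bullet> v) / s))) (at x)"
    if "(q has_real_derivative q') (at s)" for q q'
    using diff_chain_at[OF nrm, of q "(*) q'"] that by (simp add: has_field_derivative_def s_def o_def)
  have det: "sqrt (det (metric_matrix g y)) = a (norm y)"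
    and inv: "matrix_inv (metric_matrix g y) = rank_one_matrix (1 / c (norm y)) (y /\<^sub>R norm y)" if "y \<in> \<Omega>" for y
  proof -
    have y: "1 \<le> norm y" "norm y \<le> 1 + L" "0 < h (norm y - 1)" using that h(2)[of "norm y - 1"] by (auto simp: \<Omega>_def)
    have u: "norm (y /\<^sub>R norm y) = 1" using \<Omega>nz[OF that] by simp
    have m: "metric_matrix g y = rank_one_matrix (c (norm y)) (y /\<^sub>R norm y)"
      unfolding c_def by (rule metric_matrix_warped[OF g y(1,2)])
    show "matrix_inv (metric_matrix g y) = rank_one_matrix (1 / c (norm y)) (y /\<^sub>R norm y)"
      unfolding m using y \<Omega>nz[OF that] by (intro rank_one_matrix_inverse u) (auto simp: c_def)
    have "det (metric_matrix g y) = (a (norm y))\<^sup>2"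
      unfolding m rank_one_matrix_det[OF u] by (simp add: a_def c_def power_mult[symmetric] mult.commute)
    moreover have "0 \<le> a (norm y)" using y \<Omega>nz[OF that] by (auto simp: a_def)
    ultimately show "sqrt (det (metric_matrix g y)) = a (norm y)" by simp
  qed
  have part: "partial_deriv j (f \<circ> cyl_param) y = P j y" if "y \<in> \<Omega>" for j y
    unfolding P_def partial_deriv_def using frechet_derivative_cong_open[OF \<Omega> that, of "f \<circ> cyl_param" \<Phi>] f[OF cpi]
    by (simp add: \<Phi>_def)
  define A where "A i y = b (norm y) * P i y + \<gamma> (norm y) * (y $ i * E y)" for i y
  have A: "(\<Sum>j\<in>UNIV. sqrt (det (metric_matrix g y)) * matrix_inv (metric_matrix g y) $ i $ j * partial_deriv j (f \<circ> cyl_param) y) = A i y"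
    if "y \<in> \<Omega>" for i y
  proof -
    let ?t = "norm y"
    have "(\<Sum>j\<in>UNIV. sqrt (det (metric_matrix g y)) * matrix_inv (metric_matrix g y) $ i $ j * partial_deriv j (f \<circ> cyl_param) y)
      = (\<Sum>j\<in>UNIV. (if i = j then b ?t else 0) * P j y) + (\<Sum>j\<in>UNIV. (\<gamma> ?t * y $ i) * (y $ j * P j y))"
      unfolding sum.distrib[symmetric]
    proof (intro sum.cong refl)
      fix j
      have "a ?t * ((1 - 1 / c ?t) * (y $ i / ?t * (y $ j / ?t))) = \<gamma> ?t * y $ i * y $ j"
        by (simp add: \<gamma>_def b_def right_diff_distrib left_diff_distrib diff_divide_distrib power2_eq_square)
      moreover have "rank_one_matrix (1 / c ?t) (y /\<^sub>R ?t) $ i $ j = (if i = j then 1 / c ?t else 0) + (1 - 1 / c ?t) * (y $ i / ?t * (y $ j / ?t))"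
        by (simp add: rank_one_matrix_def divide_inverse mult.commute)
      ultimately have "a ?t * rank_one_matrix (1 / c ?t) (y /\<^sub>R ?t) $ i $ j = (if i = j then b ?t else 0) + \<gamma> ?t * y $ i * y $ j"
        by (simp only: distrib_left) (simp add: b_def)
      then show "sqrt (det (metric_matrix g y)) * matrix_inv (metric_matrix g y) $ i $ j * partial_deriv j (f \<circ> cyl_param) y
        = (if i = j then b ?t else 0) * P j y + \<gamma> ?t * y $ i * (y $ j * P j y)"
        unfolding det[OF that] inv[OF that] part[OF that] by (simp only: distrib_right mult.assoc)
    qed
    also have "\<dots> = A i y"
      by (simp only: sum_delta_mult sum_distrib_left[symmetric] E[OF that, symmetric] A_def mult.assoc)
    finally show ?thesis .
  qed
  have dA: "(A i has_derivative (\<lambda>v. (b (norm x) * DP i v + b' * ((x \<bullet> v) / s) * P i x)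
      + (\<gamma> (norm x) * (x $ i * DE v + v $ i * E x) + \<gamma>' * ((x \<bullet> v) / s) * (x $ i * E x)))) (at x)" for i
    unfolding A_def by (intro has_derivative_add has_derivative_mult dcomp db d\<gamma> dP coord dE)
  have "partial_deriv i (\<lambda>y. \<Sum>j\<in>UNIV. sqrt (det (metric_matrix g y)) * matrix_inv (metric_matrix g y) $ i $ j * partial_deriv j (f \<circ> cyl_param) y) x
     = b s * d i i + b' / s * (x $ i * P i x) + \<gamma> s * (x $ i * DE (axis i 1)) + \<gamma> s * E x + \<gamma>' / s * E x * (x $ i * x $ i)" for i
  proof -
    have "partial_deriv i (A i) x
     = b s * d i i + b' / s * (x $ i * P i x) + \<gamma> s * (x $ i * DE (axis i 1)) + \<gamma> s * E x + \<gamma>' / s * E x * (x $ i * x $ i)"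
      unfolding partial_deriv_def frechet_derivative_eqI[OF dA]
      by (simp add: d_def inner_axis s_def[symmetric] algebra_simps)
    then show ?thesis
      using partial_deriv_cong_open[OF \<Omega> x\<Omega> A] by (rule trans[rotated])
  qed
  then have "(\<Sum>i\<in>UNIV. partial_deriv i (\<lambda>y. \<Sum>j\<in>UNIV. sqrt (det (metric_matrix g y)) * matrix_inv (metric_matrix g y) $ i $ j * partial_deriv j (f \<circ> cyl_param) y) x)
    = (\<Sum>i\<in>UNIV. b s * d i i + b' / s * (x $ i * P i x) + \<gamma> s * (x $ i * DE (axis i 1)) + \<gamma> s * E x + \<gamma>' / s * E x * (x $ i * x $ i))"
    by (intro sum.cong refl)
  also have "\<dots> = b s * Lp + b' / s * E x + \<gamma> s * (\<Sum>i\<in>UNIV. x $ i * DE (axis i 1)) + ?n * (\<gamma> s * E x) + \<gamma>' / s * E x * s\<^sup>2"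
    by (simp only: sum.distrib sum_distrib_left[symmetric] Lp_def[symmetric] Ex[symmetric] ss sum_constant)
      (simp add: mult.left_commute)
  also have "(\<Sum>i\<in>UNIV. x $ i * DE (axis i 1)) = DE x"
  proof -
    have l: "linear DE" by (rule has_derivative_linear[OF dE])
    have "DE (\<Sum>i\<in>UNIV. x $ i *\<^sub>R axis i 1) = (\<Sum>i\<in>UNIV. x $ i * DE (axis i 1))"
      by (simp add: linear_sum[OF l] linear_scale[OF l])
    then show ?thesis using basis_expansion[of x] by (simp add: scalar_mult_eq_scaleR)
  qed
  finally have W: "(\<Sum>i\<in>UNIV. partial_deriv i (\<lambda>y. \<Sum>j\<in>UNIV. sqrt (det (metric_matrix g y)) * matrix_inv (metric_matrix g y) $ i $ j * partial_deriv j (f \<circ> cyl_param) y) x)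
    = b s * Lp + b' / s * E x + \<gamma> s * DE x + ?n * (\<gamma> s * E x) + \<gamma>' / s * E x * s\<^sup>2" .
  have "laplace_beltrami g f (r, p) = 1 / a s * (b s * Lp + b' / s * E x + \<gamma> s * DE x + ?n * (\<gamma> s * E x) + \<gamma>' / s * E x * s\<^sup>2)"
    unfolding laplace_beltrami_def Let_def x_def[symmetric] det[OF x\<Omega>] s_def[symmetric] W ..
  moreover have "a s \<noteq> 0" using \<rho>0 by (simp add: cs)
  moreover have "b s * Lp + b' / s * E x + \<gamma> s * DE x + ?n * (\<gamma> s * E x) + \<gamma>' / s * E x * s\<^sup>2
     = a s * (Frr + (?n - 1) * (h' r / h r) * F1 (1, 0) (r, p) + S / (h r)\<^sup>2)"
  proof -
    \<comment> \<open>The logarithmic derivative of \<open>a\<close> produces the drift (n - 1)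
      h'/h; its part -(n - 1)/s will cancel against the Euclidean radial term. The case n = 1 is
      separate because the exponent n - 1 - 1 is truncated.\<close>
    have "a' * \<rho> = (?n - 1) * a s * \<rho>'"
    proof (cases "CARD('n) = 1")
      case False
      then have "CARD('n) - 1 \<noteq> 0" using zero_less_card_finite[where 'a = 'n] by linarith
      then have "\<rho> ^ (CARD('n) - 1 - 1) * \<rho> = a s" unfolding cs by (metis power_minus_mult neq0_conv)
      then show ?thesis
        by (simp add: a'_def of_nat_diff Suc_leI)
    qed (simp add: a'_def)
    moreover have "\<rho>' = (h' r / h r - 1 / s) * \<rho>"
      using hr s by (simp add: \<rho>_def \<rho>'_def field_simps power2_eq_square)
    ultimately have "a' * \<rho> = ((?n - 1) * a s * (h' r / h r - 1 / s)) * \<rho>"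
      by (simp only: mult.assoc)
    then have a': "a' = (?n - 1) * a s * (h' r / h r - 1 / s)"
      using \<rho>0 by simp
    have Lp: "Lp = (S - E x + ?n * E x + XX) / s\<^sup>2"
      using S s by (simp add: field_simps)
    have bs: "b s = a s * s\<^sup>2 / (h r)\<^sup>2"
      using s hr by (simp add: b_def cs \<rho>_def power_divide)
    have g': "\<gamma>' / s * s\<^sup>2 = (a' - b') / s - 2 * \<gamma> s"
      using s by (simp add: \<gamma>'_def \<gamma>_def field_simps power2_eq_square)
    have gs: "\<gamma> s * s\<^sup>2 = a s - b s" using s by (simp add: \<gamma>_def)
    have "b s * Lp + b' / s * E x + \<gamma> s * DE x + ?n * (\<gamma> s * E x) + \<gamma>' / s * E x * s\<^sup>2
      = b s * Lp + b' / s * E x + \<gamma> s * (E x + XX) + ?n * (\<gamma> s * E x) + ((a' - b') / s - 2 * \<gamma> s) * E x"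
      unfolding g'[symmetric] DEx by simp
    also have "\<dots> = b s * (S / s\<^sup>2) + (b s / s\<^sup>2 + \<gamma> s) * (XX + (?n - 1) * E x) + a' / s * E x"
      unfolding Lp by (simp add: add_divide_distrib diff_divide_distrib algebra_simps)
    also have "b s / s\<^sup>2 + \<gamma> s = a s / s\<^sup>2"
      using s by (simp add: \<gamma>_def diff_divide_distrib)
    also have "b s * (S / s\<^sup>2) = a s * (S / (h r)\<^sup>2)"
      using s by (simp add: bs)
    also have "a s * (S / (h r)\<^sup>2) + a s / s\<^sup>2 * (XX + (?n - 1) * E x) + a' / s * E x
      = a s * (S / (h r)\<^sup>2) + a s * Frr + a s * ((?n - 1) * (F1 (1, 0) (r, p) / s)) + a' * F1 (1, 0) (r, p)"
      unfolding XX Fr using s by (simp add: field_simps power2_eq_square)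
    also have "\<dots> = a s * (Frr + (?n - 1) * (h' r / h r) * F1 (1, 0) (r, p) + S / (h r)\<^sup>2)"
      unfolding a' by (simp add: algebra_simps)
    finally show ?thesis .
  qed
  ultimately show ?thesis by (simp add: Frr_def S_def)
qed

section \<open>Enlarging a profile\<close>

text \<open>The powers of 1/x make the family closed under differentiation up to linear
  combinations, so smoothness follows by induction on the order for all \<open>m\<close> at
  once.\<close>

definition flat_fn :: "nat \<Rightarrow> real \<Rightarrow> real" where
  "flat_fn m x = (if 0 < x then inverse x ^ m * exp (- inverse x) else 0)"

lemma flat_fn_at_right_0: "(flat_fn m \<longlongrightarrow> 0) (at_right 0)"
proof -
  have "((\<lambda>x. inverse x ^ m / exp (inverse x)) \<longlongrightarrow> (0::real)) (at_right 0)"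
    using filterlim_compose[OF tendsto_power_div_exp_0 filterlim_inverse_at_top_right] .
  then show ?thesis
    by (rule Lim_transform_eventually)
      (auto simp: flat_fn_def exp_minus divide_inverse intro: eventually_mono[OF eventually_at_right_less])
qed

lemma flat_fn_deriv:
  "(flat_fn m has_real_derivative flat_fn (m + 2) x - real m * flat_fn (m + 1) x) (at x)"
proof -
  consider "x > 0" | "x < 0" | "x = 0" by linarith
  then show ?thesis
  proof cases
    case 1
    then have inv: "(inverse has_real_derivative - (inverse x)\<^sup>2) (at x)"
      using DERIV_inverse[of x UNIV] by (simp add: numeral_2_eq_2)
    have "((\<lambda>x. inverse x ^ m) has_real_derivative - real m * inverse x ^ (m + 1)) (at x)"
      using DERIV_power[OF inv, of m] by (cases m) (simp_all add: power2_eq_square algebra_simps)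
    moreover have "((\<lambda>x. exp (- inverse x)) has_real_derivative exp (- inverse x) * (inverse x)\<^sup>2) (at x)"
      using DERIV_fun_exp[OF DERIV_minus[OF inv]] by simp
    ultimately have "((\<lambda>x. inverse x ^ m * exp (- inverse x)) has_real_derivative
        - real m * inverse x ^ (m + 1) * exp (- inverse x) + exp (- inverse x) * (inverse x)\<^sup>2 * inverse x ^ m) (at x)"
      by (rule DERIV_mult)
    moreover have "- real m * inverse x ^ (m + 1) * exp (- inverse x) + exp (- inverse x) * (inverse x)\<^sup>2 * inverse x ^ m
        = flat_fn (m + 2) x - real m * flat_fn (m + 1) x"
      using 1 by (simp add: flat_fn_def power_add power2_eq_square)
    ultimately have "((\<lambda>x. inverse x ^ m * exp (- inverse x)) has_real_derivative flat_fn (m + 2) x - real m * flat_fn (m + 1) x) (at x)"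
      by simp
    then show ?thesis
      by (rule has_field_derivative_transform_within_open[where S = "{0<..}"]) (use 1 in \<open>auto simp: flat_fn_def\<close>)
  next
    case 2
    have "((\<lambda>x. 0) has_real_derivative flat_fn (m + 2) x - real m * flat_fn (m + 1) x) (at x)"
      using 2 by (simp add: flat_fn_def)
    then show ?thesis
      by (rule has_field_derivative_transform_within_open[where S = "{..<0}"]) (use 2 in \<open>auto simp: flat_fn_def\<close>)
  next
    case 3
    have "((\<lambda>h. (flat_fn m (0 + h) - flat_fn m 0) / h) \<longlongrightarrow> 0) (at_right 0)"
      by (rule Lim_transform_eventually[OF flat_fn_at_right_0[of "Suc m"]])
        (auto simp: flat_fn_def divide_inverse mult_ac intro: eventually_mono[OF eventually_at_right_less])
    moreover have "((\<lambda>h. (flat_fn m (0 + h) - flat_fn m 0) / h) \<longlongrightarrow> 0) (at_left 0)"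
      by (rule tendsto_eventually, rule eventually_at_leftI[of "-1"]) (auto simp: flat_fn_def)
    ultimately show ?thesis
      using 3 by (simp add: DERIV_def filterlim_split_at flat_fn_def)
  qed
qed

lemma flat_fn_affine_deriv:
  "((\<lambda>t. flat_fn m (c + e * t)) has_real_derivative (flat_fn (m + 2) (c + e * t) - real m * flat_fn (m + 1) (c + e * t)) * e) (at t)"
proof -
  have "((\<lambda>t. c + e * t) has_real_derivative e) (at t)"
    by (auto intro!: derivative_eq_intros)
  from DERIV_chain2[where f = "flat_fn m" and g = "\<lambda>t. c + e * t", OF flat_fn_deriv this] show ?thesis .
qed

lemma Ck_on_flat_fn: "Ck_on k (\<lambda>t. flat_fn m (c + e * t)) UNIV"
proof (induction k arbitrary: m)
  case 0
  show ?case
    using DERIV_isCont[OF flat_fn_affine_deriv] by (auto intro: continuous_at_imp_continuous_on)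
next
  case (Suc k)
  show ?case
  proof (rule Ck_on_SucI_real)
    show "((\<lambda>t. flat_fn m (c + e * t)) has_real_derivative (flat_fn (m + 2) (c + e * t) + (- real m) * flat_fn (m + 1) (c + e * t)) * e) (at t)" for t
      using flat_fn_affine_deriv[of m c e t] by simp
    show "Ck_on k (\<lambda>t. (flat_fn (m + 2) (c + e * t) + (- real m) * flat_fn (m + 1) (c + e * t)) * e) UNIV"
      by (intro Ck_on_mult Ck_on_add Ck_on_const Suc.IH open_UNIV)
  qed auto
qed

lemma flat_fn_0_mono: "x \<le> y \<Longrightarrow> flat_fn 0 x \<le> flat_fn 0 y"
  by (auto simp: flat_fn_def field_simps)

lemma flat_fn_0_nonneg: "0 \<le> flat_fn 0 x" and flat_fn_0_pos: "0 < x \<Longrightarrow> 0 < flat_fn 0 x"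
  by (auto simp: flat_fn_def)

text \<open>Integrates a smooth odd sign function with values in [-1, 1] that equals 1 beyond
  \<open>\<delta>\<close>; the slope bound 1 is then exact, and oddness makes the antiderivative
  even.\<close>

lemma smooth_abs_exists:
  fixes \<delta> C :: real
  assumes "0 < \<delta>" "\<delta> < C"
  obtains m \<theta> where "\<And>k. Ck_on k m {-C<..<C}"
    "\<And>t. t \<in> {-C<..<C} \<Longrightarrow> (m has_real_derivative \<theta> t) (at t) \<and> \<bar>\<theta> t\<bar> \<le> 1"
    "\<And>t. t \<in> {-C<..<C} \<Longrightarrow> m t \<le> max \<bar>t\<bar> \<delta>"
    "\<And>t. t \<in> {-C<..<C} \<Longrightarrow> \<delta> \<le> \<bar>t\<bar> \<Longrightarrow> m t = \<bar>t\<bar>"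
proof -
  \<comment> \<open>\<open>P\<close> vanishes for \<open>t \<le> - \<delta>\<close> and
    \<open>Q\<close> for \<open>t \<ge> \<delta>\<close>, never both; their normalised difference is
    the smooth sign.\<close>
  define P where "P t = flat_fn 0 (\<delta> + 1 * t)" for t
  define Q where "Q t = flat_fn 0 (\<delta> + (-1) * t)" for t
  define \<theta> where "\<theta> t = (P t + (-1) * Q t) * inverse (P t + Q t)" for t
  have nn: "0 \<le> P t" "0 \<le> Q t" for t by (simp_all add: P_def Q_def flat_fn_0_nonneg)
  have pos: "0 < P t + Q t" for t
    using nn[of t] flat_fn_0_pos[of "\<delta> + t"] flat_fn_0_pos[of "\<delta> - t"] \<open>0 < \<delta>\<close> unfolding P_def Q_def
    by (cases "t \<ge> 0") (auto intro: add_pos_nonneg add_nonneg_pos)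
  have smooth: "Ck_on k \<theta> UNIV" for k
    unfolding \<theta>_def[abs_def] P_def[abs_def] Q_def[abs_def]
    using pos unfolding P_def Q_def
    by (intro Ck_on_mult Ck_on_inverse Ck_on_add Ck_on_const Ck_on_flat_fn open_UNIV) (auto simp: less_imp_neq[symmetric])
  have bound: "\<bar>\<theta> t\<bar> \<le> 1" for t
  proof -
    have "\<bar>P t + (-1) * Q t\<bar> \<le> P t + Q t" using nn[of t] by auto
    then show ?thesis using pos[of t] by (simp add: \<theta>_def abs_mult divide_inverse[symmetric])
  qed
  have nonneg: "0 \<le> \<theta> t" if "0 \<le> t" for t
    using flat_fn_0_mono[of "\<delta> - t" "\<delta> + t"] that pos[of t] by (auto simp: \<theta>_def P_def Q_def intro!: mult_nonneg_nonneg)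
  have odd: "\<theta> (- t) = - \<theta> t" for t
    by (simp add: \<theta>_def P_def Q_def add.commute minus_mult_left[symmetric] del: minus_mult_left) (simp add: algebra_simps)
  have one: "\<theta> t = 1" if "\<delta> \<le> t" for t
    using that pos[of t] by (simp add: \<theta>_def Q_def flat_fn_def)
  have "continuous_on {-C..C} \<theta>"
    using smooth[of 0] by (auto intro: continuous_on_subset)
  then obtain g where g: "\<And>t. t \<in> {-C..C} \<Longrightarrow> (g has_vector_derivative \<theta> t) (at t within {-C..C})"
    using antiderivative_continuous by blast
  \<comment> \<open>The constant of integration is chosen so that \<open>m\<close> agrees with |t|
    at \<open>\<delta>\<close>, and hence from there on.\<close>
  define m where "m t = g t - g \<delta> + \<delta>" for t
  have dm: "(m has_real_derivative \<theta> t) (at t)" if "t \<in> {-C<..<C}" for t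
  proof -
    have "(g has_real_derivative \<theta> t) (at t)"
      using g[of t] that at_within_interior[of t "{-C..C}"]
      by (simp add: has_real_derivative_iff_has_vector_derivative)
    then show ?thesis unfolding m_def by (auto intro!: derivative_eq_intros)
  qed
  have cm: "continuous_on {-C<..<C} m"
    by (rule continuous_at_imp_continuous_on) (use dm DERIV_isCont in blast)
  have even: "m (- t) = m t" if "t \<in> {-C<..<C}" for t
  proof -
    have d: "((\<lambda>t. m (- t) - m t) has_real_derivative 0) (at s)" if s: "s \<in> {-C<..<C}" for s
    proof -
      have "((\<lambda>t. m (- t)) has_real_derivative \<theta> (- s) * (-1)) (at s)"
        by (rule DERIV_chain2[OF dm]) (use s in \<open>auto intro!: derivative_eq_intros\<close>)
      from DERIV_diff[OF this dm[OF s]] show ?thesis by (simp add: odd)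
    qed
    have "\<exists>c. \<forall>t\<in>{-C<..<C}. m (- t) - m t = c"
      by (rule has_field_derivative_zero_constant) (use d has_field_derivative_at_within in \<open>blast+\<close>)
    then obtain c where c: "\<And>t. t \<in> {-C<..<C} \<Longrightarrow> m (- t) - m t = c" by blast
    show ?thesis using c[OF that] c[of 0] assms by simp
  qed
  have m\<delta>: "m \<delta> = \<delta>" by (simp add: m_def)
  have up: "m t = t" if "\<delta> \<le> t" "t < C" for t
  proof -
    have c: "continuous_on {\<delta>..t} (\<lambda>s. m s - s)" using that assms cm
      by (intro continuous_intros) (auto intro: continuous_on_subset)
    show ?thesis
    proof (cases "\<delta> = t")
      case False
      have "((\<lambda>s. m s - s) has_real_derivative 0) (at s)" if s: "\<delta> < s" "s < t" for s
        using DERIV_diff[OF dm[of s] DERIV_ident] one[of s] s assms \<open>t < C\<close> by simp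
      from DERIV_isconst2[OF _ c this, of t] show ?thesis using False that m\<delta> by simp
    qed (use m\<delta> in simp)
  qed
  have low: "m t \<le> \<delta>" if "0 \<le> t" "t \<le> \<delta>" for t
  proof -
    have "continuous_on {0..\<delta>} m" using cm assms by (auto intro: continuous_on_subset)
    then have "m t \<le> m \<delta>"
      by (rule deriv_nonneg_imp_mono_closed[where f' = \<theta>]) (use dm nonneg that assms in auto)
    then show ?thesis by (simp add: m\<delta>)
  qed
  have abs: "m t = m \<bar>t\<bar>" if "t \<in> {-C<..<C}" for t
    using even[OF that] by (cases "0 \<le> t") auto
  show ?thesis
  proof (rule that[of m \<theta>])
    show "Ck_on k m {-C<..<C}" for k
    proof (cases k)
      case (Suc j)
      show ?thesis unfolding Suc
        by (rule Ck_on_SucI_real[OF _ dm]) (auto intro: Ck_on_subset[OF smooth])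
    qed (simp add: cm)
    show "(m has_real_derivative \<theta> t) (at t) \<and> \<bar>\<theta> t\<bar> \<le> 1" if "t \<in> {-C<..<C}" for t
      using dm[OF that] bound by simp
    show "m t \<le> max \<bar>t\<bar> \<delta>" if "t \<in> {-C<..<C}" for t
      using abs[OF that] up[of "\<bar>t\<bar>"] low[of "\<bar>t\<bar>"] that by (cases "\<delta> \<le> \<bar>t\<bar>") auto
    show "m t = \<bar>t\<bar>" if "t \<in> {-C<..<C}" "\<delta> \<le> \<bar>t\<bar>" for t
      using abs[OF that(1)] up[of "\<bar>t\<bar>"] that by auto
  qed
qed

text \<open>
  A profile lies below the tent \<open>min (1 + r) (1 + L - r)\<close>, and strictly so at \<open>L / 2\<close>, where the
  tent has a corner. Smoothing the corner a little leaves room for the profile.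
\<close>

lemma larger_profile_exists:
  fixes h :: "real \<Rightarrow> real"
  assumes L: "0 < L" and h: "h 0 = 1" "h L = 1"
    and dh: "\<And>r. r \<in> {0..L} \<Longrightarrow> \<exists>d. (h has_real_derivative d) (at r within {0..L}) \<and> \<bar>d\<bar> \<le> 1"
  obtains k r0 where "smooth_on k {0..L}" "k 0 = 1" "k L = 1"
    "\<And>r. r \<in> {0..L} \<Longrightarrow> \<exists>d. (k has_real_derivative d) (at r within {0..L}) \<and> \<bar>d\<bar> \<le> 1"
    "\<And>r. r \<in> {0..L} \<Longrightarrow> h r \<le> k r" "0 < r0" "r0 < L" "h r0 < k r0"
proof -
  obtain d where d: "\<And>r. r \<in> {0..L} \<Longrightarrow> (h has_real_derivative d r) (at r within {0..L}) \<and> \<bar>d r\<bar> \<le> 1"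
    using dh by metis
  have ch: "continuous_on {0..L} h"
    by (rule DERIV_continuous_on) (use d in blast)
  have di: "(h has_real_derivative d r) (at r)" "\<bar>d r\<bar> \<le> 1" if "0 < r" "r < L" for r
    using d[of r] that at_within_interior[of r "{0..L}"] by auto
  have minus: "h t - t \<le> h s - s" and plus: "h s + s \<le> h t + t" if "s \<in> {0..L}" "t \<in> {0..L}" "s \<le> t" for s t
  proof -
    have "s - h s \<le> t - h t"
    proof (rule deriv_nonneg_imp_mono_closed[where f = "\<lambda>r. r - h r" and f' = "\<lambda>r. 1 - d r", OF _ _ _ that])
      show "continuous_on {0..L} (\<lambda>r. r - h r)" by (intro continuous_intros ch)
      show "((\<lambda>r. r - h r) has_real_derivative 1 - d r) (at r)" if "0 < r" "r < L" for r
        by (intro DERIV_diff DERIV_ident di that)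
      show "0 \<le> 1 - d r" if "0 < r" "r < L" for r using di(2)[OF that] by auto
    qed
    then show "h t - t \<le> h s - s" by simp
    have "s + h s \<le> t + h t"
    proof (rule deriv_nonneg_imp_mono_closed[where f = "\<lambda>r. r + h r" and f' = "\<lambda>r. 1 + d r", OF _ _ _ that])
      show "continuous_on {0..L} (\<lambda>r. r + h r)" by (intro continuous_intros ch)
      show "((\<lambda>r. r + h r) has_real_derivative 1 + d r) (at r)" if "0 < r" "r < L" for r
        by (intro DERIV_add DERIV_ident di that)
      show "0 \<le> 1 + d r" if "0 < r" "r < L" for r using di(2)[OF that] by auto
    qed
    then show "h s + s \<le> h t + t" by simp
  qed
  have tent: "h r \<le> 1 + r" "h r \<le> 1 + L - r" if "r \<in> {0..L}" for r
    using minus[of 0 r] plus[of r L] that h L by auto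
  \<comment> \<open>At the corner the tent has left slope 1 and right slope -1; a differentiable
    function below it that touches it there would need a derivative both at least 1 and at most
    -1.\<close>
  have "h (L / 2) \<noteq> 1 + L / 2"
  proof
    assume eq: "h (L / 2) = 1 + L / 2"
    note dL = di(1)[of "L / 2"]
    show False
    proof (cases "d (L / 2) < 1")
      case True
      have "((\<lambda>r. h r - r) has_real_derivative d (L / 2) - 1) (at (L / 2))"
        by (intro DERIV_diff DERIV_ident dL) (use L in auto)
      from DERIV_neg_dec_left[OF this] True obtain e where e: "e > 0"
        "\<And>\<eta>. 0 < \<eta> \<Longrightarrow> \<eta> < e \<Longrightarrow> h (L / 2) - L / 2 < h (L / 2 - \<eta>) - (L / 2 - \<eta>)" by auto
      define \<eta> where "\<eta> = min (e / 2) (L / 2)"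
      have "0 < \<eta>" "\<eta> < e" "\<eta> \<le> L / 2" using e(1) L by (auto simp: \<eta>_def)
      then show False using e(2)[of \<eta>] tent(1)[of "L / 2 - \<eta>"] eq L by auto
    next
      case False
      have "((\<lambda>r. h r + r) has_real_derivative d (L / 2) + 1) (at (L / 2))"
        by (intro DERIV_add DERIV_ident dL) (use L in auto)
      from DERIV_pos_inc_right[OF this] False obtain e where e: "e > 0"
        "\<And>\<eta>. 0 < \<eta> \<Longrightarrow> \<eta> < e \<Longrightarrow> h (L / 2) + L / 2 < h (L / 2 + \<eta>) + (L / 2 + \<eta>)" by auto
      define \<eta> where "\<eta> = min (e / 2) (L / 2)"
      have "0 < \<eta>" "\<eta> < e" "\<eta> \<le> L / 2" using e(1) L by (auto simp: \<eta>_def)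
      then show False using e(2)[of \<eta>] tent(2)[of "L / 2 + \<eta>"] eq L by auto
    qed
  qed
  then have gap: "h (L / 2) < 1 + L / 2" using tent(1)[of "L / 2"] L by auto
  \<comment> \<open>Half the gap at the corner: within distance \<open>\<delta>\<close> of L / 2 the
    profile is at most \<open>h (L / 2) + \<delta>\<close>, hence at most
    \<open>1 + L / 2 - \<delta>\<close>, a lower bound for the smoothed tent there. The bound L / 2
    keeps the end values.\<close>
  define \<delta> where "\<delta> = min ((1 + L / 2 - h (L / 2)) / 2) (L / 2)"
  have \<delta>: "0 < \<delta>" "\<delta> \<le> L / 2" "2 * \<delta> \<le> 1 + L / 2 - h (L / 2)" using gap L by (auto simp: \<delta>_def min_def)
  obtain m \<theta> where m: "\<And>k. Ck_on k m {-(L + 1)<..<L + 1}"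
    "\<And>t. t \<in> {-(L + 1)<..<L + 1} \<Longrightarrow> (m has_real_derivative \<theta> t) (at t) \<and> \<bar>\<theta> t\<bar> \<le> 1"
    "\<And>t. t \<in> {-(L + 1)<..<L + 1} \<Longrightarrow> m t \<le> max \<bar>t\<bar> \<delta>"
    "\<And>t. t \<in> {-(L + 1)<..<L + 1} \<Longrightarrow> \<delta> \<le> \<bar>t\<bar> \<Longrightarrow> m t = \<bar>t\<bar>"
    using smooth_abs_exists[of \<delta> "L + 1"] \<delta> L by auto
  \<comment> \<open>The tent is 1 + L / 2 - |r - L / 2|; the absolute value is replaced by its
    smoothing.\<close>
  define k where "k r = 1 + L / 2 - m (r - L / 2)" for r
  have dk: "(k has_real_derivative - \<theta> (r - L / 2)) (at r)" "\<bar>\<theta> (r - L / 2)\<bar> \<le> 1" if "r \<in> {-1/2<..<L + 1/2}" for r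
  proof -
    have r: "r - L / 2 \<in> {-(L + 1)<..<L + 1}" using that L by auto
    then show "\<bar>\<theta> (r - L / 2)\<bar> \<le> 1" using m(2) by blast
    have "((\<lambda>r. m (r - L / 2)) has_real_derivative \<theta> (r - L / 2) * 1) (at r)"
      by (rule DERIV_chain2) (use m(2)[OF r] in \<open>auto intro!: derivative_eq_intros\<close>)
    then show "(k has_real_derivative - \<theta> (r - L / 2)) (at r)"
      unfolding k_def by (auto intro!: derivative_eq_intros)
  qed
  have smooth_shift: "Ck_on j (\<lambda>r. f (r - L / 2)) {-1/2<..<L + 1/2}" if "Ck_on j f {-(L + 1)<..<L + 1}" for f :: "real \<Rightarrow> real" and j
    using that
  proof (induction j arbitrary: f)
    case 0
    have "(\<lambda>r. r - L / 2) ` {-1/2<..<L + 1/2} \<subseteq> {-(L + 1)<..<L + 1}" using L by auto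
    then show ?case
      using 0 continuous_on_compose2[of "{-(L + 1)<..<L + 1}" f "{-1/2<..<L + 1/2}" "\<lambda>r. r - L / 2"]
      by (simp add: continuous_on_diff continuous_on_id continuous_on_const)
  next
    case (Suc j)
    show ?case
    proof (rule Ck_on_SucI_real)
      show "((\<lambda>r. f (r - L / 2)) has_real_derivative deriv f (r - L / 2)) (at r)" if "r \<in> {-1/2<..<L + 1/2}" for r
      proof -
        have "(f has_real_derivative deriv f (r - L / 2)) (at (r - L / 2))"
          by (rule Ck_on_Suc_real(2)[OF _ Suc.prems]) (use that L in auto)
        moreover have "((\<lambda>r. r - L / 2) has_real_derivative 1) (at r)"
          by (auto intro!: derivative_eq_intros)
        ultimately show ?thesis
          using DERIV_chain2[where f = f and g = "\<lambda>r. r - L / 2"] by fastforce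
      qed
      show "Ck_on j (\<lambda>r. deriv f (r - L / 2)) {-1/2<..<L + 1/2}"
        by (rule Suc.IH, rule Ck_on_Suc_real(1)[OF _ Suc.prems]) simp
    qed simp
  qed
  have "Ck_on j (\<lambda>r. (1 + L / 2) + (-1) * m (r - L / 2)) {-1/2<..<L + 1/2}" for j
    by (intro Ck_on_add Ck_on_mult Ck_on_const smooth_shift m) auto
  then have "Ck_on j k {-1/2<..<L + 1/2}" for j
    by (simp add: k_def[abs_def])
  then have smooth: "smooth_on k {0..L}"
    unfolding smooth_on_def by (intro exI[of _ "{-1/2<..<L + 1/2}"] exI[of _ k]) auto
  have hk: "h r \<le> k r" if r: "r \<in> {0..L}" for r
  proof -
    have t: "r - L / 2 \<in> {-(L + 1)<..<L + 1}" using r L by auto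
    show ?thesis
    proof (cases "\<delta> \<le> \<bar>r - L / 2\<bar>")
      case True
      then show ?thesis using m(4)[OF t] tent[OF r] by (auto simp: k_def abs_if split: if_splits)
    next
      case False
      then have "m (r - L / 2) \<le> \<delta>" using m(3)[OF t] by auto
      moreover have "h r \<le> h (L / 2) + \<bar>r - L / 2\<bar>"
        using minus[of "L / 2" r] plus[of r "L / 2"] r L by (cases "L / 2 \<le> r") auto
      ultimately show ?thesis using \<delta>(3) False by (simp add: k_def)
    qed
  qed
  show ?thesis
  proof (rule that[of k "L / 2"])
    show "k 0 = 1" using m(4)[of "- L / 2"] \<delta> L by (simp add: k_def)
    show "k L = 1" using m(4)[of "L / 2"] \<delta> L by (simp add: k_def)
    show "\<exists>d. (k has_real_derivative d) (at r within {0..L}) \<and> \<bar>d\<bar> \<le> 1" if "r \<in> {0..L}" for r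
      using dk[of r] that by (intro exI[of _ "- \<theta> (r - L / 2)"]) (auto intro: has_field_derivative_at_within)
    show "h (L / 2) < k (L / 2)" using m(3)[of 0] \<delta> L by (simp add: k_def)
  qed (use smooth hk L in auto)
qed

section \<open>Steklov eigenfunctions of a warped product\<close>

definition dir_deriv :: "('a::real_normed_vector \<Rightarrow> real) \<Rightarrow> 'a \<Rightarrow> 'a \<Rightarrow> real" where
  "dir_deriv F v q = frechet_derivative F (at q) v"

text \<open>The expression from \<open>laplace_beltrami_warped\<close>, to be applied to a smooth
  extension of a function on the cylinder, so that all derivatives are ordinary ones.\<close>

definition warped_lap :: "(real \<Rightarrow> real) \<Rightarrow> (real \<times> (real^'n::finite) \<Rightarrow> real) \<Rightarrow> real \<Rightarrow> real^'n \<Rightarrow> real" where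
  "warped_lap h F r p = dir_deriv (dir_deriv F (1, 0)) (1, 0) (r, p)
    + (real CARD('n) - 1) * (deriv h r / h r) * dir_deriv F (1, 0) (r, p) + sph_lap (\<lambda>p. F (r, p)) p / (h r)\<^sup>2"

text \<open>Since \<open>h 0 = h L = 1\<close>, the metric at the boundary is the product metric, so
  the outward unit normal is the radial unit vector with a sign. In that direction a derivative
  within the cylinder agrees with the ambient one, as is seen along a meridian.\<close>

lemma has_normal_derivative_iff:
  fixes F f :: "real \<times> (real^'n::finite) \<Rightarrow> real" and g :: "'n metric_tensor"
  assumes g: "induced_by L h g" and L: "0 < L" and h: "h 0 = 1" "h L = 1"
    and F: "(F has_derivative D) (at (r, p))" and f: "\<And>q. q \<in> cyl L \<Longrightarrow> f q = F q"
    and r: "r = 0 \<or> r = L" and p: "norm p = 1"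
  shows "has_normal_derivative L g f c (r, p) \<longleftrightarrow> (if r = 0 then - D (1, 0) else D (1, 0)) = c"
proof
  have mem: "(r, p) \<in> cyl L" using r p L by (auto simp: cyl_def)
  have hr: "h r = 1" using r h by auto
  have gv: "g (r, p) (\<rho>, v) (\<rho>', v') = \<rho> * \<rho>' + v \<bullet> v'" if "v \<bullet> p = 0" "v' \<bullet> p = 0" for \<rho> \<rho>' v v'
    using g mem that hr unfolding induced_by_def cyl_tangent_def by fastforce
  have lin: "linear D" by (rule has_derivative_linear[OF F])
  have neg: "D (- 1, 0) = - D (1, 0)"
    using linear_scale[OF lin, of "- 1" "(1, 0)"] by simp
  {
    assume "has_normal_derivative L g f c (r, p)"
    then obtain \<nu> D' where \<nu>: "outward_unit_normal L g (r, p) \<nu>" and D': "(f has_derivative D') (at (r, p) within cyl L)" and c: "D' \<nu> = c"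
      by (auto simp: has_normal_derivative_def)
    obtain \<rho> v where \<nu>eq: "\<nu> = (\<rho>, v)" by (cases \<nu>)
    have vp: "v \<bullet> p = 0" using \<nu> by (simp add: outward_unit_normal_def cyl_tangent_def \<nu>eq)
    \<comment> \<open>Orthogonality is tested against the spherical part of the normal
      itself.\<close>
    have "(0, v) \<in> boundary_tangent (r, p)" using vp by (simp add: boundary_tangent_def)
    then have "g (r, p) (\<rho>, v) (0, v) = 0"
      using \<nu> unfolding outward_unit_normal_def \<nu>eq by blast
    then have v: "v = 0" using gv[OF vp vp] by simp
    have "g (r, p) (\<rho>, v) (\<rho>, v) = 1" using \<nu> unfolding outward_unit_normal_def \<nu>eq by blast
    then have "\<rho> * \<rho> = 1" using gv[OF vp vp] v by simp
    moreover have "r = 0 \<Longrightarrow> \<rho> < 0" "r = L \<Longrightarrow> 0 < \<rho>"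
      using \<nu> unfolding outward_unit_normal_def \<nu>eq by auto
    ultimately have \<rho>: "\<rho> = (if r = 0 then -1 else 1)"
      using r by (auto simp: square_eq_1_iff)
    have "D' (1, 0) = D (1, 0)"
    proof -
      have g1: "((\<lambda>t. (t, p)) has_derivative (\<lambda>t. (t, 0))) (at r within {0..L})"
        by (auto intro!: derivative_eq_intros)
      have "(\<lambda>t. (t, p)) ` {0..L} \<subseteq> cyl L" using p by (auto simp: cyl_def)
      then have "((\<lambda>t. f (t, p)) has_derivative (\<lambda>t. D' (t, 0))) (at r within {0..L})"
        using diff_chain_within[OF g1 has_derivative_subset[OF D']] by (simp add: o_def)
      moreover have "((\<lambda>t. f (t, p)) has_derivative (\<lambda>t. D (t, 0))) (at r within {0..L})"
      proof (rule has_derivative_transform)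
        show "r \<in> {0..L}" using r L by auto
        show "f (t, p) = F (t, p)" if "t \<in> {0..L}" for t
          by (rule f) (use that p in \<open>simp add: cyl_def\<close>)
        show "((\<lambda>t. F (t, p)) has_derivative (\<lambda>t. D (t, 0))) (at r within {0..L})"
          using diff_chain_within[OF g1 has_derivative_at_withinI[OF F]] by (simp add: o_def)
      qed
      ultimately have a: "((\<lambda>t. f (t, p)) has_derivative (\<lambda>t. D' (t, 0))) (at r within {0..L})"
        "((\<lambda>t. f (t, p)) has_derivative (\<lambda>t. D (t, 0))) (at r within {0..L})" .
      have *: "(\<lambda>t. t *\<^sub>R E (1, 0)) = (\<lambda>t. E (t, 0))" if "linear E" for E :: "real \<times> (real^'n) \<Rightarrow> real"
      proof
        show "t *\<^sub>R E (1, 0) = E (t, 0)" for t using linear_scale[OF that, of t "(1, 0)"] by simp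
      qed
      have "((\<lambda>t. f (t, p)) has_vector_derivative D' (1, 0)) (at r within {0..L})"
        unfolding has_vector_derivative_def *[OF has_derivative_linear[OF D']] by (rule a)
      moreover have "((\<lambda>t. f (t, p)) has_vector_derivative D (1, 0)) (at r within {0..L})"
        unfolding has_vector_derivative_def *[OF lin] by (rule a)
      ultimately show ?thesis
        using vector_derivative_unique_within_closed_interval[OF L, of r] r L by auto
    qed
    moreover have "D' (- 1, 0) = - D' (1, 0)"
      using linear_scale[OF has_derivative_linear[OF D'], of "- 1" "(1, 0)"] by simp
    ultimately show "(if r = 0 then - D (1, 0) else D (1, 0)) = c"
      using c \<nu>eq v \<rho> by auto
  }
  assume c: "(if r = 0 then - D (1, 0) else D (1, 0)) = c"
  define \<nu> :: "real \<times> (real^'n)" where "\<nu> = (if r = 0 then -1 else 1, 0)"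
  have "g (r, p) \<nu> w = 0" if "w \<in> boundary_tangent (r, p)" for w
    using gv[of 0 "snd w" "fst \<nu>" "fst w"] that by (auto simp: \<nu>_def boundary_tangent_def)
  moreover have "g (r, p) \<nu> \<nu> = 1"
    using gv[of 0 0 "fst \<nu>" "fst \<nu>"] by (auto simp: \<nu>_def)
  ultimately have "outward_unit_normal L g (r, p) \<nu>"
    using L r by (auto simp: outward_unit_normal_def \<nu>_def cyl_tangent_def)
  moreover have "(f has_derivative D) (at (r, p) within cyl L)"
    by (rule has_derivative_transform[OF mem _ has_derivative_at_withinI[OF F]]) (rule f)
  moreover have "D \<nu> = c" using c neg by (auto simp: \<nu>_def)
  ultimately show "has_normal_derivative L g f c (r, p)"
    unfolding has_normal_derivative_def by blast
qed

section \<open>Smooth extensions, their spherical slices and the eigenspace conditions\<close>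

lemma Ck_on_dir_deriv:
  assumes "\<And>k. Ck_on k F U"
  shows "Ck_on k (dir_deriv F v) U" and "q \<in> U \<Longrightarrow> (F has_derivative (\<lambda>v. dir_deriv F v q)) (at q)"
proof -
  have *: "Ck_on (Suc k) F U" for k by (rule assms)
  then show "Ck_on k (dir_deriv F v) U" by (simp add: dir_deriv_def[abs_def])
  show "q \<in> U \<Longrightarrow> (F has_derivative (\<lambda>v. dir_deriv F v q)) (at q)"
    using *[of 0] by (auto simp: dir_deriv_def frechet_derivative_works)
qed

lemma rot_derivative_slice:
  fixes F :: "real \<times> (real^'n::finite) \<Rightarrow> real"
  assumes "(F has_derivative D) (at (r, p))"
  shows "((\<lambda>t. F (r, rot i j t p)) has_real_derivative p $ i * D (0, axis j 1) + (- 1) * (p $ j * D (0, axis i 1))) (at 0)"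
proof -
  have lin: "linear D" by (rule has_derivative_linear[OF assms])
  have "((\<lambda>t. (r, rot i j t p)) has_derivative (\<lambda>t. (0, t *\<^sub>R rot_gen i j p))) (at 0)"
    using has_vector_derivative_rot[of i j p] unfolding has_vector_derivative_def
    by (intro has_derivative_Pair has_derivative_const)
  from diff_chain_at[OF this, of F D] assms
  have "((\<lambda>t. F (r, rot i j t p)) has_derivative (\<lambda>t. D (0, t *\<^sub>R rot_gen i j p))) (at 0)"
    by (simp add: o_def)
  moreover have "D (0, t *\<^sub>R rot_gen i j p) = t * (p $ i * D (0, axis j 1) + (- 1) * (p $ j * D (0, axis i 1)))" for t
  proof -
    have "(0, t *\<^sub>R rot_gen i j p) = (t * p $ i) *\<^sub>R (0::real, axis j 1) + (- t * p $ j) *\<^sub>R (0, axis i 1)"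
      by (simp add: rot_gen_def algebra_simps)
    then have "D (0, t *\<^sub>R rot_gen i j p) = (t * p $ i) * D (0, axis j 1) + (- t * p $ j) * D (0, axis i 1)"
      by (simp only: linear_add[OF lin] linear_scale[OF lin] real_scaleR_def)
    then show ?thesis by (simp add: algebra_simps)
  qed
  ultimately show ?thesis
    by (simp add: has_field_derivative_def mult_commute_abs)
qed

text \<open>A rotational derivative of a slice is a combination of slices of directional derivatives
  with coordinate coefficients, so the first-order argument applies to it again.\<close>

lemma rot_C2_slice:
  fixes F :: "real \<times> (real^'n::finite) \<Rightarrow> real"
  assumes F: "\<And>k. Ck_on k F U" and U: "{r} \<times> sphere 0 1 \<subseteq> U"
  shows "rot_C2 (\<lambda>p. F (r, p))"
proof -
  define M where "M G i j p = p $ i * dir_deriv G (0, axis j 1) (r, p) + (- 1) * (p $ j * dir_deriv G (0, axis i 1) (r, p))"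
    for G :: "real \<times> (real^'n) \<Rightarrow> real" and i j p
  have c: "continuous_on (sphere 0 1) (\<lambda>p. G (r, p))" if "\<And>k. Ck_on k G U" for G :: "real \<times> (real^'n) \<Rightarrow> real"
    by (rule continuous_on_compose2[of U G "sphere 0 1" "\<lambda>p. (r, p)"]) (use that[of 0] U in \<open>auto intro!: continuous_intros\<close>)
  have step: "rot_diff (\<lambda>p. G (r, p)) \<and> (\<forall>p i j. norm p = 1 \<longrightarrow> Lop i j (\<lambda>p. G (r, p)) p = M G i j p)"
    if G: "\<And>k. Ck_on k G U" for G :: "real \<times> (real^'n) \<Rightarrow> real"
  proof -
    have d: "((\<lambda>t. G (r, rot i j t p)) has_real_derivative M G i j p) (at 0)" if "norm p = 1" for i j p
      unfolding M_def by (rule rot_derivative_slice[OF Ck_on_dir_deriv(2)[OF G]]) (use U that in auto)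
    have "continuous_on (sphere 0 1) (M G i j)" for i j
      unfolding M_def by (intro continuous_intros c Ck_on_dir_deriv(1)[OF G])
    then show ?thesis using rot_diffI[OF c[OF G] _ d] LopI[OF d] by blast
  qed
  have L: "M F i j p = Lop i j (\<lambda>p. F (r, p)) p" if "norm p = 1" for i j p
    using step[OF F] that by auto
  have "rot_diff (M F i j)" for i j
  proof -
    have a: "rot_diff (\<lambda>p. dir_deriv F v (r, p))" for v
      using step[of "dir_deriv F v"] Ck_on_dir_deriv(1)[OF F] by blast
    have "rot_diff (\<lambda>p. 1 * (p $ i * dir_deriv F (0, axis j 1) (r, p)) + (- 1) * (p $ j * dir_deriv F (0, axis i 1) (r, p)))"
      by (intro rot_diff_add(1) rot_diff_mult rot_diff_coord a)
    then show ?thesis by (simp add: M_def[abs_def])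
  qed
  then have "rot_diff (Lop i j (\<lambda>p. F (r, p)))" for i j
    by (rule rot_diff_cong(1)[OF _ L])
  then show ?thesis
    unfolding rot_C2_def using step[OF F] by blast
qed

text \<open>Members of the eigenspace vanish off the cylinder and in general are not differentiable
  across its boundary, so derivatives are taken of the extension \<open>F\<close>.\<close>

definition smooth_rep :: "real \<Rightarrow> (real \<times> (real^'n::finite) \<Rightarrow> real) \<Rightarrow> (real \<times> (real^'n)) set \<Rightarrow>
    (real \<times> (real^'n) \<Rightarrow> real) \<Rightarrow> bool" where
  "smooth_rep L f U F \<longleftrightarrow> open U \<and> cyl L \<subseteq> U \<and> (\<forall>k. Ck_on k F U) \<and> (\<forall>q\<in>cyl L. f q = F q)"

lemma cyl_interior_subset: "cyl_interior L \<subseteq> cyl L"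
  by (auto simp: cyl_interior_def cyl_def)

lemma steklov_eigenspace_iff:
  fixes f :: "real \<times> (real^'n::finite) \<Rightarrow> real"
  assumes g: "induced_by L h g" and L: "0 < L" and h: "h 0 = 1" "h L = 1"
    and dh: "\<And>r. \<lbrakk>0 < r; r < L\<rbrakk> \<Longrightarrow> (h has_real_derivative deriv h r) (at r)" "\<And>r. \<lbrakk>0 < r; r < L\<rbrakk> \<Longrightarrow> 0 < h r"
    and rep: "smooth_rep L f U F"
  shows "f \<in> steklov_eigenspace L g \<tau> \<longleftrightarrow> (\<forall>q. q \<notin> cyl L \<longrightarrow> f q = 0) \<and>
     (\<forall>r p. 0 < r \<longrightarrow> r < L \<longrightarrow> norm p = 1 \<longrightarrow> warped_lap h F r p = 0) \<and>
     (\<forall>p. norm p = 1 \<longrightarrow> - dir_deriv F (1, 0) (0, p) = \<tau> * F (0, p) \<and> dir_deriv F (1, 0) (L, p) = \<tau> * F (L, p))"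
proof -
  have U: "open U" "cyl L \<subseteq> U" and F: "\<And>k. Ck_on k F U" and f: "\<And>q. q \<in> cyl L \<Longrightarrow> f q = F q"
    using rep by (auto simp: smooth_rep_def)
  have sm: "smooth_on f (cyl L)"
    unfolding smooth_on_def using U F f by (intro exI[of _ U] exI[of _ F]) auto
  have lap: "laplace_beltrami g f (r, p) = warped_lap h F r p" if "0 < r" "r < L" "norm p = 1" for r p
    unfolding warped_lap_def dir_deriv_def[abs_def]
    by (rule laplace_beltrami_warped[OF g dh U(1) _ F _ that]) (use U f cyl_interior_subset in blast)+
  have nd: "has_normal_derivative L g f c (r, p) \<longleftrightarrow> (if r = 0 then - dir_deriv F (1, 0) (r, p) else dir_deriv F (1, 0) (r, p)) = c"
    if "r = 0 \<or> r = L" "norm p = 1" for r p c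
    by (rule has_normal_derivative_iff[OF g L h Ck_on_dir_deriv(2)[OF F] f that]) (use U that L in \<open>auto simp: cyl_def\<close>)
  have "(\<forall>q\<in>cyl_interior L. laplace_beltrami g f q = 0) \<longleftrightarrow> (\<forall>r p. 0 < r \<longrightarrow> r < L \<longrightarrow> norm p = 1 \<longrightarrow> warped_lap h F r p = 0)"
    using lap by (auto simp: cyl_interior_def)
  moreover have "(\<forall>q\<in>cyl_boundary L. has_normal_derivative L g f (\<tau> * f q) q) \<longleftrightarrow>
     (\<forall>p. norm p = 1 \<longrightarrow> - dir_deriv F (1, 0) (0, p) = \<tau> * F (0, p) \<and> dir_deriv F (1, 0) (L, p) = \<tau> * F (L, p))"
  proof -
    have m: "(0, p) \<in> cyl L" "(L, p) \<in> cyl L" if "norm p = 1" for p :: "real^'n" using that L by (auto simp: cyl_def)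
    have "(\<forall>q\<in>cyl_boundary L. has_normal_derivative L g f (\<tau> * f q) q) \<longleftrightarrow>
      (\<forall>p. norm p = 1 \<longrightarrow> has_normal_derivative L g f (\<tau> * f (0, p)) (0, p) \<and> has_normal_derivative L g f (\<tau> * f (L, p)) (L, p))"
      by (auto simp: cyl_boundary_def)
    also have "\<dots> \<longleftrightarrow> (\<forall>p. norm p = 1 \<longrightarrow> - dir_deriv F (1, 0) (0, p) = \<tau> * F (0, p) \<and> dir_deriv F (1, 0) (L, p) = \<tau> * F (L, p))"
      using L m f nd[of 0] nd[of L] by auto
    finally show ?thesis .
  qed
  ultimately show ?thesis
    unfolding steklov_eigenspace_def using sm by simp
qed

lemma dir_deriv_lincomb:
  assumes "F differentiable (at q)" "G differentiable (at q)"
  shows "dir_deriv (\<lambda>q. a * F q + b * G q) v q = a * dir_deriv F v q + b * dir_deriv G v q"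
proof -
  have "((\<lambda>q. a * F q + b * G q) has_derivative (\<lambda>v. a * frechet_derivative F (at q) v + b * frechet_derivative G (at q) v)) (at q)"
    using assms unfolding frechet_derivative_works by (intro has_derivative_add has_derivative_mult_right)
  then show ?thesis unfolding dir_deriv_def by (metis frechet_derivative_at)
qed

lemma dir_deriv_cong_open:
  assumes "open S" "q \<in> S" "\<And>y. y \<in> S \<Longrightarrow> F y = G y"
  shows "dir_deriv F v q = dir_deriv G v q"
  unfolding dir_deriv_def by (simp add: frechet_derivative_cong_open[OF assms])

lemma Ck_on_differentiable: "(\<And>k. Ck_on k F U) \<Longrightarrow> q \<in> U \<Longrightarrow> F differentiable (at q)"
  by (metis Ck_on.simps(2))

lemma smooth_rep_lincomb:
  fixes f1 f2 :: "real \<times> (real^'n::finite) \<Rightarrow> real"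
  assumes "smooth_rep L f1 U1 F1" "smooth_rep L f2 U2 F2"
  shows "smooth_rep L (\<lambda>q. a * f1 q + b * f2 q) (U1 \<inter> U2) (\<lambda>q. a * F1 q + b * F2 q)"
  using assms unfolding smooth_rep_def
  by (auto intro!: Ck_on_add Ck_on_mult Ck_on_const intro: Ck_on_subset)

lemma warped_lap_lincomb:
  fixes f1 f2 :: "real \<times> (real^'n::finite) \<Rightarrow> real"
  assumes "smooth_rep L f1 U1 F1" "smooth_rep L f2 U2 F2" and r: "r \<in> {0..L}" and p: "norm p = 1"
  shows "warped_lap h (\<lambda>q. a * F1 q + b * F2 q) r p = a * warped_lap h F1 r p + b * warped_lap h F2 r p"
    and "dir_deriv (\<lambda>q. a * F1 q + b * F2 q) v (r, p) = a * dir_deriv F1 v (r, p) + b * dir_deriv F2 v (r, p)"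
proof -
  have U: "open U1" "open U2" "cyl L \<subseteq> U1" "cyl L \<subseteq> U2" and C: "\<And>k. Ck_on k F1 U1" "\<And>k. Ck_on k F2 U2"
    using assms by (auto simp: smooth_rep_def)
  have m: "(r, p) \<in> U1 \<inter> U2" using U r p by (auto simp: cyl_def)
  have s: "{r} \<times> sphere 0 1 \<subseteq> U1" "{r} \<times> sphere 0 1 \<subseteq> U2" using U r by (auto simp: cyl_def)
  have d: "dir_deriv (\<lambda>q. a * F1 q + b * F2 q) v q = a * dir_deriv F1 v q + b * dir_deriv F2 v q" if "q \<in> U1 \<inter> U2" for q v
    using that by (intro dir_deriv_lincomb Ck_on_differentiable[OF C(1)] Ck_on_differentiable[OF C(2)]) auto
  then show "dir_deriv (\<lambda>q. a * F1 q + b * F2 q) v (r, p) = a * dir_deriv F1 v (r, p) + b * dir_deriv F2 v (r, p)"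
    using m by blast
  have "dir_deriv (dir_deriv (\<lambda>q. a * F1 q + b * F2 q) (1, 0)) (1, 0) (r, p)
      = dir_deriv (\<lambda>q. a * dir_deriv F1 (1, 0) q + b * dir_deriv F2 (1, 0) q) (1, 0) (r, p)"
    by (rule dir_deriv_cong_open[OF _ m d]) (use U in auto)
  also have "\<dots> = a * dir_deriv (dir_deriv F1 (1, 0)) (1, 0) (r, p) + b * dir_deriv (dir_deriv F2 (1, 0)) (1, 0) (r, p)"
    using m by (intro dir_deriv_lincomb Ck_on_differentiable[OF Ck_on_dir_deriv(1)[OF C(1)]] Ck_on_differentiable[OF Ck_on_dir_deriv(1)[OF C(2)]]) auto
  finally show "warped_lap h (\<lambda>q. a * F1 q + b * F2 q) r p = a * warped_lap h F1 r p + b * warped_lap h F2 r p"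
    unfolding warped_lap_def d[OF m] rot_C2_add(2)[OF rot_C2_slice[OF C(1) s(1)] rot_C2_slice[OF C(2) s(2)] p]
    by (simp add: algebra_simps add_divide_distrib)
qed

lemma dir_deriv_product:
  fixes u :: "real \<Rightarrow> real" and y :: "real^'n::finite \<Rightarrow> real"
  assumes "(u has_real_derivative u') (at r)" "y differentiable (at p)"
  shows "dir_deriv (\<lambda>q. u (fst q) * y (snd q)) (1, 0) (r, p) = u' * y p"
proof -
  obtain D where D: "(y has_derivative D) (at p)" using assms(2) unfolding differentiable_def by blast
  have a: "((\<lambda>q. u (fst q)) has_derivative (\<lambda>v. u' * fst v)) (at (r, p))"
    using has_derivative_compose[of fst fst "(r, p)" UNIV u "(*) u'"] assms(1)
    by (simp add: has_field_derivative_def bounded_linear_imp_has_derivative bounded_linear_fst)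
  have b: "((\<lambda>q. y (snd q)) has_derivative (\<lambda>v. D (snd v))) (at (r, p))"
    using has_derivative_compose[of snd snd "(r, p)" UNIV y D] D
    by (simp add: bounded_linear_imp_has_derivative bounded_linear_snd)
  have "((\<lambda>q. u (fst q) * y (snd q)) has_derivative (\<lambda>v. u r * D (snd v) + u' * fst v * y p)) (at (r, p))"
    using has_derivative_mult[OF a b] by simp
  from frechet_derivative_eqI[OF this]
  have "dir_deriv (\<lambda>q. u (fst q) * y (snd q)) (1, 0) (r, p) = u r * D 0 + u' * y p"
    by (simp add: dir_deriv_def)
  then show ?thesis using linear_0[OF has_derivative_linear[OF D]] by simp
qed

text \<open>Here \<open>h\<close> is a smooth positive extension of the profile to
  \<open>{A<..<B}\<close>. The bound on \<open>CARD('n)\<close> keeps the exponent n - 3 from being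
  truncated, which gives \<open>P = Q * h\<^sup>2\<close>; and \<open>regular\<close> continues the
  radial solutions beyond both ends.\<close>

locale steklov_modes =
  fixes L A B :: real and h :: "real \<Rightarrow> real" and g :: "'n::finite metric_tensor"
    and Y :: "nat \<Rightarrow> real^'n \<Rightarrow> real" and lam :: "nat \<Rightarrow> real"
    and \<mu> :: "nat \<Rightarrow> bool \<Rightarrow> real" and U V :: "nat \<Rightarrow> bool \<Rightarrow> real \<Rightarrow> real"
    and P Q :: "real \<Rightarrow> real"
  assumes card: "3 \<le> CARD('n)" and AB: "A < 0" "0 < L" "L < B"
    and smooth_h: "\<And>k. Ck_on k h {A<..<B}" and h_pos: "\<And>r. r \<in> {A<..<B} \<Longrightarrow> 0 < h r"
    and h_ends: "h 0 = 1" "h L = 1" and g: "induced_by L h g"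
    and harmonic: "harmonic_basis Y lam"
    and P_def: "P = (\<lambda>r. h r ^ (CARD('n) - 1))" and Q_def: "Q = (\<lambda>r. h r ^ (CARD('n) - 3))"
    and eigen: "\<And>k. sl_eigen L P Q (lam k) (\<mu> k) (U k) (V k)"
    and regular: "\<And>k. \<exists>a b. a < 0 \<and> L < b \<and> (\<forall>e j. Ck_on j (U k e) {a<..<b}) \<and>
      (\<forall>e. \<forall>r\<in>{a<..<b}. (U k e has_real_derivative V k e r / P r) (at r)
          \<and> (V k e has_real_derivative lam k * Q r * U k e r) (at r))"
begin

section \<open>Separated modes and the eigenspaces they span\<close>

lemma h_deriv: "r \<in> {A<..<B} \<Longrightarrow> (h has_real_derivative deriv h r) (at r)"
  using Ck_on_Suc_real(2)[of "{A<..<B}" 0 h r] smooth_h[of "Suc 0"] by simp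

lemma interval: "r \<in> {0..L} \<Longrightarrow> r \<in> {A<..<B}"
  using AB by auto

lemma PQ:
  assumes "r \<in> {A<..<B}"
  shows "P r = Q r * (h r)\<^sup>2" "0 < P r" "0 < Q r"
proof -
  have "CARD('n) - 1 = (CARD('n) - 3) + 2" using card by simp
  then show "P r = Q r * (h r)\<^sup>2" by (simp only: P_def Q_def power_add)
qed (use h_pos[OF assms] in \<open>auto simp: P_def Q_def\<close>)

lemma P_deriv: "r \<in> {A<..<B} \<Longrightarrow> (P has_real_derivative (real CARD('n) - 1) * (deriv h r / h r) * P r) (at r)"
proof -
  assume r: "r \<in> {A<..<B}"
  have "CARD('n) - 1 = Suc (CARD('n) - 2)" using card by simp
  then have w: "P r = h r * h r ^ (CARD('n) - 1 - Suc 0)"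
    unfolding P_def by (metis One_nat_def diff_Suc_1 power_Suc)
  have "real (CARD('n) - 1) = real CARD('n) - 1" using card by (simp add: of_nat_diff)
  moreover have "(real CARD('n) - 1) * (deriv h r * z) = (real CARD('n) - 1) * (deriv h r / h r) * (h r * z)" for z
    using h_pos[OF r] by simp
  ultimately have "real (CARD('n) - 1) * (deriv h r * h r ^ (CARD('n) - 1 - Suc 0)) = (real CARD('n) - 1) * (deriv h r / h r) * P r"
    unfolding w by simp
  then show ?thesis using DERIV_power[OF h_deriv[OF r], of "CARD('n) - 1"] by (simp add: P_def)
qed

sublocale sl_coeffs L P Q
proof
  have "{0..L} \<subseteq> {A<..<B}" using AB by auto
  then have c: "continuous_on {0..L} h"
    using continuous_on_subset smooth_h[of 0] by auto
  show "continuous_on {0..L} P" "continuous_on {0..L} Q" unfolding P_def Q_def by (intro continuous_intros c)+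
  show "0 < L" by (rule AB)
  show "0 < P r" "0 < Q r" if "r \<in> {0..L}" for r
    using PQ[OF interval[OF that]] by auto
qed

lemma Y_facts: "real_polynomial_function (Y k)" "rot_C2 (Y k)" "norm p = 1 \<Longrightarrow> sph_lap (Y k) p = - lam k * Y k p"
    "j \<noteq> k \<Longrightarrow> sph_int (\<lambda>p. Y j p * Y k p) = 0" "0 < sph_int (\<lambda>p. Y k p * Y k p)" "lam 0 = 0" "0 < k \<Longrightarrow> 0 < lam k"
    "filterlim lam at_top sequentially"
  using harmonic unfolding harmonic_basis_def by auto

lemma Y_complete: "continuous_on (sphere 0 1) \<phi> \<Longrightarrow> (\<And>k. sph_int (\<lambda>p. \<phi> p * Y k p) = 0) \<Longrightarrow> norm p = 1 \<Longrightarrow> \<phi> p = 0"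
  using harmonic unfolding harmonic_basis_def by blast

lemma Y_continuous: "continuous_on (sphere 0 1) (Y k)"
  by (rule rot_C2_continuous[OF Y_facts(2)])

lemma lam_nonneg: "0 \<le> lam k"
  using Y_facts(6) Y_facts(7)[of k] by (cases "k = 0") auto

lemma UV: "sl_sol L P Q (lam k) (U k e) (V k e)" "- V k e 0 = \<mu> k e * U k e 0" "V k e L = \<mu> k e * U k e L"
  "U k e 0 * U k d 0 + U k e L * U k d L = (if e = d then 1 else 0)"
  using eigen[of k] unfolding sl_eigen_def by auto

abbreviation "val i \<equiv> \<mu> (fst i) (snd i)"

text \<open>An eigenvalue at most t bounds \<open>lam k\<close>, which admits only finitely many
  \<open>k\<close>, with two modes each.\<close>

lemma finite_sublevel: "finite {i. val i \<le> t}"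
proof -
  obtain \<Lambda> where \<Lambda>: "\<And>lam \<mu> U V e. \<Lambda> \<le> lam \<Longrightarrow> sl_eigen L P Q lam \<mu> U V \<Longrightarrow> t + 1 \<le> \<mu> e"
    using sl_eigen_lower_bound[of "t + 1"] by blast
  have "{i. val i \<le> t} \<subseteq> {k. lam k \<le> \<Lambda>} \<times> UNIV"
  proof
    fix i assume i: "i \<in> {i. val i \<le> t}"
    have "lam (fst i) \<le> \<Lambda>"
    proof (rule ccontr)
      assume "\<not> ?thesis"
      then have "t + 1 \<le> val i" by (intro \<Lambda>[OF _ eigen]) auto
      then show False using i by simp
    qed
    then show "i \<in> {k. lam k \<le> \<Lambda>} \<times> UNIV" by (cases i) auto
  qed
  then show ?thesis
    by (rule finite_subset) (intro finite_cartesian_product finite_sublevel_if_at_top Y_facts finite)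
qed

definition mode_fn :: "nat \<times> bool \<Rightarrow> real \<times> (real^'n) \<Rightarrow> real" where
  "mode_fn i q = (if q \<in> cyl L then U (fst i) (snd i) (fst q) * Y (fst i) (snd q) else 0)"

lemma eigenspace_iff:
  assumes "smooth_rep L f W F"
  shows "f \<in> steklov_eigenspace L g \<tau> \<longleftrightarrow> (\<forall>q. q \<notin> cyl L \<longrightarrow> f q = 0) \<and>
     (\<forall>r p. 0 < r \<longrightarrow> r < L \<longrightarrow> norm p = 1 \<longrightarrow> warped_lap h F r p = 0) \<and>
     (\<forall>p. norm p = 1 \<longrightarrow> - dir_deriv F (1, 0) (0, p) = \<tau> * F (0, p) \<and> dir_deriv F (1, 0) (L, p) = \<tau> * F (L, p))"
  by (rule steklov_eigenspace_iff[OF g AB(2) h_ends h_deriv h_pos assms]) (use AB in auto)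

lemma eigenspaceE:
  assumes "f \<in> steklov_eigenspace L g \<tau>"
  obtains W F where "smooth_rep L f W F"
  using assms unfolding steklov_eigenspace_def smooth_on_def smooth_rep_def by (auto, metis)

lemma eigenspace_lincomb:
  assumes "f1 \<in> steklov_eigenspace L g \<tau>" "f2 \<in> steklov_eigenspace L g \<tau>"
  shows "(\<lambda>q. a * f1 q + b * f2 q) \<in> steklov_eigenspace L g \<tau>"
proof -
  obtain W1 F1 where r1: "smooth_rep L f1 W1 F1" using eigenspaceE[OF assms(1)] .
  obtain W2 F2 where r2: "smooth_rep L f2 W2 F2" using eigenspaceE[OF assms(2)] .
  note wl = warped_lap_lincomb[OF r1 r2]
  note e1 = assms(1)[unfolded eigenspace_iff[OF r1]] and e2 = assms(2)[unfolded eigenspace_iff[OF r2]]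
  show ?thesis
    unfolding eigenspace_iff[OF smooth_rep_lincomb[OF r1 r2]]
  proof (intro conjI allI impI)
    show "a * f1 q + b * f2 q = 0" if "q \<notin> cyl L" for q
    proof -
      have "f1 q = 0" "f2 q = 0" using e1 e2 that by blast+
      then show ?thesis by simp
    qed
    show "warped_lap h (\<lambda>q. a * F1 q + b * F2 q) r p = 0" if "0 < r" "r < L" "norm p = 1" for r p
      using wl(1)[of r p h a b] e1 e2 that by simp
    show "- dir_deriv (\<lambda>q. a * F1 q + b * F2 q) (1, 0) (0, p) = \<tau> * (a * F1 (0, p) + b * F2 (0, p))" if "norm p = 1" for p
    proof -
      have "dir_deriv F1 (1, 0) (0, p) = - \<tau> * F1 (0, p)" "dir_deriv F2 (1, 0) (0, p) = - \<tau> * F2 (0, p)"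
        using e1 e2 that by (metis minus_minus mult_minus_left)+
      then show ?thesis using wl(2)[of 0 p a b "(1, 0)"] that AB by (simp add: algebra_simps)
    qed
    show "dir_deriv (\<lambda>q. a * F1 q + b * F2 q) (1, 0) (L, p) = \<tau> * (a * F1 (L, p) + b * F2 (L, p))" if "norm p = 1" for p
    proof -
      have "dir_deriv F1 (1, 0) (L, p) = \<tau> * F1 (L, p)" "dir_deriv F2 (1, 0) (L, p) = \<tau> * F2 (L, p)"
        using e1 e2 that by blast+
      then show ?thesis using wl(2)[of L p a b "(1, 0)"] that AB by (simp add: algebra_simps)
    qed
  qed
qed

lemma zero_in_eigenspace: "(\<lambda>q. 0) \<in> steklov_eigenspace L g \<tau>"
proof -
  have r: "smooth_rep L (\<lambda>q. 0) UNIV (\<lambda>q :: real \<times> (real^'n). 0)"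
    by (auto simp: smooth_rep_def intro: Ck_on_const)
  have z: "dir_deriv (\<lambda>q :: real \<times> (real^'n). 0) v = (\<lambda>q. 0)" for v
    by (simp add: dir_deriv_def fun_eq_iff)
  show ?thesis unfolding eigenspace_iff[OF r] by (simp add: z warped_lap_def sph_lap_const)
qed

lemma mode_fn_in_eigenspace: "mode_fn i \<in> steklov_eigenspace L g (val i)"
proof -
  obtain k e where i: "i = (k, e)" by (cases i)
  obtain a b where ab: "a < 0" "L < b" and sU: "\<And>j. Ck_on j (U k e) {a<..<b}"
    and dU: "\<And>r. r \<in> {a<..<b} \<Longrightarrow> (U k e has_real_derivative V k e r / P r) (at r)"
    and dV: "\<And>r. r \<in> {a<..<b} \<Longrightarrow> (V k e has_real_derivative lam k * Q r * U k e r) (at r)"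
    using regular[of k] by blast
  define W where "W = {max a A<..<min b B} \<times> (UNIV :: (real^'n) set)"
  define F where "F = (\<lambda>q :: real \<times> (real^'n). U k e (fst q) * Y k (snd q))"
  have oW: "open W" unfolding W_def by (intro open_Times) auto
  have cW: "cyl L \<subseteq> W" using ab AB by (auto simp: W_def cyl_def)
  have CF: "Ck_on j F W" for j
    unfolding F_def
  proof (intro Ck_on_mult oW)
    show "Ck_on j (\<lambda>q. U k e (fst q)) W"
      by (rule Ck_on_compose_linear[where V = "{a<..<b}", OF oW _ bounded_linear_fst _ sU]) (auto simp: W_def)
    show "Ck_on j (\<lambda>q. Y k (snd q)) W"
      by (rule Ck_on_compose_linear[where V = UNIV, OF oW _ bounded_linear_snd _ Ck_on_real_polynomial_function[OF _ Y_facts(1)]]) auto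
  qed
  have rep: "smooth_rep L (mode_fn i) W F"
    unfolding smooth_rep_def using oW cW CF by (auto simp: mode_fn_def F_def i)
  have Yd: "Y k differentiable (at p)" for p
    using Ck_on_differentiable[of "Y k" UNIV p] Ck_on_real_polynomial_function[OF open_UNIV Y_facts(1)] by blast
  have F1: "dir_deriv F (1, 0) q = (\<lambda>q. V k e (fst q) / P (fst q) * Y k (snd q)) q" if "q \<in> W" for q
    using dir_deriv_product[OF dU Yd, of "fst q" "snd q"] that by (simp add: F_def W_def mem_Times_iff)
  \<comment> \<open>The radial equation as
    \<open>u'' + (n - 1) (h'/h) u' = lam u / h\<^sup>2\<close>, obtained from
    \<open>v' = lam Q u\<close> and \<open>P = Q h\<^sup>2\<close>.\<close>
  have dVP: "((\<lambda>r. V k e r / P r) has_real_derivative (lam k * U k e r / (h r)\<^sup>2 - (real CARD('n) - 1) * (deriv h r / h r) * (V k e r / P r))) (at r)"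
    if r: "r \<in> {max a A<..<min b B}" for r
  proof -
    have rr: "r \<in> {a<..<b}" "r \<in> {A<..<B}" using r by auto
    have pos: "0 < P r" "0 < Q r" "P r = Q r * (h r)\<^sup>2" "0 < h r" using PQ[OF rr(2)] h_pos[OF rr(2)] by auto
    have "lam k * Q r * U k e r / P r = lam k * U k e r / (h r)\<^sup>2"
      unfolding pos(3) using pos(2,4) by simp
    moreover have "(lam k * Q r * U k e r * P r - V k e r * ((real CARD('n) - 1) * (deriv h r / h r) * P r)) / (P r * P r)
       = lam k * Q r * U k e r / P r - (real CARD('n) - 1) * (deriv h r / h r) * (V k e r / P r)"
      using pos(1) by (simp add: diff_divide_distrib)
    ultimately show ?thesis
      using DERIV_divide[OF dV[OF rr(1)] P_deriv[OF rr(2)]] pos(1) by simp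
  qed
  show ?thesis
    unfolding i fst_conv snd_conv eigenspace_iff[OF rep[unfolded i]]
  proof (intro conjI allI impI)
    show "mode_fn (k, e) q = 0" if "q \<notin> cyl L" for q using that by (simp add: mode_fn_def)
    show "warped_lap h F r p = 0" if r: "0 < r" "r < L" and p: "norm p = 1" for r p
    proof -
      have m: "(r, p) \<in> W" "r \<in> {max a A<..<min b B}" using r ab AB by (auto simp: W_def)
      have "dir_deriv (dir_deriv F (1, 0)) (1, 0) (r, p) = dir_deriv (\<lambda>q. V k e (fst q) / P (fst q) * Y k (snd q)) (1, 0) (r, p)"
        by (rule dir_deriv_cong_open[OF oW m(1) F1])
      also have "\<dots> = (lam k * U k e r / (h r)\<^sup>2 - (real CARD('n) - 1) * (deriv h r / h r) * (V k e r / P r)) * Y k p"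
        by (rule dir_deriv_product[OF dVP[OF m(2)] Yd])
      finally have Frr: "dir_deriv (dir_deriv F (1, 0)) (1, 0) (r, p) = (lam k * U k e r / (h r)\<^sup>2 - (real CARD('n) - 1) * (deriv h r / h r) * (V k e r / P r)) * Y k p" .
      \<comment> \<open>The zero summand brings the scalar multiple into the form of
        \<open>rot_C2_add\<close>.\<close>
      have "sph_lap (\<lambda>p. F (r, p)) p = sph_lap (\<lambda>p. U k e r * Y k p + 0 * Y k p) p" by (simp add: F_def)
      also have "\<dots> = U k e r * (- lam k * Y k p)"
        using rot_C2_add(2)[OF Y_facts(2) Y_facts(2) p, of "U k e r" k 0 k] Y_facts(3)[OF p] by simp
      finally show ?thesis
        unfolding warped_lap_def Frr F1[OF m(1)] by (simp add: algebra_simps)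
    qed
    show "- dir_deriv F (1, 0) (0, p) = \<mu> k e * F (0, p)" if "norm p = 1" for p
    proof -
      have "(0, p) \<in> W" using ab AB by (auto simp: W_def)
      from F1[OF this] have "dir_deriv F (1, 0) (0, p) = V k e 0 * Y k p" by (simp add: P_def h_ends)
      then have "- dir_deriv F (1, 0) (0, p) = (- V k e 0) * Y k p" by simp
      then show ?thesis unfolding UV(2) by (simp add: F_def)
    qed
    show "dir_deriv F (1, 0) (L, p) = \<mu> k e * F (L, p)" if "norm p = 1" for p
    proof -
      have "(L, p) \<in> W" using ab AB by (auto simp: W_def)
      from F1[OF this] have "dir_deriv F (1, 0) (L, p) = V k e L * Y k p" by (simp add: P_def h_ends)
      then have "dir_deriv F (1, 0) (L, p) = (V k e L) * Y k p" by simp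
      then show ?thesis unfolding UV(3) by (simp add: F_def)
    qed
  qed
qed

text \<open>Pairing with \<open>Y m\<close> isolates the modes with first index m at every radius;
  pairing their values at the two ends with the boundary vector of \<open>U m d\<close> isolates a
  single coefficient.\<close>

lemma modes_independent:
  assumes "finite J" and zero: "\<And>q. (\<Sum>i\<in>J. c i * mode_fn i q) = 0" and "j \<in> J"
  shows "c j = 0"
proof -
  obtain m d where j: "j = (m, d)" by (cases j)
  define N where "N = sph_int (\<lambda>p. Y m p * Y m p)"
  have N: "N > 0" unfolding N_def by (rule Y_facts)
  define S where "S r = (\<Sum>i\<in>J. if fst i = m then c i * U (fst i) (snd i) r else 0)" for r
  have S: "S r = 0" if r: "r \<in> {0..L}" for r
  proof -
    have "0 = sph_int (\<lambda>p. 0 * Y m p)" by (simp only: sph_int_cmult)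
    also have "\<dots> = sph_int (\<lambda>p. \<Sum>i\<in>J. (c i * U (fst i) (snd i) r) * (Y (fst i) p * Y m p))"
    proof (rule sph_int_cong)
      fix p :: "real^'n" assume p: "norm p = 1"
      have "0 = (\<Sum>i\<in>J. c i * mode_fn i (r, p)) * Y m p" by (simp add: zero)
      also have "\<dots> = (\<Sum>i\<in>J. (c i * U (fst i) (snd i) r) * (Y (fst i) p * Y m p))"
        unfolding sum_distrib_right using r p by (intro sum.cong refl) (simp add: mode_fn_def cyl_def)
      finally show "0 * Y m p = (\<Sum>i\<in>J. (c i * U (fst i) (snd i) r) * (Y (fst i) p * Y m p))" by simp
    qed
    also have "\<dots> = (\<Sum>i\<in>J. (c i * U (fst i) (snd i) r) * sph_int (\<lambda>p. Y (fst i) p * Y m p))"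
      unfolding sph_int_cmult[symmetric] by (intro sph_int_sum continuous_intros Y_continuous)
    also have "\<dots> = (\<Sum>i\<in>J. (if fst i = m then c i * U (fst i) (snd i) r else 0) * N)"
      by (intro sum.cong refl) (auto simp: N_def Y_facts(4))
    also have "\<dots> = S r * N" by (simp add: S_def sum_distrib_right)
    finally show ?thesis using N by simp
  qed
  have "0 = S 0 * U m d 0 + S L * U m d L" using S AB by simp
  also have "\<dots> = (\<Sum>i\<in>J. (if fst i = m then c i * (U (fst i) (snd i) 0 * U m d 0 + U (fst i) (snd i) L * U m d L) else 0))"
    unfolding S_def sum_distrib_right sum.distrib[symmetric] by (intro sum.cong refl) (simp add: algebra_simps)
  also have "\<dots> = (\<Sum>i\<in>J. if i = j then c j else 0)"
    by (intro sum.cong refl) (auto simp: UV(4) j prod_eq_iff)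
  also have "\<dots> = c j" using assms by simp
  finally show ?thesis by simp
qed

lemma slice_has_derivative:
  fixes F :: "real \<times> (real^'n) \<Rightarrow> real"
  assumes W: "cyl L \<subseteq> W" and F: "\<And>k. Ck_on k F W"
  shows "continuous_on {0..L} (\<lambda>r. sph_int (\<lambda>p. F (r, p) * Y k p))"
    and "0 < r \<Longrightarrow> r < L \<Longrightarrow>
      ((\<lambda>r. sph_int (\<lambda>p. F (r, p) * Y k p)) has_real_derivative sph_int (\<lambda>p. dir_deriv F (1, 0) (r, p) * Y k p)) (at r)"
proof -
  have c: "continuous_on ({0..L} \<times> sphere 0 1) (\<lambda>(r, p). G (r, p) * Y k p)" if "\<And>k. Ck_on k G W" for G :: "real \<times> (real^'n) \<Rightarrow> real"
  proof -
    have "continuous_on ({0..L} \<times> sphere 0 1) G"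
      using that[of 0] W by (auto intro: continuous_on_subset simp: cyl_def)
    moreover have "continuous_on ({0..L} \<times> sphere 0 1) (\<lambda>q. Y k (snd q))"
      by (rule continuous_on_compose2[OF Y_continuous continuous_on_snd[OF continuous_on_id]]) auto
    ultimately show ?thesis unfolding case_prod_beta by (simp add: continuous_on_mult)
  qed
  show "continuous_on {0..L} (\<lambda>r. sph_int (\<lambda>p. F (r, p) * Y k p))"
    by (rule sph_int_continuous[OF c[OF F]])
  show "((\<lambda>r. sph_int (\<lambda>p. F (r, p) * Y k p)) has_real_derivative sph_int (\<lambda>p. dir_deriv F (1, 0) (r, p) * Y k p)) (at r)"
    if r: "0 < r" "r < L"
  proof (rule sph_int_has_derivative[OF _ _ c[OF Ck_on_dir_deriv(1)[OF F]] r])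
    show "((\<lambda>t. F (t, p) * Y k p) has_real_derivative dir_deriv F (1, 0) (t, p) * Y k p) (at t)" if "t \<in> {0..L}" "norm p = 1" for t p
    proof -
      have "(t, p) \<in> W" using W that by (auto simp: cyl_def)
      note D = Ck_on_dir_deriv(2)[OF F this]
      have g1: "((\<lambda>t. (t, p)) has_derivative (\<lambda>t. (t, 0))) (at t)"
        by (auto intro!: derivative_eq_intros)
      have "((\<lambda>t. F (t, p)) has_derivative (\<lambda>x. dir_deriv F (x, 0) (t, p))) (at t)"
        using diff_chain_at[OF g1 D] by (simp add: o_def)
      moreover have "(\<lambda>x. dir_deriv F (x, 0) (t, p)) = (*) (dir_deriv F (1, 0) (t, p))"
      proof
        show "dir_deriv F (x, 0) (t, p) = dir_deriv F (1, 0) (t, p) * x" for x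
          using linear_scale[OF has_derivative_linear[OF D], of x "(1, 0)"] by simp
      qed
      ultimately have "((\<lambda>t. F (t, p)) has_real_derivative dir_deriv F (1, 0) (t, p)) (at t)"
        by (simp add: has_field_derivative_def)
      then show ?thesis by (rule DERIV_cmult_right)
    qed
    show "continuous_on (sphere 0 1) (\<lambda>p. F (t, p) * Y k p)" if "t \<in> {0..L}" for t
      using continuous_on_compose2[OF c[OF F], of "sphere 0 1" "\<lambda>p. (t, p)"] that
      by (simp add: continuous_on_Pair image_subset_iff)
  qed
qed

text \<open>Symmetry moves the spherical Laplacian onto \<open>Y k\<close>, so the Fourier
  coefficients satisfy the radial system; \<open>P 0 = P L = 1\<close> turns normal derivatives into
  fluxes.\<close>

lemma eigenfunction_coefficient:
  fixes f :: "real \<times> (real^'n) \<Rightarrow> real"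
  assumes f: "f \<in> steklov_eigenspace L g \<tau>" and rep: "smooth_rep L f W F"
  defines "u \<equiv> \<lambda>k r. sph_int (\<lambda>p. F (r, p) * Y k p)"
  defines "v \<equiv> \<lambda>k r. P r * sph_int (\<lambda>p. dir_deriv F (1, 0) (r, p) * Y k p)"
  shows "sl_sol L P Q (lam k) (u k) (v k)" "- v k 0 = \<tau> * u k 0" "v k L = \<tau> * u k L"
proof -
  have W: "cyl L \<subseteq> W" and F: "\<And>k. Ck_on k F W" using rep by (auto simp: smooth_rep_def)
  note F' = Ck_on_dir_deriv(1)[OF F]
  define w where "w r = sph_int (\<lambda>p. dir_deriv F (1, 0) (r, p) * Y k p)" for r
  have vw: "v k = (\<lambda>r. P r * w r)" by (simp add: v_def w_def)
  note ee = f[unfolded eigenspace_iff[OF rep]]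
  have slice: "continuous_on (sphere 0 1) (\<lambda>p. G (r, p))" if "\<And>k. Ck_on k G W" "r \<in> {0..L}" for G :: "real \<times> (real^'n) \<Rightarrow> real" and r
    by (rule rot_C2_continuous[OF rot_C2_slice[OF that(1)]]) (use W that(2) in \<open>auto simp: cyl_def\<close>)
  have dw: "(w has_real_derivative - ((real CARD('n) - 1) * (deriv h r / h r)) * w r + lam k / (h r)\<^sup>2 * u k r) (at r)"
    if r: "0 < r" "r < L" for r
  proof -
    have rL: "r \<in> {0..L}" using r by simp
    have C2: "rot_C2 (\<lambda>p. F (r, p))" by (rule rot_C2_slice[OF F]) (use W r in \<open>auto simp: cyl_def\<close>)
    let ?c = "- ((real CARD('n) - 1) * (deriv h r / h r))"
    have "sph_int (\<lambda>p. dir_deriv (dir_deriv F (1, 0)) (1, 0) (r, p) * Y k p)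
       = sph_int (\<lambda>p. ?c * (dir_deriv F (1, 0) (r, p) * Y k p) + (- 1 / (h r)\<^sup>2) * (sph_lap (\<lambda>p. F (r, p)) p * Y k p))"
    proof (rule sph_int_cong)
      fix p :: "real^'n" assume "norm p = 1"
      then have "warped_lap h F r p = 0" using ee r by blast
      then have "dir_deriv (dir_deriv F (1, 0)) (1, 0) (r, p) = ?c * dir_deriv F (1, 0) (r, p) + (- 1 / (h r)\<^sup>2) * sph_lap (\<lambda>p. F (r, p)) p"
        unfolding warped_lap_def by simp
      then show "dir_deriv (dir_deriv F (1, 0)) (1, 0) (r, p) * Y k p
        = ?c * (dir_deriv F (1, 0) (r, p) * Y k p) + (- 1 / (h r)\<^sup>2) * (sph_lap (\<lambda>p. F (r, p)) p * Y k p)"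
        by (simp only: distrib_right mult.assoc)
    qed
    also have "\<dots> = sph_int (\<lambda>p. ?c * (dir_deriv F (1, 0) (r, p) * Y k p)) + sph_int (\<lambda>p. (- 1 / (h r)\<^sup>2) * (sph_lap (\<lambda>p. F (r, p)) p * Y k p))"
      by (intro sph_int_add continuous_on_mult_left continuous_on_mult slice[OF F' rL] Y_continuous continuous_on_sph_lap[OF C2])
    also have "\<dots> = ?c * w r + (- 1 / (h r)\<^sup>2) * sph_int (\<lambda>p. sph_lap (\<lambda>p. F (r, p)) p * Y k p)"
      unfolding sph_int_cmult w_def ..
    also have "sph_int (\<lambda>p. sph_lap (\<lambda>p. F (r, p)) p * Y k p) = sph_int (\<lambda>p. F (r, p) * sph_lap (Y k) p)"
      by (rule sph_lap_symmetric[OF C2 Y_facts(2)])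
    also have "\<dots> = sph_int (\<lambda>p. - lam k * (F (r, p) * Y k p))"
      by (rule sph_int_cong) (simp add: Y_facts(3))
    also have "\<dots> = - lam k * u k r" unfolding sph_int_cmult u_def ..
    finally have "sph_int (\<lambda>p. dir_deriv (dir_deriv F (1, 0)) (1, 0) (r, p) * Y k p) = ?c * w r + lam k / (h r)\<^sup>2 * u k r"
      by simp
    then show ?thesis
      using slice_has_derivative(2)[OF W F' r, of "(1, 0)" k] unfolding w_def[abs_def] by simp
  qed
  show "sl_sol L P Q (lam k) (u k) (v k)"
    unfolding sl_sol_def
  proof (intro conjI allI impI)
    show "continuous_on {0..L} (u k)" unfolding u_def by (rule slice_has_derivative(1)[OF W F])
    show "continuous_on {0..L} (v k)"
      unfolding v_def by (intro continuous_on_mult cont_p slice_has_derivative(1)[OF W F'])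
    fix r assume r: "0 < r" "r < L"
    then have rA: "r \<in> {A<..<B}" using AB by auto
    have "v k r / P r = sph_int (\<lambda>p. dir_deriv F (1, 0) (r, p) * Y k p)"
      using PQ(2)[OF rA] by (simp add: v_def)
    then show "(u k has_real_derivative v k r / P r) (at r)"
      unfolding u_def using slice_has_derivative(2)[OF W F r, of k] by simp
    have "(real CARD('n) - 1) * (deriv h r / h r) * P r * w r + (- ((real CARD('n) - 1) * (deriv h r / h r)) * w r + lam k / (h r)\<^sup>2 * u k r) * P r
       = lam k * (P r / (h r)\<^sup>2) * u k r"
      by (simp add: algebra_simps)
    also have "P r / (h r)\<^sup>2 = Q r" using PQ(1)[OF rA] h_pos[OF rA] by simp
    finally show "(v k has_real_derivative lam k * Q r * u k r) (at r)"
      unfolding vw using DERIV_mult[OF P_deriv[OF rA] dw[OF r]] by simp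
  qed
  have bd: "sph_int (\<lambda>p. a * (dir_deriv F (1, 0) (r, p) * Y k p)) = sph_int (\<lambda>p. \<tau> * (F (r, p) * Y k p))"
    if "\<And>p. norm p = 1 \<Longrightarrow> a * dir_deriv F (1, 0) (r, p) = \<tau> * F (r, p)" for a r
    by (rule sph_int_cong) (simp only: mult.assoc[symmetric] that)
  have "sph_int (\<lambda>p. (- 1) * (dir_deriv F (1, 0) (0, p) * Y k p)) = sph_int (\<lambda>p. \<tau> * (F (0, p) * Y k p))"
    by (rule bd) (use ee in simp)
  then show "- v k 0 = \<tau> * u k 0"
    unfolding sph_int_cmult by (simp add: v_def u_def P_def h_ends)
  have "sph_int (\<lambda>p. 1 * (dir_deriv F (1, 0) (L, p) * Y k p)) = sph_int (\<lambda>p. \<tau> * (F (L, p) * Y k p))"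
    by (rule bd) (use ee in simp)
  then show "v k L = \<tau> * u k L"
    unfolding sph_int_cmult by (simp add: v_def u_def P_def h_ends)
qed

text \<open>Only modes of eigenvalue \<open>\<tau>\<close> contribute, and there are finitely many,
  so completeness of the harmonics gives a pointwise finite expansion with no question of
  convergence.\<close>

lemma eigenfunction_expansion:
  assumes f: "f \<in> steklov_eigenspace L g \<tau>"
  shows "\<exists>c. \<forall>q. f q = (\<Sum>i\<in>{i. val i = \<tau>}. c i * mode_fn i q)"
proof -
  obtain W F where rep: "smooth_rep L f W F" using eigenspaceE[OF f] .
  have W: "cyl L \<subseteq> W" and F: "\<And>k. Ck_on k F W" and fF: "\<And>q. q \<in> cyl L \<Longrightarrow> f q = F q"
    using rep by (auto simp: smooth_rep_def)
  define u where "u k r = sph_int (\<lambda>p. F (r, p) * Y k p)" for k r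
  define v where "v k r = P r * sph_int (\<lambda>p. dir_deriv F (1, 0) (r, p) * Y k p)" for k r
  have u: "sl_sol L P Q (lam k) (u k) (v k)" "- v k 0 = \<tau> * u k 0" "v k L = \<tau> * u k L" for k
    using eigenfunction_coefficient[OF f rep, of k] by (simp_all add: u_def[abs_def] v_def[abs_def])
  define N where "N k = sph_int (\<lambda>p. Y k p * Y k p)" for k
  have N: "N k > 0" for k unfolding N_def by (rule Y_facts)
  define b where "b k e = u k 0 * U k e 0 + u k L * U k e L" for k e
  define J where "J = {i. val i = \<tau>}"
  have J: "finite J" unfolding J_def by (rule finite_subset[OF _ finite_sublevel[of \<tau>]]) auto
  \<comment> \<open>The Wronskian with the mode \<open>(k, e)\<close> gives
    \<open>(\<tau> - \<mu> k e) * b k e = 0\<close>.\<close>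
  have b0: "b k e = 0" if "(k, e) \<notin> J" for k e
  proof -
    have "v k L * U k e L - V k e L * u k L = v k 0 * U k e 0 - V k e 0 * u k 0"
      by (rule sl_sol_wronskian[OF u(1) UV(1)])
    moreover have "v k 0 = - \<tau> * u k 0" "V k e 0 = - \<mu> k e * U k e 0"
      using u(2)[of k] UV(2)[of k e] by auto
    ultimately have "(\<tau> - \<mu> k e) * b k e = 0"
      unfolding u(3) UV(3) by (simp add: b_def algebra_simps)
    then show ?thesis using that by (auto simp: J_def)
  qed
  define c where "c i = b (fst i) (snd i) / N (fst i)" for i
  have main: "F (r, p) - (\<Sum>i\<in>J. c i * U (fst i) (snd i) r * Y (fst i) p) = 0" if r: "r \<in> {0..L}" and p: "norm p = 1" for r p
  proof (rule Y_complete[OF _ _ p])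
    have cF: "continuous_on (sphere 0 1) (\<lambda>p. F (r, p))"
      by (rule rot_C2_continuous[OF rot_C2_slice[OF F]]) (use W r in \<open>auto simp: cyl_def\<close>)
    then show "continuous_on (sphere 0 1) (\<lambda>p. F (r, p) - (\<Sum>i\<in>J. c i * U (fst i) (snd i) r * Y (fst i) p))"
      by (intro continuous_intros Y_continuous)
    fix m
    have "sph_int (\<lambda>p. (F (r, p) - (\<Sum>i\<in>J. c i * U (fst i) (snd i) r * Y (fst i) p)) * Y m p)
      = sph_int (\<lambda>p. F (r, p) * Y m p - (\<Sum>i\<in>J. (c i * U (fst i) (snd i) r) * (Y (fst i) p * Y m p)))"
      by (simp add: left_diff_distrib sum_distrib_right mult.assoc)
    also have "\<dots> = u m r - sph_int (\<lambda>p. \<Sum>i\<in>J. (c i * U (fst i) (snd i) r) * (Y (fst i) p * Y m p))"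
      unfolding u_def by (intro sph_int_diff continuous_intros Y_continuous cF)
    also have "sph_int (\<lambda>p. \<Sum>i\<in>J. (c i * U (fst i) (snd i) r) * (Y (fst i) p * Y m p))
      = (\<Sum>i\<in>J. (c i * U (fst i) (snd i) r) * sph_int (\<lambda>p. Y (fst i) p * Y m p))"
      unfolding sph_int_cmult[symmetric] by (intro sph_int_sum continuous_intros Y_continuous)
    also have "\<dots> = (\<Sum>i\<in>J. if fst i = m then b m (snd i) * U m (snd i) r else 0)"
      using N[of m] by (intro sum.cong refl) (auto simp: Y_facts(4) c_def N_def[symmetric])
    \<comment> \<open>Both modes over m are added, with zero terms if absent from \<open>J\<close>,
      to match the two-term expansion of the radial coefficient.\<close>
    also have "\<dots> = (\<Sum>i\<in>J \<union> {(m, False), (m, True)}. if fst i = m then b m (snd i) * U m (snd i) r else 0)"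
      by (rule sum.mono_neutral_left) (use J b0 in auto)
    also have "\<dots> = (\<Sum>i\<in>{(m, False), (m, True)}. if fst i = m then b m (snd i) * U m (snd i) r else 0)"
    proof (rule sum.mono_neutral_right)
      have "i \<in> {(m, False), (m, True)}" if "fst i = m" for i
        using that by (cases i; cases "snd i") auto
      then show "\<forall>i\<in>(J \<union> {(m, False), (m, True)}) - {(m, False), (m, True)}. (if fst i = m then b m (snd i) * U m (snd i) r else 0) = 0"
        by auto
    qed (use J in auto)
    also have "\<dots> = u m r"
      using sl_eigen_expand(1)[OF eigen u(1) lam_nonneg r] by (simp add: b_def)
    finally show "sph_int (\<lambda>p. (F (r, p) - (\<Sum>i\<in>J. c i * U (fst i) (snd i) r * Y (fst i) p)) * Y m p) = 0" by simp
  qed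
  have "f q = (\<Sum>i\<in>J. c i * mode_fn i q)" for q
  proof (cases "q \<in> cyl L")
    case True
    then have "fst q \<in> {0..L}" "norm (snd q) = 1" by (auto simp: cyl_def)
    from main[OF this] fF[OF True] True show ?thesis
      by (simp add: mode_fn_def mult.assoc)
  next
    case False
    then have "f q = 0" using f unfolding steklov_eigenspace_def by blast
    then show ?thesis using False by (simp add: mode_fn_def)
  qed
  then show ?thesis unfolding J_def by blast
qed

lemma eigenspace_dim: "has_finite_dim (steklov_eigenspace L g \<tau>) (card {i. val i = \<tau>})"
proof -
  let ?J = "{i. val i = \<tau>}"
  have J: "finite ?J" by (rule finite_subset[OF _ finite_sublevel[of \<tau>]]) auto
  have "\<forall>j\<in>?J. c j = 0" if "\<And>q. (\<Sum>i\<in>?J. c i * mode_fn i q) = 0" for c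
    using modes_independent[OF J that] by blast
  note ind = independent_family[OF J, of mode_fn, OF this]
  have "fun_space.span (mode_fn ` ?J) = steklov_eigenspace L g \<tau>"
  proof
    have "fun_space.subspace (steklov_eigenspace L g \<tau>)"
    proof (rule fun_space.subspaceI)
      show "0 \<in> steklov_eigenspace L g \<tau>" using zero_in_eigenspace by (simp add: zero_fun_def)
      show "x + y \<in> steklov_eigenspace L g \<tau>" if "x \<in> steklov_eigenspace L g \<tau>" "y \<in> steklov_eigenspace L g \<tau>" for x y
        using eigenspace_lincomb[OF that, of 1 1] by (simp add: plus_fun_def)
      show "(\<lambda>q. c * x q) \<in> steklov_eigenspace L g \<tau>" if "x \<in> steklov_eigenspace L g \<tau>" for c x
        using eigenspace_lincomb[OF that that, of c 0] by simp
    qed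
    moreover have "mode_fn ` ?J \<subseteq> steklov_eigenspace L g \<tau>"
      using mode_fn_in_eigenspace by auto
    ultimately show "fun_space.span (mode_fn ` ?J) \<subseteq> steklov_eigenspace L g \<tau>"
      by (rule fun_space.span_minimal[rotated])
    show "steklov_eigenspace L g \<tau> \<subseteq> fun_space.span (mode_fn ` ?J)"
    proof
      fix f assume "f \<in> steklov_eigenspace L g \<tau>"
      then obtain c where "\<And>q. f q = (\<Sum>i\<in>?J. c i * mode_fn i q)"
        using eigenfunction_expansion by blast
      then have "f = (\<Sum>i\<in>?J. (\<lambda>q. c i * mode_fn i q))"
        by (simp add: fun_eq_iff sum_fun_apply)
      also have "\<dots> \<in> fun_space.span (mode_fn ` ?J)"
        by (intro fun_space.span_sum fun_space.span_scale fun_space.span_base) auto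
      finally show "f \<in> fun_space.span (mode_fn ` ?J)" .
    qed
  qed
  then show ?thesis
    unfolding has_finite_dim_def using ind J
    by (intro exI[of _ "mode_fn ` ?J"]) (auto simp: card_image)
qed

end

section \<open>Uniqueness of the spectrum and comparison of two metrics\<close>

lemma has_finite_dim_unique:
  assumes "has_finite_dim V d" "has_finite_dim V d'"
  shows "d = d'"
proof -
  obtain B where B: "finite B" "card B = d" "fun_space.independent B" "fun_space.span B = V"
    using assms(1) unfolding has_finite_dim_def by auto
  obtain B' where B': "finite B'" "card B' = d'" "fun_space.independent B'" "fun_space.span B' = V"
    using assms(2) unfolding has_finite_dim_def by auto
  have "B \<subseteq> fun_space.span B'" "B' \<subseteq> fun_space.span B"
    using fun_space.span_superset[of B] fun_space.span_superset[of B'] B(4) B'(4) by auto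
  then show ?thesis
    using fun_space.independent_span_bound[OF B'(1) B(3)] fun_space.independent_span_bound[OF B(1) B'(3)] B(2) B'(2)
    by auto
qed

text \<open>Multiplicities are dimensions, hence fixed by the eigenspaces, and they determine a
  sorted sequence; so the definite description denotes any sequence that satisfies it.\<close>

lemma steklov_eigenvalue_eqI:
  assumes "steklov_spectrum L g s"
  shows "steklov_eigenvalue L g k = s k"
proof -
  have "(THE s. steklov_spectrum L g s) = s"
  proof (rule the_equality)
    show "steklov_spectrum L g s" by (rule assms)
  next
    fix s' assume s': "steklov_spectrum L g s'"
    have "card {k. s' k = \<tau>} = card {k. s k = \<tau>}" for \<tau>
      using assms s' has_finite_dim_unique unfolding steklov_spectrum_def by blast
    then show "s' = s"
      using assms s' sorted_sequence_unique unfolding steklov_spectrum_def by blast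
  qed
  then show ?thesis by (simp add: steklov_eigenvalue_def)
qed

context steklov_modes
begin

lemma steklov_eigenvalue_sorted:
  assumes e: "bij_betw e UNIV UNIV" "mono (val \<circ> e)"
  shows "steklov_eigenvalue L g k = val (e k)"
proof -
  have "filterlim (val \<circ> e) at_top sequentially"
    unfolding filterlim_at_top
  proof
    fix Z
    have "e ` {k. val (e k) \<le> Z} \<subseteq> {i. val i \<le> Z}" by auto
    then have "finite (e ` {k. val (e k) \<le> Z})" using finite_sublevel finite_subset by blast
    then have "finite {k. val (e k) \<le> Z}"
      using e(1) by (elim finite_imageD) (auto simp: bij_betw_def intro: inj_on_subset)
    then have "\<forall>\<^sub>F k in sequentially. \<not> val (e k) \<le> Z"
      by (simp add: cofinite_eq_sequentially[symmetric] eventually_cofinite)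
    then show "\<forall>\<^sub>F k in sequentially. Z \<le> (val \<circ> e) k"
      by eventually_elim simp
  qed
  moreover have "card {k. (val \<circ> e) k = \<tau>} = card {i. val i = \<tau>}" for \<tau>
  proof -
    have "bij_betw e {k. (val \<circ> e) k = \<tau>} {i. val i = \<tau>}"
    proof (rule bij_betw_subset[OF e(1)])
      show "e ` {k. (val \<circ> e) k = \<tau>} = {i. val i = \<tau>}"
      proof (intro equalityI subsetI)
        fix i assume "i \<in> {i. val i = \<tau>}"
        moreover obtain k where "i = e k" using e(1) unfolding bij_betw_def by auto
        ultimately show "i \<in> e ` {k. (val \<circ> e) k = \<tau>}" by auto
      qed auto
    qed simp
    then show ?thesis by (rule bij_betw_same_card)
  qed
  ultimately have "steklov_spectrum L g (val \<circ> e)"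
    using e(2) eigenspace_dim unfolding steklov_spectrum_def by auto
  then show ?thesis by (simp add: steklov_eigenvalue_eqI)
qed

end

text \<open>An extension may fail to be positive away from [0, L]; openness of the set where it is
  positive leaves a margin at each end.\<close>

lemma smooth_on_interval_extend:
  fixes h :: "real \<Rightarrow> real"
  assumes "smooth_on h {0..L}" "0 < L" and pos: "\<And>r. r \<in> {0..L} \<Longrightarrow> 0 < h r"
  obtains H A B where "A < 0" "L < B" "\<And>k. Ck_on k H {A<..<B}" "\<And>r. r \<in> {A<..<B} \<Longrightarrow> 0 < H r"
    "\<And>r. r \<in> {0..L} \<Longrightarrow> H r = h r"
proof -
  obtain U H where U: "open U" "{0..L} \<subseteq> U" and H: "\<And>k. Ck_on k H U" and eq: "\<And>r. r \<in> {0..L} \<Longrightarrow> H r = h r"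
    using assms(1) unfolding smooth_on_def by metis
  have op: "open (U \<inter> H -` {0<..})"
    using H[of 0] by (intro continuous_open_preimage U) auto
  have sub: "{0..L} \<subseteq> U \<inter> H -` {0<..}" using U(2) eq pos by auto
  then have "0 \<in> U \<inter> H -` {0<..}" "L \<in> U \<inter> H -` {0<..}" using \<open>0 < L\<close> by (auto simp: subset_iff)
  then obtain d0 d1 where d: "0 < d0" "ball 0 d0 \<subseteq> U \<inter> H -` {0<..}" "0 < d1" "ball L d1 \<subseteq> U \<inter> H -` {0<..}"
    by (metis openE[OF op])
  have "{- d0<..<L + d1} \<subseteq> ball 0 d0 \<union> {0..L} \<union> ball L d1"
    by (auto simp: dist_real_def)
  then have *: "{- d0<..<L + d1} \<subseteq> U \<inter> H -` {0<..}" using d sub by blast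
  show ?thesis
    by (rule that[of "- d0" "L + d1" H]) (use d * eq in \<open>auto intro: Ck_on_subset[OF H]\<close>)
qed

lemma steklov_modes_exist:
  fixes g :: "'n::finite metric_tensor"
  assumes card: "3 \<le> CARD('n)" and L: "0 < L" and h: "smooth_on h {0..L}" "\<And>r. r \<in> {0..L} \<Longrightarrow> 0 < h r" "h 0 = 1" "h L = 1"
    and g: "induced_by L h g" and Y: "harmonic_basis (Y :: nat \<Rightarrow> real^'n \<Rightarrow> real) lam"
  shows "\<exists>H A B \<mu> U V P Q. steklov_modes L A B H g Y lam \<mu> U V P Q \<and> (\<forall>r\<in>{0..L}. H r = h r)"
proof -
  obtain H A B where AB: "A < 0" "L < B" and H: "\<And>k. Ck_on k H {A<..<B}" "\<And>r. r \<in> {A<..<B} \<Longrightarrow> 0 < H r"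
    and eq: "\<And>r. r \<in> {0..L} \<Longrightarrow> H r = h r"
    using smooth_on_interval_extend[OF h(1) L h(2)] by metis
  define P where "P = (\<lambda>r. H r ^ (CARD('n) - 1))"
  define Q where "Q = (\<lambda>r. H r ^ (CARD('n) - 3))"
  have lam: "0 \<le> lam k" for k
    using Y unfolding harmonic_basis_def by (cases "k = 0") (auto intro: less_imp_le)
  have CP: "Ck_on k P {A<..<B}" and CQ: "Ck_on k Q {A<..<B}" for k
    unfolding P_def Q_def by (intro Ck_on_power H; simp)+
  have pos: "0 < P r" "0 < Q r" if "r \<in> {A<..<B}" for r
    using H(2)[OF that] by (simp_all add: P_def Q_def)
  have "\<forall>k. \<exists>\<mu> U V. sl_eigen L P Q (lam k) \<mu> U V \<and>
     (\<exists>a b. a < 0 \<and> L < b \<and> (\<forall>e j. Ck_on j (U e) {a<..<b}) \<and> (\<forall>e. \<forall>r\<in>{a<..<b}. (U e has_real_derivative V e r / P r) (at r)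
          \<and> (V e has_real_derivative lam k * Q r * U e r) (at r)))"
    using sl_eigen_exists[OF AB(1) L AB(2) CP CQ pos lam] by blast
  then obtain \<mu> U V where "\<forall>k. sl_eigen L P Q (lam k) (\<mu> k) (U k) (V k) \<and>
     (\<exists>a b. a < 0 \<and> L < b \<and> (\<forall>e j. Ck_on j (U k e) {a<..<b}) \<and> (\<forall>e. \<forall>r\<in>{a<..<b}. (U k e has_real_derivative V k e r / P r) (at r)
          \<and> (V k e has_real_derivative lam k * Q r * U k e r) (at r)))"
    by metis
  moreover have "induced_by L H g"
    using g eq unfolding induced_by_def by (auto simp: cyl_def)
  ultimately have "steklov_modes L A B H g Y lam \<mu> U V P Q"
    using card L AB H Y h eq by unfold_locales (auto simp: P_def Q_def)
  with eq show ?thesis by blast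
qed

theorem theorem2:
  fixes L :: real and g\<^sub>1 :: "'n::finite metric_tensor"
  assumes "CARD('n) \<ge> 3" and "L > 0" and "metric_of_revolution L g\<^sub>1"
  shows "\<exists>g\<^sub>2 :: 'n metric_tensor. metric_of_revolution L g\<^sub>2 \<and>
           (\<forall>k\<ge>1. steklov_eigenvalue L g\<^sub>1 k < steklov_eigenvalue L g\<^sub>2 k)"
proof -
  obtain h where h: "smooth_on h {0..L}" "\<And>r. r \<in> {0..L} \<Longrightarrow> 0 < h r"
    "\<And>r. r \<in> {0..L} \<Longrightarrow> \<exists>d. (h has_real_derivative d) (at r within {0..L}) \<and> \<bar>d\<bar> \<le> 1"
    "h 0 = 1" "h L = 1" and g1: "induced_by L h g\<^sub>1"
    using assms(3) unfolding metric_of_revolution_def by auto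
  obtain k r0 where k: "smooth_on k {0..L}" "k 0 = 1" "k L = 1"
    "\<And>r. r \<in> {0..L} \<Longrightarrow> \<exists>d. (k has_real_derivative d) (at r within {0..L}) \<and> \<bar>d\<bar> \<le> 1"
    "\<And>r. r \<in> {0..L} \<Longrightarrow> h r \<le> k r" and r0: "0 < r0" "r0 < L" "h r0 < k r0"
    using larger_profile_exists[OF assms(2) h(4,5,3)] by metis
  have kpos: "0 < k r" if "r \<in> {0..L}" for r
    using h(2)[OF that] k(5)[OF that] by linarith
  define g\<^sub>2 :: "'n metric_tensor" where "g\<^sub>2 q v w = fst v * fst w + (k (fst q))\<^sup>2 * (snd v \<bullet> snd w)" for q v w
  have g2: "induced_by L k g\<^sub>2" by (auto simp: induced_by_def g\<^sub>2_def)
  have m2: "metric_of_revolution L g\<^sub>2"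
    unfolding metric_of_revolution_def using k kpos g2 by (intro exI[of _ k]) auto
  \<comment> \<open>One basis of harmonics for both metrics, so that modes with the same index are
    comparable.\<close>
  obtain Y :: "nat \<Rightarrow> real^'n \<Rightarrow> real" and lam where Y: "harmonic_basis Y lam"
    using harmonic_basis_exists assms(1) by (metis Suc_leD numeral_3_eq_3 numeral_2_eq_2)
  obtain H A B \<mu> U V P Q where M1: "steklov_modes L A B H g\<^sub>1 Y lam \<mu> U V P Q" and H: "\<And>r. r \<in> {0..L} \<Longrightarrow> H r = h r"
    using steklov_modes_exist[OF assms(1,2) h(1,2,4,5) g1 Y] by blast
  obtain H' A' B' \<mu>' U' V' P' Q' where M2: "steklov_modes L A' B' H' g\<^sub>2 Y lam \<mu>' U' V' P' Q'" and H': "\<And>r. r \<in> {0..L} \<Longrightarrow> H' r = k r"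
    using steklov_modes_exist[OF assms(1,2) k(1) kpos k(2,3) g2 Y] by blast
  interpret m1: steklov_modes L A B H g\<^sub>1 Y lam \<mu> U V P Q by (rule M1)
  interpret m2: steklov_modes L A' B' H' g\<^sub>2 Y lam \<mu>' U' V' P' Q' by (rule M2)
  have inf: "infinite (UNIV :: (nat \<times> bool) set)" by (simp add: finite_prod)
  have "finite {i \<in> UNIV. \<mu> (fst i) (snd i) \<le> t}" "finite {i \<in> UNIV. \<mu>' (fst i) (snd i) \<le> t}" for t
    using m1.finite_sublevel[of t] m2.finite_sublevel[of t] by simp_all
  note fin = this
  obtain e :: "nat \<Rightarrow> nat \<times> bool" where e: "bij_betw e UNIV UNIV" "mono ((\<lambda>i. \<mu> (fst i) (snd i)) \<circ> e)"
    by (rule sorted_enumeration[OF inf fin(1)]) blast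
  obtain e' :: "nat \<Rightarrow> nat \<times> bool" where e': "bij_betw e' UNIV UNIV" "mono ((\<lambda>i. \<mu>' (fst i) (snd i)) \<circ> e')"
    by (rule sorted_enumeration[OF inf fin(2)]) blast
  have le: "P r \<le> P' r \<and> Q r \<le> Q' r" if "r \<in> {0..L}" for r
    using h(2)[OF that] k(5)[OF that] H[OF that] H'[OF that]
    by (auto simp: m1.P_def m2.P_def m1.Q_def m2.Q_def intro!: power_mono)
  \<comment> \<open>The exponent n - 1 is positive, so strictness passes to \<open>P\<close>; for
    \<open>Q\<close> the exponent n - 3 may be 0.\<close>
  have "P r0 < P' r0"
    using h(2)[of r0] r0 H[of r0] H'[of r0] assms(1)
    by (auto simp: m1.P_def m2.P_def intro!: power_strict_mono)
  note cmp = sl_eigen_comparison[OF m1.sl_coeffs_axioms m2.sl_coeffs_axioms le r0(1,2) this m1.eigen m2.eigen m1.lam_nonneg]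
  \<comment> \<open>The index \<open>(0, False)\<close> belongs to the constants; the other index
    over 0 is \<open>True\<close>, which the comparison covers even for
    \<open>lam = 0\<close>.\<close>
  have less: "0 < \<mu> (fst i) (snd i) \<and> \<mu> (fst i) (snd i) < \<mu>' (fst i) (snd i)" if "i \<noteq> (0, False)" for i
  proof -
    obtain j d where i: "i = (j, d)" by (cases i)
    show ?thesis
    proof (cases "j = 0")
      case True
      then have d using that i by simp
      then show ?thesis
        using cmp[of j d] m1.sl_eigen_lam0(2)[of "\<mu> 0" "U 0" "V 0"] m1.eigen[of 0] m1.Y_facts(6) True i by simp
    next
      case False
      then have "0 < lam j" using m1.Y_facts(7)[of j] by simp
      then show ?thesis using cmp[of j d] m1.sl_eigen_pos[OF m1.eigen] i by simp
    qed
  qed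
  have zero: "\<mu> 0 False = 0" "\<mu>' 0 False = 0"
    using m1.sl_eigen_lam0(1)[of "\<mu> 0" "U 0" "V 0"] m1.eigen[of 0] m2.sl_eigen_lam0(1)[of "\<mu>' 0" "U' 0" "V' 0"] m2.eigen[of 0] m1.Y_facts(6)
    by simp_all
  have "steklov_eigenvalue L g\<^sub>1 j < steklov_eigenvalue L g\<^sub>2 j" if "1 \<le> j" for j
    unfolding m1.steklov_eigenvalue_sorted[OF e] m2.steklov_eigenvalue_sorted[OF e']
    by (rule sorted_enumeration_less[OF e e', of "(0, False)"]) (use zero less that in auto)
  with m2 show ?thesis by blast
qed

end
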